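(* In the setting of the context, put $C_{tr}=\max(4\|\beta\|_\infty,\tau^{-1})$. Given any $v_h,w_h\in\mathcal V^0$ the following two estimates hold: (i) $\displaystyle a_h^{DoD}(v_h,w_h)\le\sqrt{\frac{C_{tr}}{h}}\,|v_h|_\beta\,\|w_h\|_{L^2(\Omega)}$; (ii) $\displaystyle \|A_h^{DoD}v_h\|_{L^2(\Omega)}\le\sqrt{\frac{C_{tr}}{h}}\,|v_h|_\beta$, where $A_h^{DoD}$ is the operator with values in $\mathcal V^0$ defined by $(A_h^{DoD}v,w_h)_{L^2}=a_h^{DoD}(v,w_h)$ for all $w_h\in\mathcal V^0$.
   Context: **Geometry.** Let $L>0$, $0<x_0<L$, $0<\gamma<\pi/2$ with $(L-x_0)\tan\gamma<L$, and $\Omega=\{(x,y)\in(0,L)^2:\ y>(x-x_0)\tan\gamma\}$: a square from which a ramp of angle $\gamma$ is cut out; the ramp is the part of $\partial\Omega$ on the line $y=(x-x_0)\tan\gamma$. **Mesh.** The square is divided into a Cartesian background mesh of square cells $\widehat E$ of side length $h$; $\mathcal T_h$ is the set of all non-degenerate $E=\widehat E\cap\Omega$. The faces of a cell are its edges; $\mathcal F_i$ = interior faces (shared by two cells), $\mathcal F_b$ = faces on $\partial\Omega$, $\mathcal F=\mathcal F_i\cup\mathcal F_b$. $n_E$ is the outer unit normal of $E$; $|E|$ area, $|e|$ length. **Velocity.** $\beta:\overline\Omega\to\mathbb R^2$ is Lipschitz continuous, $\nabla\cdot\beta=0$, $\beta\cdot n=0$ along the ramp, $\beta$ does not vanish on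 the ramp, and the sign of $\beta\cdot n$ is constant along each face of the mesh. $\|\beta\|_\infty=\max_{x}|\beta(x)|_2$ (Euclidean norm). **Stabilized cut cells.** A triangular cut cell $E\in\mathcal T_h$ has a hypotenuse $e_{bdy}$ on the ramp, one inflow face $e_{in}=e_{in}(E)$ ($\beta\cdot n_E<0$) with neighbor $E_{in}$, and one outflow face $e_{out}=e_{out}(E)$ ($\beta\cdot n_E>0$) with neighbor $E_{out}$. $\mathcal I$ is the set of triangular cut cells with $\max(|e_{in}|,|e_{out}|)<\tfrac12h$; for $E\in\mathcal I$, $e_{in},e_{out}\notin\mathcal F_b$. $\mathcal F_{\setminus o}$ = faces that are not outflow faces $e_{out}$ of cells in $\mathcal I$; $\mathcal F_{\setminus io}$ = faces that are neither $e_{in}$ nor $e_{out}$ of cells in $\mathcal I$. With a fixed $\tau>0$, the capacity is $\alpha_E=\min\big(\frac{|E|}{\tau h\int_{e_{in}}|\beta\cdot n|},1\big)$. **Spaces, means, jumps.** $\mathcal V^0$ = functions in $L^2(\Omega)$ constant on each $E\in\mathcal T_h$; $\mathcal V^0_*=H^1(\Omega)+\mathcal V^0$. For $v\in\mathcal V^0_*$, a cell $E$ and a face $e\subset\partial E$, the $\beta$-weighted mean $\bar v_{E,e}\in\mathbb R$ is defined by $\bar v_{E,e}\int_e|\beta\cdot n|\,ds=\int_e|\beta\cdot n|\,\mathrm{tr}(v|_E)\,ds$ (irrelevant, say $0$, where $\beta\cdot n\equiv0$ on $e$; for $v\in\mathcal V^0$ it is the constant value $v|_E$). On an interior face $e$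 between $E_1,E_2$: $[\![\bar v]\!]=\bar v_{E_1,e}n_{E_1}+\bar v_{E_2,e}n_{E_2}$, and $\bar v^\uparrow$ is the mean $\bar v_{E_i,e}$ from the upwind cell, i.e. the $E_i$ with $\beta\cdot n_{E_i}>0$. On a boundary face of $E$: $[\![\bar v]\!]=\bar v_{E,e}n_E$, and $\bar v^\uparrow=\bar v_{E,e}$ if $\beta\cdot n_E>0$, $\bar v^\uparrow=0$ otherwise. $[\![\bar v]\!]^2=[\![\bar v]\!]\cdot[\![\bar v]\!]$. For $E\in\mathcal I$: $\bar v_{in}=\bar v_{E_{in},e_{in}}$, $\bar v_{out}=\bar v_{E_{out},e_{out}}$. **Bilinear form.** For $v\in\mathcal V^0_*$, $w_h\in\mathcal V^0$, $$a_h^{DoD}(v,w_h)=\sum_{e\in\mathcal F_{\setminus o}}\int_e\bar v^\uparrow\,\beta\cdot[\![\bar w_h]\!]+\sum_{E\in\mathcal I}\int_{e_{out}(E)}\big(\alpha_E\bar v^\uparrow+(1-\alpha_E)\bar v_{in}\big)\beta\cdot[\![\bar w_h]\!].$$ **Seminorm.** For $v\in\mathcal V^0_*$, $$|v|_\beta^2=\sum_{e\in\mathcal F_{\setminus io}}\int_e|\beta\cdot n|[\![\bar v]\!]^2+\sum_{E\in\mathcal I}\Big(\alpha_E\sum_{e\in\{e_{in}(E),e_{out}(E)\}}\int_e|\beta\cdot n|[\![\bar v]\!]^2+(1-\alpha_E)\int_{e_{out}(E)}|\beta\cdot n|(\bar v_{out}-\bar v_{in})^2\Big).$$ *)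

theory Defs
  imports "HOL-Analysis.Analysis"
begin

type_synonym plane = "real \<times> real"

text \<open>
  Arc length integral over a line segment. The value does not depend on which of the two
  parametrisations is chosen.
\<close>

definition seg_integral :: "plane set \<Rightarrow> (plane \<Rightarrow> real) \<Rightarrow> real" where
  "seg_integral e f =
     (let (a, b) = (SOME (a, b). e = closed_segment a b)
      in dist a b * integral {0..1} (\<lambda>t. f (a + t *\<^sub>R (b - a))))"

text \<open>One of the two unit normals of a segment; only used inside absolute values.\<close>

definition seg_normal :: "plane set \<Rightarrow> plane" where
  "seg_normal e = (SOME n. norm n = 1 \<and> (\<forall>x\<in>e. \<forall>y\<in>e. n \<bullet> (y - x) = 0))"

text \<open>
  The domain and the background cells are convex, so the closure of every cut cell is a convex
  polygon. Its faces are therefore its one-dimensional faces in the sense of convex geometry,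
  and the outer unit normal on such a face is the unit normal of the supporting line.
\<close>

definition cell_faces :: "plane set \<Rightarrow> plane set set" where
  "cell_faces E = {e. e edge_of closure E}"

definition outer_normal :: "plane set \<Rightarrow> plane set \<Rightarrow> plane" where
  "outer_normal E e = (THE n. norm n = 1 \<and> (\<forall>x\<in>e. \<forall>y\<in>E. n \<bullet> (y - x) \<le> 0))"

text \<open>
  Trace of \<open>v|\<^sub>E\<close> at boundary points, as limit of averages. On the faces of a convex polygon
  \<open>E\<close>, this is almost everywhere the Sobolev trace if \<open>v|\<^sub>E\<close> is in \<open>H\<^sup>1(E)\<close>, and it is the
  constant value of \<open>v|\<^sub>E\<close> if \<open>v\<close> is (almost everywhere) constant on \<open>E\<close>. Hence
  it covers the whole space \<open>H\<^sup>1(\<Omega>) + V\<^sup>0\<close> on which the bilinear form and the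
  seminorm live.
\<close>

definition cell_trace :: "plane set \<Rightarrow> (plane \<Rightarrow> real) \<Rightarrow> plane \<Rightarrow> real" where
  "cell_trace E v x =
     Lim (at_right 0) (\<lambda>r. (LINT y|lebesgue_on (E \<inter> ball x r). v y) / measure lebesgue (E \<inter> ball x r))"

locale dod_data =
  fixes L x0 \<gamma> h \<tau> :: real
    and \<beta> :: "plane \<Rightarrow> plane"
begin

definition Omega :: "plane set" where
  "Omega = {(x, y). 0 < x \<and> x < L \<and> 0 < y \<and> y < L \<and> y > (x - x0) * tan \<gamma>}"

definition ramp :: "plane set" where
  "ramp = {(x, y) \<in> frontier Omega. y = (x - x0) * tan \<gamma>}"

definition background_cells :: "plane set set" where
  "background_cells =
     {cbox (real i * h, real j * h) (real (Suc i) * h, real (Suc j) * h) | i j.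
        real (Suc i) * h \<le> L \<and> real (Suc j) * h \<le> L}"

definition cells :: "plane set set" where
  "cells = {E. (\<exists>B\<in>background_cells. E = B \<inter> Omega) \<and> measure lebesgue E > 0}"

definition interior_faces :: "plane set set" where
  "interior_faces =
     {e. \<exists>E1\<in>cells. \<exists>E2\<in>cells. E1 \<noteq> E2 \<and> e \<in> cell_faces E1 \<and> e \<in> cell_faces E2}"

definition boundary_faces :: "plane set set" where
  "boundary_faces = {e. (\<exists>E\<in>cells. e \<in> cell_faces E) \<and> e \<subseteq> frontier Omega}"

definition faces :: "plane set set" where
  "faces = interior_faces \<union> boundary_faces"

definition adjacent_cells :: "plane set \<Rightarrow> plane set set" where
  "adjacent_cells e = {E \<in> cells. e \<in> cell_faces E}"

text \<open>\<open>Omega\<close> is bounded, so for continuous \<open>\<beta>\<close> the supremum is a maximum.\<close>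

definition beta_max :: real where
  "beta_max = (SUP x\<in>closure Omega. norm (\<beta> x))"

text \<open>
  The velocity has no change of sign in its normal component along a face, but it may vanish at
  some points of the face. So \<open>\<beta> \<bullet> n\<^sub>E\<close> is regarded as negative (positive) on a face if it is
  so somewhere on the face.
\<close>

definition inflow :: "plane set \<Rightarrow> plane set \<Rightarrow> bool" where
  "inflow E e \<longleftrightarrow> (\<exists>x\<in>e. \<beta> x \<bullet> outer_normal E e < 0)"

definition outflow :: "plane set \<Rightarrow> plane set \<Rightarrow> bool" where
  "outflow E e \<longleftrightarrow> (\<exists>x\<in>e. \<beta> x \<bullet> outer_normal E e > 0)"

definition normal_speed :: "plane set \<Rightarrow> plane \<Rightarrow> real" where
  "normal_speed e x = \<bar>\<beta> x \<bullet> seg_normal e\<bar>"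

definition e_in :: "plane set \<Rightarrow> plane set" where
  "e_in E = (THE e. e \<in> cell_faces E \<and> inflow E e)"

definition e_out :: "plane set \<Rightarrow> plane set" where
  "e_out E = (THE e. e \<in> cell_faces E \<and> outflow E e)"

definition E_in :: "plane set \<Rightarrow> plane set" where
  "E_in E = (THE E'. E' \<in> cells \<and> E' \<noteq> E \<and> e_in E \<in> cell_faces E')"

definition E_out :: "plane set \<Rightarrow> plane set" where
  "E_out E = (THE E'. E' \<in> cells \<and> E' \<noteq> E \<and> e_out E \<in> cell_faces E')"

text \<open>
  A triangular cell is always a cut cell with its hypotenuse on the ramp. The length of a face
  is its diameter.
\<close>

definition stab_cells :: "plane set set" where
  "stab_cells = {E \<in> cells. 2 simplex closure E \<and>
     max (diameter (e_in E)) (diameter (e_out E)) < h / 2}"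

definition faces_no_out :: "plane set set" where
  "faces_no_out = faces - e_out ` stab_cells"

definition faces_no_inout :: "plane set set" where
  "faces_no_inout = faces - (e_in ` stab_cells \<union> e_out ` stab_cells)"

definition capacity :: "plane set \<Rightarrow> real" where
  "capacity E =
     min (measure lebesgue E / (\<tau> * h * seg_integral (e_in E) (normal_speed (e_in E)))) 1"

text \<open>
  Square integrable functions are represented by actual functions, so being constant on a
  cell is meant almost everywhere. Cells overlap in their common faces, so a
  pointwise condition would be wrong.
\<close>

definition L2 :: "(plane \<Rightarrow> real) set" where
  "L2 = {v \<in> borel_measurable (lebesgue_on Omega). integrable (lebesgue_on Omega) (\<lambda>x. (v x)\<^sup>2)}"

definition L2_inner :: "(plane \<Rightarrow> real) \<Rightarrow> (plane \<Rightarrow> real) \<Rightarrow> real" where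
  "L2_inner v w = (LINT x|lebesgue_on Omega. v x * w x)"

definition L2_norm :: "(plane \<Rightarrow> real) \<Rightarrow> real" where
  "L2_norm v = sqrt (LINT x|lebesgue_on Omega. (v x)\<^sup>2)"

definition V0 :: "(plane \<Rightarrow> real) set" where
  "V0 = {v \<in> L2. \<forall>E\<in>cells. \<exists>c. AE x in lebesgue_on E. v x = c}"

text \<open>Division by zero yields the value \<open>0\<close> where \<open>\<beta> \<bullet> n\<close> vanishes identically on the face.\<close>

definition wmean :: "(plane \<Rightarrow> real) \<Rightarrow> plane set \<Rightarrow> plane set \<Rightarrow> real" where
  "wmean v E e =
     seg_integral e (\<lambda>x. normal_speed e x * cell_trace E v x) / seg_integral e (normal_speed e)"

text \<open>
  An interior face has two adjacent cells and a boundary face has one, so both cases of the jump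
  are a sum over the adjacent cells. Likewise, at most one of the adjacent cells is upwind, and
  none is for a boundary face that is not an outflow face.
\<close>

definition jump :: "(plane \<Rightarrow> real) \<Rightarrow> plane set \<Rightarrow> plane" where
  "jump v e = (\<Sum>E\<in>adjacent_cells e. wmean v E e *\<^sub>R outer_normal E e)"

definition upwind :: "(plane \<Rightarrow> real) \<Rightarrow> plane set \<Rightarrow> real" where
  "upwind v e = (\<Sum>E | E \<in> adjacent_cells e \<and> outflow E e. wmean v E e)"

definition v_in :: "(plane \<Rightarrow> real) \<Rightarrow> plane set \<Rightarrow> real" where
  "v_in v E = wmean v (E_in E) (e_in E)"

definition v_out :: "(plane \<Rightarrow> real) \<Rightarrow> plane set \<Rightarrow> real" where
  "v_out v E = wmean v (E_out E) (e_out E)"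

definition a_DoD :: "(plane \<Rightarrow> real) \<Rightarrow> (plane \<Rightarrow> real) \<Rightarrow> real" where
  "a_DoD v w =
     (\<Sum>e\<in>faces_no_out. seg_integral e (\<lambda>x. upwind v e * (\<beta> x \<bullet> jump w e))) +
     (\<Sum>E\<in>stab_cells. seg_integral (e_out E)
        (\<lambda>x. (capacity E * upwind v (e_out E) + (1 - capacity E) * v_in v E)
              * (\<beta> x \<bullet> jump w (e_out E))))"

definition seminorm_beta :: "(plane \<Rightarrow> real) \<Rightarrow> real" where
  "seminorm_beta v = sqrt (
     (\<Sum>e\<in>faces_no_inout. seg_integral e (\<lambda>x. normal_speed e x * (jump v e \<bullet> jump v e))) +
     (\<Sum>E\<in>stab_cells.
        capacity E * (\<Sum>e\<in>{e_in E, e_out E}.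
           seg_integral e (\<lambda>x. normal_speed e x * (jump v e \<bullet> jump v e))) +
        (1 - capacity E) *
           seg_integral (e_out E) (\<lambda>x. normal_speed (e_out E) x * (v_out v E - v_in v E)\<^sup>2)))"

text \<open>\<open>A_DoD v\<close> is determined up to equality almost everywhere in \<open>Omega\<close>.\<close>

definition A_DoD :: "(plane \<Rightarrow> real) \<Rightarrow> plane \<Rightarrow> real" where
  "A_DoD v = (SOME u. u \<in> V0 \<and> (\<forall>w\<in>V0. L2_inner u w = a_DoD v w))"

definition C_tr :: real where
  "C_tr = max (4 * beta_max) (1 / \<tau>)"

end

text \<open>
  A Lipschitz continuous field is differentiable almost everywhere by Rademacher's theorem, and
  the divergence is the trace of its derivative; a solenoidal field is one for which it
  vanishes almost everywhere. The outer unit normal along the ramp is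
  \<open>(sin \<gamma>, - cos \<gamma>)\<close>.
\<close>

locale dod_setting = dod_data +
  assumes L_pos: "0 < L"
    and x0_range: "0 < x0" "x0 < L"
    and gamma_range: "0 < \<gamma>" "\<gamma> < pi / 2"
    and ramp_height: "(L - x0) * tan \<gamma> < L"
    and h_pos: "0 < h"
    and cartesian: "\<exists>N::nat. L = real N * h"
    and tau_pos: "0 < \<tau>"
    and beta_lipschitz: "\<exists>K. K-lipschitz_on (closure Omega) \<beta>"
    and beta_div_free: "AE x in lebesgue_on Omega.
          \<exists>D. (\<beta> has_derivative D) (at x) \<and> (\<Sum>b\<in>Basis. D b \<bullet> b) = 0"
    and beta_ramp: "\<And>x. x \<in> ramp \<Longrightarrow> \<beta> x \<bullet> (sin \<gamma>, - cos \<gamma>) = 0"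
    and beta_ramp_nonzero: "\<And>x. x \<in> ramp \<Longrightarrow> \<beta> x \<noteq> 0"
    and beta_sign: "\<And>E e. E \<in> cells \<Longrightarrow> e \<in> cell_faces E \<Longrightarrow>
          (\<forall>x\<in>e. \<beta> x \<bullet> outer_normal E e \<ge> 0) \<or> (\<forall>x\<in>e. \<beta> x \<bullet> outer_normal E e \<le> 0)"
    and stab_not_boundary: "\<And>E. E \<in> stab_cells \<Longrightarrow>
          e_in E \<notin> boundary_faces \<and> e_out E \<notin> boundary_faces"

end

theory Submission
  imports Defs
begin

text \<open>
  Since \<open>\<beta>\<close> is divergence free, the fluxes of \<open>\<beta>\<close> over the faces of a cell sum to zero. Hence the
  value of \<open>v\<close> on the cell can be subtracted from each numerical flux, and \<open>a_DoD v w\<close> becomes a sum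
  over cells of the value of \<open>w\<close> times a residual that contains only jumps over inflow faces. By
  the Cauchy-Schwarz inequality it remains to bound the total inflow of a cell by its area.
  On a stabilised cell the capacity does this. On any other cell the inflow equals the outflow,
  so it is at most \<open>beta_max\<close> times the length of any set of faces that contains all inflow
  faces or all outflow faces, and this is compared with the area of a trapezoid inside the cell.
  Testing the first estimate with \<open>w = A_DoD v\<close> gives the second.
\<close>

section \<open>Segments and normals\<close>

text \<open>The factor 4 in \<open>C_tr\<close> is used up in two situations: a full or pentagonal
  cell, with flux through possibly all four straight sides and area at least h^2/2, and a triangle
  with a leg of length just h/2, whose inflow is at most \<open>beta_max\<close> times the other
  leg. For smaller triangles the inflow is not controlled by area / h. There the stabilisation
  multiplies the residual by the capacity; the squared residual carries this factor twice and the
  seminorm only once, and the spare factor turns h times the inflow into at most area / \<tau>.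
  Downstream of a stabilised cell the flux value is a convex combination of two upstream values, and
  the seminorm contains exactly the two squares that convexity produces. A face with nonzero flux is
  an inflow face of at most one cell, so the local bounds add up without a multiplicity. The shapes
  of cells are treated together as a box cut by a line: the left and top faces always exist, while
  the right, bottom and ramp faces may be missing. Integrals over empty intervals are 0, so missing
  grid faces can stay in the flux balance.\<close>

lemma seg_integral_segment:
  "seg_integral (closed_segment a b) f = dist a b * integral {0..1} (\<lambda>t. f (a + t *\<^sub>R (b - a)))"
proof -
  define p where "p = (SOME (a', b'). closed_segment a b = closed_segment a' b')"
  have "case p of (a', b') \<Rightarrow> closed_segment a b = closed_segment a' b'"
    unfolding p_def by (rule someI[of _ "(a, b)"]) simp
  \<comment> \<open>A segment determines its endpoints up to order, so the chosen pair is
    \<open>(a, b)\<close> or \<open>(b, a)\<close>.\<close>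
  then have "{a, b} = {fst p, snd p}"
    by (cases p) simp
  then consider "fst p = a" "snd p = b" | "fst p = b" "snd p = a"
    by (metis doubleton_eq_iff)
  then show ?thesis
  proof cases
    case 1
    then have "p = (a, b)" by (simp add: prod_eq_iff)
    then show ?thesis unfolding seg_integral_def p_def[symmetric] by simp
  next
    case 2
    then have p: "p = (b, a)" by (simp add: prod_eq_iff)
    \<comment> \<open>Substitution of 1 - t for t, composed of a reflection and a shift by
      one.\<close>
    have "integral {0..1} (\<lambda>t. f (a + t *\<^sub>R (b - a)))
        = integral {-1..0} (\<lambda>t. f (a + (- t) *\<^sub>R (b - a)))"
      using Henstock_Kurzweil_Integration.integral_reflect_real[of 1 0 "\<lambda>t. f (a + t *\<^sub>R (b - a))"]
      by simp
    also have "\<dots> = integral {0..1} (\<lambda>t. f (a + (- (t - 1)) *\<^sub>R (b - a)))"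
      using integral_shift_real_ivl[of "-1" "-1" 0 "\<lambda>t. f (a + (- t) *\<^sub>R (b - a))"]
      by simp
    also have "\<dots> = integral {0..1} (\<lambda>t. f (b + t *\<^sub>R (a - b)))"
      by (rule arg_cong[where f="integral _"]) (simp add: fun_eq_iff algebra_simps)
    finally show ?thesis unfolding seg_integral_def p_def[symmetric] p
      by (simp add: dist_commute)
  qed
qed

lemma seg_integral_cong:
  assumes "\<And>x. x \<in> e \<Longrightarrow> f x = g x" and "\<exists>a b. e = closed_segment a b"
  shows "seg_integral e f = seg_integral e g"
proof -
  obtain a b where e: "e = closed_segment a b" using assms by blast
  have "f (a + t *\<^sub>R (b - a)) = g (a + t *\<^sub>R (b - a))" if "t \<in> {0..1}" for t
  proof -
    have "a + t *\<^sub>R (b - a) = (1 - t) *\<^sub>R a + t *\<^sub>R b" by (simp add: algebra_simps)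
    then have "a + t *\<^sub>R (b - a) \<in> e" using that unfolding e closed_segment_def by auto
    then show ?thesis by (rule assms(1))
  qed
  then show ?thesis
    unfolding e seg_integral_segment by (metis (no_types, lifting) integral_cong)
qed

text \<open>The affine substitution works in both directions, so it also preserves
  non-integrability, and then both sides are the default value 0. This spares side conditions
  whenever a face integral is rewritten.\<close>

lemma integral_interval_unit:
  fixes f :: "real \<Rightarrow> real"
  assumes "y1 < y2"
  shows "(y2 - y1) * integral {0..1} (\<lambda>t. f (y1 + t * (y2 - y1))) = integral {y1..y2} f"
proof -
  let ?m = "y2 - y1"
  have *: "((\<lambda>t. f (?m * t + y1)) has_integral (I / ?m)) {0..1} \<longleftrightarrow> (f has_integral I) {y1..y2}" for I
    using has_integral_affinity_iff[of ?m f y1 I y1 y2] assms by (simp add: divide_inverse mult.commute)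
  have c: "(\<lambda>t. f (y1 + t * (y2 - y1))) = (\<lambda>t. f (?m * t + y1))" by (simp add: fun_eq_iff algebra_simps)
  show ?thesis
  proof (cases "f integrable_on {y1..y2}")
    case True
    then obtain I where I: "(f has_integral I) {y1..y2}" by blast
    then have "((\<lambda>t. f (?m * t + y1)) has_integral (I / ?m)) {0..1}" using * by blast
    then show ?thesis using I assms unfolding c by (simp add: integral_unique)
  next
    case False
    moreover have "\<not> (\<lambda>t. f (?m * t + y1)) integrable_on {0..1}"
    proof
      assume "(\<lambda>t. f (?m * t + y1)) integrable_on {0..1}"
      then obtain J where J: "((\<lambda>t. f (?m * t + y1)) has_integral J) {0..1}" by blast
      then have "(f has_integral (J * ?m)) {y1..y2}" using *[of "J * ?m"] assms by simp
      then show False using False by blast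
    qed
    ultimately show ?thesis unfolding c by (simp add: not_integrable_integral)
  qed
qed

lemma closed_segment_vertical:
  assumes "y1 \<le> (y2::real)"
  shows "closed_segment (x::real, y1) (x, y2) = {x} \<times> {y1..y2}"
proof -
  have "closed_segment (x, y1) (x, y2) = Pair x ` closed_segment y1 y2"
  proof -
    have "(1 - u) * x + u * x = x" for u by (simp add: algebra_simps)
    then show ?thesis by (auto simp: in_segment image_iff)
  qed
  then show ?thesis using assms by (auto simp: closed_segment_eq_real_ivl)
qed

lemma seg_integral_vertical:
  assumes "y1 < y2"
  shows "seg_integral ({x} \<times> {y1..y2}) f = integral {y1..y2} (\<lambda>y. f (x, y))"
proof -
  have d: "dist (x, y1) (x, y2) = y2 - y1" using assms by (simp add: dist_Pair_Pair dist_real_def)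
  show ?thesis
    unfolding closed_segment_vertical[OF less_imp_le[OF assms], symmetric] seg_integral_segment d
    using integral_interval_unit[OF assms, of "\<lambda>y. f (x, y)"] by simp
qed

lemma closed_segment_horizontal:
  assumes "x1 \<le> (x2::real)"
  shows "closed_segment (x1, y::real) (x2, y) = {x1..x2} \<times> {y}"
proof -
  have "closed_segment (x1, y) (x2, y) = (\<lambda>x. (x, y)) ` closed_segment x1 x2"
  proof -
    have "(1 - u) * y + u * y = y" for u by (simp add: algebra_simps)
    then show ?thesis by (auto simp: in_segment image_iff)
  qed
  then show ?thesis using assms by (auto simp: closed_segment_eq_real_ivl)
qed

lemma seg_integral_horizontal:
  assumes "x1 < x2"
  shows "seg_integral ({x1..x2} \<times> {y}) f = integral {x1..x2} (\<lambda>x. f (x, y))"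
proof -
  have d: "dist (x1, y) (x2, y) = x2 - x1" using assms by (simp add: dist_Pair_Pair dist_real_def)
  show ?thesis
    unfolding closed_segment_horizontal[OF less_imp_le[OF assms], symmetric] seg_integral_segment d
    using integral_interval_unit[OF assms, of "\<lambda>x. f (x, y)"] by simp
qed

lemma seg_integral_mult_left: "seg_integral e (\<lambda>x. c * f x) = c * seg_integral e f"
  unfolding seg_integral_def by (simp add: case_prod_beta mult.left_commute)

lemma continuous_on_segment_param:
  fixes f :: "plane \<Rightarrow> real"
  assumes "continuous_on (closed_segment a b) f"
  shows "continuous_on {0..1} (\<lambda>t. f (a + t *\<^sub>R (b - a)))"
proof (rule continuous_on_compose2[OF assms])
  show "continuous_on {0..1} (\<lambda>t. a + t *\<^sub>R (b - a))" by (intro continuous_intros)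
  show "(\<lambda>t. a + t *\<^sub>R (b - a)) ` {0..1} \<subseteq> closed_segment a b"
  proof
    fix p assume "p \<in> (\<lambda>t. a + t *\<^sub>R (b - a)) ` {0..1}"
    then obtain t where "t \<in> {0..1}" "p = (1 - t) *\<^sub>R a + t *\<^sub>R b" by (auto simp: algebra_simps)
    then show "p \<in> closed_segment a b" unfolding closed_segment_def by auto
  qed
qed

lemma seg_integral_sum:
  assumes "finite A" and "\<exists>a b. e = closed_segment a b"
    and "\<And>k. k \<in> A \<Longrightarrow> continuous_on e (f k)"
  shows "seg_integral e (\<lambda>x. \<Sum>k\<in>A. f k x) = (\<Sum>k\<in>A. seg_integral e (f k))"
proof -
  obtain a b where e: "e = closed_segment a b" using assms by blast
  have "integral {0..1} (\<lambda>t. \<Sum>k\<in>A. f k (a + t *\<^sub>R (b - a)))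
      = (\<Sum>k\<in>A. integral {0..1} (\<lambda>t. f k (a + t *\<^sub>R (b - a))))"
    by (rule integral_sum[OF assms(1)])
      (rule integrable_continuous_real[OF continuous_on_segment_param[OF assms(3)[unfolded e]]])
  then show ?thesis unfolding e seg_integral_segment by (simp add: sum_distrib_left)
qed

lemma seg_integral_nonneg:
  assumes "\<And>x. x \<in> closed_segment a b \<Longrightarrow> 0 \<le> f x" "continuous_on (closed_segment a b) f"
  shows "0 \<le> seg_integral (closed_segment a b) f"
proof -
  have "0 \<le> f (a + t *\<^sub>R (b - a))" if "t \<in> {0..1}" for t
    by (rule assms(1)) (use that in \<open>auto simp: closed_segment_def algebra_simps intro!: exI[of _ t]\<close>)
  then show ?thesis unfolding seg_integral_segment
    by (intro mult_nonneg_nonneg integral_nonneg integrable_continuous_real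
        continuous_on_segment_param assms(2)) auto
qed

text \<open>A continuous nonnegative function with integral zero vanishes identically. This turns
  the pointwise definitions of \<open>inflow\<close> and \<open>outflow\<close> into signs of
  fluxes.\<close>

lemma seg_integral_pos:
  assumes "a \<noteq> b" "\<And>x. x \<in> closed_segment a b \<Longrightarrow> 0 \<le> f x" "continuous_on (closed_segment a b) f"
    and "z \<in> closed_segment a b" "0 < f z"
  shows "0 < seg_integral (closed_segment a b) f"
proof -
  let ?g = "\<lambda>t. f (a + t *\<^sub>R (b - a))"
  have g0: "0 \<le> ?g t" if "t \<in> {0..1}" for t
    by (rule assms(2)) (use that in \<open>auto simp: closed_segment_def algebra_simps intro!: exI[of _ t]\<close>)
  have cg: "continuous_on {0..1} ?g" by (rule continuous_on_segment_param[OF assms(3)])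
  obtain t where t: "0 \<le> t" "t \<le> 1" "z = (1 - t) *\<^sub>R a + t *\<^sub>R b"
    using assms(4) unfolding closed_segment_def by auto
  then have "z = a + t *\<^sub>R (b - a)" by (simp add: algebra_simps)
  then have "?g t > 0" using assms(5) by simp
  have "integral {0..1} ?g \<noteq> 0"
  proof
    assume "integral {0..1} ?g = 0"
    then have "(?g has_integral 0) (cbox 0 1)"
      using integrable_continuous_real[OF cg] by (metis cbox_interval integrable_integral)
    then have "?g t = 0"
      by (rule has_integral_0_cbox_imp_0[rotated 2]) (use cg g0 t in \<open>auto simp: content_real\<close>)
    with \<open>?g t > 0\<close> show False by simp
  qed
  moreover have "0 \<le> integral {0..1} ?g"
    by (intro integral_nonneg integrable_continuous_real cg) (use g0 in auto)
  ultimately show ?thesis unfolding seg_integral_segment using assms(1) by simp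
qed

section \<open>Unit normals of segments in the plane\<close>

lemma unit_orthogonal_unique:
  fixes \<nu> n d :: plane
  assumes "norm \<nu> = 1" "norm n = 1" "\<nu> \<bullet> d = 0" "n \<bullet> d = 0" "d \<noteq> 0"
  shows "n = \<nu> \<or> n = - \<nu>"
proof -
  obtain n1 n2 where n: "n = (n1, n2)" by (cases n)
  obtain v1 v2 where v: "\<nu> = (v1, v2)" by (cases \<nu>)
  obtain d1 d2 where d: "d = (d1, d2)" by (cases d)
  have 1: "v1\<^sup>2 + v2\<^sup>2 = 1" "n1\<^sup>2 + n2\<^sup>2 = 1"
    using assms(1,2) by (simp_all add: n v norm_Pair)
  have 2: "v1 * d1 + v2 * d2 = 0" "n1 * d1 + n2 * d2 = 0" using assms(3,4) by (simp_all add: n v d)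
  \<comment> \<open>The determinant of \<nu> and \<open>n\<close> vanishes because both are
    orthogonal to the nonzero \<open>d\<close>. Parallel unit vectors agree up to sign.\<close>
  have "(v1 * n2 - v2 * n1) * d1 = 0" "(v1 * n2 - v2 * n1) * d2 = 0"
    using 2 by algebra+
  then have 3: "v1 * n2 = v2 * n1" using assms(5) by (auto simp: d zero_prod_def)
  have "(n1 - v1 * (v1 * n1 + v2 * n2)) = 0" "(n2 - v2 * (v1 * n1 + v2 * n2)) = 0"
    using 1 3 by algebra+
  moreover have "(v1 * n1 + v2 * n2)\<^sup>2 = 1" using 1 3 by algebra
  ultimately show ?thesis unfolding n v by (auto simp: power2_eq_1_iff)
qed

text \<open>The inequality for a candidate \<open>n\<close> extends to the closure of
  \<open>E\<close>, hence holds on \<open>e\<close> in both directions, so \<open>n\<close> is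
  orthogonal to \<open>e\<close> and equals \<nu> or its negative. The point \<open>y0\<close>
  strictly on the inner side excludes the negative.\<close>

lemma outer_normal_eqI:
  assumes "norm \<nu> = 1" "p \<in> e" "q \<in> e" "p \<noteq> q" "e \<subseteq> closure E"
    and le: "\<And>x y. x \<in> e \<Longrightarrow> y \<in> E \<Longrightarrow> \<nu> \<bullet> (y - x) \<le> 0"
    and "x0 \<in> e" "y0 \<in> E" "\<nu> \<bullet> (y0 - x0) < 0"
  shows "outer_normal E e = \<nu>"
  unfolding outer_normal_def
proof (rule the_equality)
  show "norm \<nu> = 1 \<and> (\<forall>x\<in>e. \<forall>y\<in>E. \<nu> \<bullet> (y - x) \<le> 0)" using assms by blast
next
  have orth: "n \<bullet> (q - p) = 0" if n: "\<And>x y. x \<in> e \<Longrightarrow> y \<in> E \<Longrightarrow> n \<bullet> (y - x) \<le> 0" for n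
  proof -
    have "n \<bullet> (y - x) \<le> 0" if "x \<in> e" "y \<in> e" for x y
    proof -
      have "closure E \<subseteq> {y. n \<bullet> y \<le> n \<bullet> x}"
      proof (rule closure_minimal)
        show "E \<subseteq> {y. n \<bullet> y \<le> n \<bullet> x}"
          using n[OF that(1)] by (simp add: inner_diff_right subset_iff del: split_paired_All)
      qed (rule closed_halfspace_le)
      then show ?thesis using that assms(5) by (auto simp: inner_diff_right)
    qed
    from this[of p q] this[of q p] show ?thesis using assms(2,3) by (simp add: inner_diff_right)
  qed
  fix n assume n: "norm n = 1 \<and> (\<forall>x\<in>e. \<forall>y\<in>E. n \<bullet> (y - x) \<le> 0)"
  have "n = \<nu> \<or> n = - \<nu>"
    by (rule unit_orthogonal_unique[of \<nu> n "q - p"]) (use assms n orth le in auto)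
  moreover have "n \<noteq> - \<nu>"
  proof
    assume "n = - \<nu>"
    then have "- \<nu> \<bullet> (y0 - x0) \<le> 0" using n assms by blast
    then show False using assms(9) by simp
  qed
  ultimately show "n = \<nu>" by blast
qed

text \<open>The arbitrary choice in \<open>seg_normal\<close> is harmless: the admissible vectors
  are \<nu> and its negative, which the absolute value does not distinguish.\<close>

lemma abs_inner_seg_normal:
  assumes "norm \<nu> = 1" "p \<in> e" "q \<in> e" "p \<noteq> q" "\<And>x y. x \<in> e \<Longrightarrow> y \<in> e \<Longrightarrow> \<nu> \<bullet> (y - x) = 0"
  shows "\<bar>z \<bullet> seg_normal e\<bar> = \<bar>z \<bullet> \<nu>\<bar>"
proof -
  have "norm (seg_normal e) = 1 \<and> (\<forall>x\<in>e. \<forall>y\<in>e. seg_normal e \<bullet> (y - x) = 0)"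
    unfolding seg_normal_def by (rule someI[of _ \<nu>]) (use assms in blast)
  then have "seg_normal e = \<nu> \<or> seg_normal e = - \<nu>"
    by (intro unit_orthogonal_unique[of \<nu> _ "q - p"]) (use assms in auto)
  then show ?thesis by auto
qed

section \<open>The divergence theorem for Lipschitz fields\<close>

lemmas hk_diff = Henstock_Kurzweil_Integration.integral_diff
lemmas hk_combine = Henstock_Kurzweil_Integration.integral_combine

text \<open>Fubini applied to \<open>f\<close> times the indicator of \<open>P\<close> supplies both
  the value and the integrability of the slice integrals as a function of \<open>y\<close>;
  compactness of \<open>P\<close> provides the integrability on the product.\<close>

lemma fubini_horizontal_slices:
  fixes f :: "plane \<Rightarrow> real"
  assumes "compact P" and P: "P = {(x, y). y \<in> {c..d} \<and> x \<in> {l y..u y}}"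
    and f: "continuous_on UNIV f"
  shows "(\<lambda>y. integral {l y..u y} (\<lambda>x. f (x, y))) integrable_on {c..d}"
    and "integral P f = integral {c..d} (\<lambda>y. integral {l y..u y} (\<lambda>x. f (x, y)))"
proof -
  let ?g = "\<lambda>x y. indicator P (x, y) *\<^sub>R f (x, y)"
  let ?I = "\<lambda>y. integral {l y..u y} (\<lambda>x. f (x, y))"
  have cs: "continuous_on S (\<lambda>x. f (x, y))" for S y
    by (rule continuous_on_compose2[OF f]) (auto intro!: continuous_intros)
  have int: "integrable lborel (\<lambda>p. indicator P p *\<^sub>R f p)"
    by (rule borel_integrable_compact[OF assms(1)]) (rule continuous_on_subset[OF f subset_UNIV])
  have int2: "integrable (lborel \<Otimes>\<^sub>M lborel) (\<lambda>(x, y). ?g x y)"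
    using int unfolding lborel_prod[symmetric] by (simp add: split_beta')
  have inner: "(LINT x|lborel. ?g x y) = indicator {c..d} y *\<^sub>R ?I y" for y
  proof (cases "y \<in> {c..d}")
    case True
    then have "indicator P (x, y) = (indicator {l y..u y} x :: real)" for x
      unfolding P by (simp add: indicator_def)
    moreover have "set_integrable lborel {l y..u y} (\<lambda>x. f (x, y))"
      unfolding set_integrable_def by (rule borel_integrable_compact[OF _ cs]) simp
    ultimately show ?thesis
      using True set_borel_integral_eq_integral(2)[of "{l y..u y}" "\<lambda>x. f (x, y)"]
      by (simp add: set_lebesgue_integral_def)
  next
    case False
    then have "indicator P (x, y) = (0 :: real)" for x unfolding P by (auto simp: indicator_def)
    then show ?thesis using False by simp
  qed
  have "integrable lborel (\<lambda>y. LINT x|lborel. ?g x y)" by (rule lborel_pair.integrable_snd[OF int2])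
  then have si: "set_integrable lborel {c..d} ?I" unfolding inner set_integrable_def .
  then show "?I integrable_on {c..d}" by (rule set_borel_integral_eq_integral(1))
  have "integral P f = (LINT p:P|lborel. f p)"
    by (rule set_borel_integral_eq_integral(2)[symmetric]) (use int in \<open>simp add: set_integrable_def\<close>)
  also have "\<dots> = integral\<^sup>L (lborel \<Otimes>\<^sub>M lborel) (\<lambda>(x, y). ?g x y)"
    unfolding set_lebesgue_integral_def lborel_prod by (simp add: split_beta')
  also have "\<dots> = (LINT y|lborel. LINT x|lborel. ?g x y)"
    by (rule lborel_pair.integral_snd[OF int2, symmetric])
  also have "\<dots> = (LINT y:{c..d}|lborel. ?I y)" unfolding inner set_lebesgue_integral_def ..
  also have "\<dots> = integral {c..d} ?I" by (rule set_borel_integral_eq_integral(2)[OF si])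
  finally show "integral P f = integral {c..d} ?I" .
qed

lemma fubini_vertical_slices:
  fixes f :: "plane \<Rightarrow> real"
  assumes "compact P" and P: "P = {(x, y). x \<in> {a..b} \<and> y \<in> {l x..u x}}"
    and f: "continuous_on UNIV f"
  shows "(\<lambda>x. integral {l x..u x} (\<lambda>y. f (x, y))) integrable_on {a..b}"
    and "integral P f = integral {a..b} (\<lambda>x. integral {l x..u x} (\<lambda>y. f (x, y)))"
proof -
  let ?g = "\<lambda>x y. indicator P (x, y) *\<^sub>R f (x, y)"
  let ?I = "\<lambda>x. integral {l x..u x} (\<lambda>y. f (x, y))"
  have cs: "continuous_on S (\<lambda>y. f (x, y))" for S x
    by (rule continuous_on_compose2[OF f]) (auto intro!: continuous_intros)
  have int: "integrable lborel (\<lambda>p. indicator P p *\<^sub>R f p)"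
    by (rule borel_integrable_compact[OF assms(1)]) (rule continuous_on_subset[OF f subset_UNIV])
  have int2: "integrable (lborel \<Otimes>\<^sub>M lborel) (\<lambda>(x, y). ?g x y)"
    using int unfolding lborel_prod[symmetric] by (simp add: split_beta')
  have inner: "(LINT y|lborel. ?g x y) = indicator {a..b} x *\<^sub>R ?I x" for x
  proof (cases "x \<in> {a..b}")
    case True
    then have "indicator P (x, y) = (indicator {l x..u x} y :: real)" for y
      unfolding P by (simp add: indicator_def)
    moreover have "set_integrable lborel {l x..u x} (\<lambda>y. f (x, y))"
      unfolding set_integrable_def by (rule borel_integrable_compact[OF _ cs]) simp
    ultimately show ?thesis
      using True set_borel_integral_eq_integral(2)[of "{l x..u x}" "\<lambda>y. f (x, y)"]
      by (simp add: set_lebesgue_integral_def)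
  next
    case False
    then have "indicator P (x, y) = (0 :: real)" for y unfolding P by (auto simp: indicator_def)
    then show ?thesis using False by simp
  qed
  have "integrable lborel (\<lambda>x. LINT y|lborel. ?g x y)" by (rule lborel_pair.integrable_fst[OF int2])
  then have si: "set_integrable lborel {a..b} ?I" unfolding inner set_integrable_def .
  then show "?I integrable_on {a..b}" by (rule set_borel_integral_eq_integral(1))
  have "integral P f = (LINT p:P|lborel. f p)"
    by (rule set_borel_integral_eq_integral(2)[symmetric]) (use int in \<open>simp add: set_integrable_def\<close>)
  also have "\<dots> = integral\<^sup>L (lborel \<Otimes>\<^sub>M lborel) (\<lambda>(x, y). ?g x y)"
    unfolding set_lebesgue_integral_def lborel_prod by (simp add: split_beta')
  also have "\<dots> = (LINT x|lborel. LINT y|lborel. ?g x y)"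
    by (rule lborel_pair.integral_fst[OF int2, symmetric])
  also have "\<dots> = (LINT x:{a..b}|lborel. ?I x)" unfolding inner set_lebesgue_integral_def ..
  also have "\<dots> = integral {a..b} ?I" by (rule set_borel_integral_eq_integral(2)[OF si])
  finally show "integral P f = integral {a..b} ?I" .
qed

section \<open>Difference quotients integrated over slices\<close>

lemma integral_short_interval:
  fixes g :: "real \<Rightarrow> real"
  assumes g: "K-lipschitz_on UNIV g" and "0 \<le> \<delta>"
  shows "\<bar>integral {s..s + \<delta>} g - \<delta> * g s\<bar> \<le> K * \<delta> * \<delta>"
proof -
  have c: "continuous_on S g" for S
    using lipschitz_on_continuous_on[OF g] continuous_on_subset by blast
  have "integral {s..s + \<delta>} g - \<delta> * g s = integral {s..s + \<delta>} (\<lambda>x. g x - g s)"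
    using assms(2) hk_diff[OF integrable_continuous_real[OF c] integrable_const_ivl, of s "s + \<delta>" "g s"]
    by simp
  moreover have "norm (integral {s..s + \<delta>} (\<lambda>x. g x - g s)) \<le> (K * \<delta>) * (s + \<delta> - s)"
  proof (rule integral_bound)
    show "continuous_on {s..s + \<delta>} (\<lambda>x. g x - g s)" by (intro continuous_intros c)
    fix x assume x: "x \<in> {s..s + \<delta>}"
    have "norm (g x - g s) \<le> K * \<bar>x - s\<bar>"
      using lipschitz_onD[OF g, of x s] by (simp add: dist_real_def)
    also have "\<dots> \<le> K * \<delta>" using x lipschitz_on_nonneg[OF g] by (intro mult_left_mono) auto
    finally show "norm (g x - g s) \<le> K * \<delta>" .
  qed (use assms in auto)
  ultimately show ?thesis by simp
qed

text \<open>Translation by \<delta> cancels everything except the windows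
  \<open>{a..a + \<delta>}\<close> and \<open>{b..b + \<delta>}\<close>, so the integral is a
  difference of two averages of \<open>g\<close>, each within \<open>K * \<delta>\<close> of the
  value at the endpoint.\<close>

lemma integral_difference_quotient:
  fixes g :: "real \<Rightarrow> real"
  assumes g: "K-lipschitz_on UNIV g" and "0 < \<delta>" "a \<le> b"
  shows "\<bar>integral {a..b} (\<lambda>x. (g (x + \<delta>) - g x) / \<delta>) - (g b - g a)\<bar> \<le> 2 * K * \<delta>"
proof -
  have c: "continuous_on S g" for S
    using lipschitz_on_continuous_on[OF g] continuous_on_subset by blast
  have ig: "g integrable_on {s..t}" for s t by (rule integrable_continuous_real[OF c])
  have cs: "continuous_on S (\<lambda>x. g (x + \<delta>))" for S
    by (rule continuous_on_compose2[OF c[of UNIV]]) (auto intro!: continuous_intros)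
  define J where "J = integral {a..b} (\<lambda>x. (g (x + \<delta>) - g x) / \<delta>)"
  have "\<delta> * J = integral {a..b} (\<lambda>x. g (x + \<delta>)) - integral {a..b} g"
    unfolding J_def using assms(2)
      hk_diff[OF integrable_continuous_real[OF cs] ig, of a b]
    by simp
  also have "integral {a..b} (\<lambda>x. g (x + \<delta>)) = integral {a + \<delta>..b + \<delta>} g"
    using integral_shift_real_ivl[of "a + \<delta>" \<delta> "b + \<delta>" g] by simp
  also have "integral {a + \<delta>..b + \<delta>} g - integral {a..b} g
      = integral {b..b + \<delta>} g - integral {a..a + \<delta>} g"
    using hk_combine[OF _ _ ig, of a "a + \<delta>" "b + \<delta>"]
      hk_combine[OF _ _ ig, of a b "b + \<delta>"] assms
    by simp
  finally have eq: "\<delta> * (J - (g b - g a))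
      = (integral {b..b + \<delta>} g - \<delta> * g b) - (integral {a..a + \<delta>} g - \<delta> * g a)"
    by (simp add: algebra_simps)
  have "\<bar>\<delta> * (J - (g b - g a))\<bar> \<le> 2 * (K * \<delta> * \<delta>)"
    unfolding eq using integral_short_interval[OF g, of \<delta> a] integral_short_interval[OF g, of \<delta> b] assms
    by linarith
  then have "\<delta> * \<bar>J - (g b - g a)\<bar> \<le> \<delta> * (2 * K * \<delta>)"
    using assms(2) by (simp add: abs_mult mult_ac)
  then show ?thesis using assms(2) unfolding J_def by simp
qed

text \<open>\<open>T s t\<close> is the point with coordinate \<open>s\<close> along the direction
  \<open>k\<close> and \<open>t\<close> across it, so one proof serves both coordinate directions.
  The error on a slice is at most \<open>2 * K * \<delta>\<close> uniformly in \<open>t\<close>,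
  hence still tends to 0 after integration over \<open>t\<close>.\<close>

lemma integral_difference_quotient_slices:
  fixes f :: "plane \<Rightarrow> real" and T :: "real \<Rightarrow> real \<Rightarrow> plane"
  assumes f: "K-lipschitz_on UNIV f" and "c \<le> d"
    and T: "\<And>s s' t. dist (T s t) (T s' t) = \<bar>s - s'\<bar>" "\<And>s t r. T s t + r *\<^sub>R k = T (s + r) t"
    and lu: "\<And>t. t \<in> {c..d} \<Longrightarrow> l t \<le> u t"
    and fub: "\<And>q :: plane \<Rightarrow> real. continuous_on UNIV q \<Longrightarrow> (\<lambda>t. integral {l t..u t} (\<lambda>s. q (T s t))) integrable_on {c..d}"
      "\<And>q :: plane \<Rightarrow> real. continuous_on UNIV q \<Longrightarrow> integral P q = integral {c..d} (\<lambda>t. integral {l t..u t} (\<lambda>s. q (T s t)))"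
    and bd: "(\<lambda>t. f (T (u t) t) - f (T (l t) t)) integrable_on {c..d}"
  shows "(\<lambda>n. integral P (\<lambda>p. (f (p + inverse (real (Suc n)) *\<^sub>R k) - f p) / inverse (real (Suc n))))
      \<longlonglongrightarrow> integral {c..d} (\<lambda>t. f (T (u t) t) - f (T (l t) t))"
proof -
  let ?\<delta> = "\<lambda>n. inverse (real (Suc n))"
  let ?q = "\<lambda>n p. (f (p + ?\<delta> n *\<^sub>R k) - f p) / ?\<delta> n"
  let ?B = "\<lambda>t. f (T (u t) t) - f (T (l t) t)"
  have cf: "continuous_on S f" for S
    using lipschitz_on_continuous_on[OF f] continuous_on_subset by blast
  have cq: "continuous_on UNIV (?q n)" for n
    by (intro continuous_intros cf continuous_on_compose2[OF cf[of UNIV]]) auto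
  have lT: "K-lipschitz_on UNIV (\<lambda>s. f (T s t))" for t
    using lipschitz_onD[OF f, of "T _ t" "T _ t"] lipschitz_on_nonneg[OF f]
    by (intro lipschitz_onI) (auto simp: T(1) dist_real_def)
  have bound: "norm (integral P (?q n) - integral {c..d} ?B) \<le> (2 * K * (d - c)) * ?\<delta> n" for n
  proof -
    have "norm (integral {c..d} (\<lambda>t. integral {l t..u t} (\<lambda>s. ?q n (T s t)) - ?B t))
        \<le> integral {c..d} (\<lambda>t. 2 * K * ?\<delta> n)"
    proof (rule integral_norm_bound_integral)
      show "(\<lambda>t. integral {l t..u t} (\<lambda>s. ?q n (T s t)) - ?B t) integrable_on {c..d}"
        by (rule Henstock_Kurzweil_Integration.integrable_diff[OF fub(1)[OF cq] bd])
      fix t assume "t \<in> {c..d}"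
      then show "norm (integral {l t..u t} (\<lambda>s. ?q n (T s t)) - ?B t) \<le> 2 * K * ?\<delta> n"
        using integral_difference_quotient[OF lT[of t] _ lu, of "?\<delta> n" t] unfolding T(2)
        by simp
    qed (rule integrable_const_ivl)
    moreover have "integral {c..d} (\<lambda>t. 2 * K * ?\<delta> n) = (2 * K * (d - c)) * ?\<delta> n"
      using assms(2) by (simp add: mult_ac)
    ultimately show ?thesis
      unfolding fub(2)[OF cq] hk_diff[OF fub(1)[OF cq] bd]
      by metis
  qed
  have "(\<lambda>n. (2 * K * (d - c)) * ?\<delta> n) \<longlonglongrightarrow> (2 * K * (d - c)) * 0"
    by (intro tendsto_intros LIMSEQ_inverse_real_of_nat)
  then have "(\<lambda>n. integral P (?q n) - integral {c..d} ?B) \<longlonglongrightarrow> 0"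
    using Lim_null_comparison[OF always_eventually[OF allI[OF bound]]] by simp
  then show ?thesis by (rule LIM_zero_cancel)
qed

text \<open>
  The sum of the difference quotients in both coordinate directions is bounded and tends to the
  divergence almost everywhere, so its integral tends to zero. Fubini turns the integral of a
  difference quotient into averages of \<open>F\<close> near the boundary. In this way neither measurability
  of the partial derivatives nor absolute continuity on lines is needed.
\<close>

lemma divergence_theorem_divergence_free:
  fixes F :: "plane \<Rightarrow> plane"
  assumes F: "K-lipschitz_on UNIV F" and "compact P"
    and Ph: "P = {(x, y). y \<in> {c..d} \<and> x \<in> {l y..u y}}" "c \<le> d" "\<And>y. y \<in> {c..d} \<Longrightarrow> l y \<le> u y"
    and lu: "continuous_on {c..d} l" "continuous_on {c..d} u"
    and Pv: "P = {(x, y). x \<in> {a..b} \<and> y \<in> {s x..t x}}" "a \<le> b" "\<And>x. x \<in> {a..b} \<Longrightarrow> s x \<le> t x"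
    and st: "continuous_on {a..b} s" "continuous_on {a..b} t"
    and div: "AE p in lebesgue_on P. \<exists>D. (F has_derivative D) (at p) \<and> (\<Sum>b\<in>Basis. D b \<bullet> b) = 0"
  shows "integral {c..d} (\<lambda>y. fst (F (u y, y)) - fst (F (l y, y)))
       + integral {a..b} (\<lambda>x. snd (F (x, t x)) - snd (F (x, s x))) = 0"
proof -
  let ?\<delta> = "\<lambda>n. inverse (real (Suc n))"
  define q1 where "q1 = (\<lambda>n p. (fst (F (p + ?\<delta> n *\<^sub>R (1, 0))) - fst (F p)) / ?\<delta> n)"
  define q2 where "q2 = (\<lambda>n p. (snd (F (p + ?\<delta> n *\<^sub>R (0, 1))) - snd (F p)) / ?\<delta> n)"
  have K: "0 \<le> K" by (rule lipschitz_on_nonneg[OF F])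
  have F1: "K-lipschitz_on UNIV (\<lambda>p. fst (F p))"
    using lipschitz_onD[OF F] K by (intro lipschitz_onI) (force intro: order_trans[OF dist_fst_le])+
  have F2: "K-lipschitz_on UNIV (\<lambda>p. snd (F p))"
    using lipschitz_onD[OF F] K by (intro lipschitz_onI) (force intro: order_trans[OF dist_snd_le])+
  have cF: "continuous_on S F" for S
    using lipschitz_on_continuous_on[OF F] continuous_on_subset by blast
  have cq: "continuous_on S (q1 n)" "continuous_on S (q2 n)" for S n
    unfolding q1_def q2_def
    by (intro continuous_intros cF continuous_on_compose2[OF cF[of UNIV]]; auto)+
  have lim1: "(\<lambda>n. integral P (q1 n)) \<longlonglongrightarrow> integral {c..d} (\<lambda>y. fst (F (u y, y)) - fst (F (l y, y)))"
    unfolding q1_def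
  proof (rule integral_difference_quotient_slices[OF F1, where T="\<lambda>s t. (s, t)"])
    show "(\<lambda>y. fst (F (u y, y)) - fst (F (l y, y))) integrable_on {c..d}"
      by (intro integrable_continuous_real continuous_intros continuous_on_compose2[OF cF[of UNIV]] lu) auto
  qed (fact fubini_horizontal_slices[OF \<open>compact P\<close> Ph(1)] Ph(2,3) |
      simp add: dist_Pair_Pair dist_real_def)+
  have lim2: "(\<lambda>n. integral P (q2 n)) \<longlonglongrightarrow> integral {a..b} (\<lambda>x. snd (F (x, t x)) - snd (F (x, s x)))"
    unfolding q2_def
  proof (rule integral_difference_quotient_slices[OF F2, where T="\<lambda>s t. (t, s)"])
    show "(\<lambda>x. snd (F (x, t x)) - snd (F (x, s x))) integrable_on {a..b}"
      by (intro integrable_continuous_real continuous_intros continuous_on_compose2[OF cF[of UNIV]] st) auto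
  qed (fact fubini_vertical_slices[OF \<open>compact P\<close> Pv(1)] Pv(2,3) |
      simp add: dist_Pair_Pair dist_real_def)+
  have Pl: "P \<in> lmeasurable" by (rule lmeasurable_compact[OF \<open>compact P\<close>])
  have P_l: "P \<in> sets lebesgue" using Pl by blast
  \<comment> \<open>Dominated convergence is available for the Lebesgue integral, while the slice
    lemmas use the gauge integral; for continuous integrands on the compact set \<open>P\<close> the
    two agree.\<close>
  have int: "(LINT p|lebesgue_on P. g p) = integral P g" "integrable (lebesgue_on P) g"
    if "\<And>S. continuous_on S g" for g :: "plane \<Rightarrow> real"
  proof -
    have "integrable lborel (\<lambda>p. indicator P p *\<^sub>R g p)"
      by (rule borel_integrable_compact[OF \<open>compact P\<close> that])
    then have "integrable lebesgue (\<lambda>p. indicator P p *\<^sub>R g p)"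
      using integrable_completion[OF borel_measurable_integrable] by blast
    then have "g absolutely_integrable_on P" unfolding set_integrable_def .
    then show "integrable (lebesgue_on P) g" "(LINT p|lebesgue_on P. g p) = integral P g"
      using P_l by (simp_all add: integrable_restrict_space set_integrable_def lebesgue_integral_eq_integral)
  qed
  have "(\<lambda>n. LINT p|lebesgue_on P. q1 n p + q2 n p) \<longlonglongrightarrow> (LINT p|lebesgue_on P. 0)"
  proof (rule integral_dominated_convergence)
    show "integrable (lebesgue_on P) (\<lambda>p. 2 * K)"
      by (rule int(2)) simp
    show "(\<lambda>p. q1 n p + q2 n p) \<in> borel_measurable (lebesgue_on P)" for n
      by (rule borel_measurable_integrable[OF int(2)]) (intro continuous_intros cq)
    show "AE p in lebesgue_on P. norm (q1 n p + q2 n p) \<le> 2 * K" for n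
    proof (rule AE_I2)
      fix p
      have "\<bar>q1 n p\<bar> \<le> K" "\<bar>q2 n p\<bar> \<le> K"
        using lipschitz_onD[OF F1, of "p + ?\<delta> n *\<^sub>R (1, 0)" p] lipschitz_onD[OF F2, of "p + ?\<delta> n *\<^sub>R (0, 1)" p]
        unfolding q1_def q2_def
        by (simp_all add: dist_real_def dist_norm norm_Pair abs_divide divide_le_eq del: of_nat_Suc)
      then show "norm (q1 n p + q2 n p) \<le> 2 * K" by simp
    qed
    show "AE p in lebesgue_on P. (\<lambda>n. q1 n p + q2 n p) \<longlonglongrightarrow> 0"
      using div
    proof eventually_elim
      case (elim p)
      then obtain D where D: "(F has_derivative D) (at p)" and tr: "(\<Sum>b\<in>Basis. D b \<bullet> b) = 0" by blast
      \<comment> \<open>Restriction to lines through \<open>p\<close> reduces to derivatives in one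
        variable. Along the two coordinate axes these give the diagonal entries of \<open>D\<close>,
        whose sum is the trace.\<close>
      have dv: "((\<lambda>r. F (p + r *\<^sub>R v)) has_derivative (\<lambda>r. r *\<^sub>R D v)) (at 0)" for v
      proof -
        have "((\<lambda>r. F (p + r *\<^sub>R v)) has_derivative (\<lambda>r. D (r *\<^sub>R v))) (at 0)"
          by (rule has_derivative_compose[of "\<lambda>r. p + r *\<^sub>R v" "\<lambda>r. r *\<^sub>R v" 0 UNIV F D])
            (auto intro!: derivative_eq_intros D)
        moreover have "(\<lambda>r. D (r *\<^sub>R v)) = (\<lambda>r. r *\<^sub>R D v)"
          using has_derivative_bounded_linear[OF D] by (simp add: linear_simps)
        ultimately show ?thesis by simp
      qed
      have "((\<lambda>r. fst (F (p + r *\<^sub>R (1, 0)))) has_field_derivative fst (D (1, 0))) (at 0)"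
        "((\<lambda>r. snd (F (p + r *\<^sub>R (0, 1)))) has_field_derivative snd (D (0, 1))) (at 0)"
        using has_derivative_fst[OF dv[of "(1, 0)"]] has_derivative_snd[OF dv[of "(0, 1)"]]
        by (simp_all add: has_field_derivative_def mult_commute_abs)
      then have lims: "((\<lambda>r. (fst (F (p + r *\<^sub>R (1, 0))) - fst (F p)) / r) \<longlongrightarrow> fst (D (1, 0))) (at 0)"
        "((\<lambda>r. (snd (F (p + r *\<^sub>R (0, 1))) - snd (F p)) / r) \<longlongrightarrow> snd (D (0, 1))) (at 0)"
        unfolding DERIV_def by (simp_all del: scaleR_Pair)
      have fl: "filterlim ?\<delta> (at 0) sequentially"
        using LIMSEQ_inverse_real_of_nat by (simp add: filterlim_at del: of_nat_Suc)
      have "(\<lambda>n. q1 n p) \<longlonglongrightarrow> fst (D (1, 0))" "(\<lambda>n. q2 n p) \<longlonglongrightarrow> snd (D (0, 1))"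
        using filterlim_compose[OF lims(1) fl] filterlim_compose[OF lims(2) fl]
        unfolding q1_def q2_def .
      then have "(\<lambda>n. q1 n p + q2 n p) \<longlonglongrightarrow> fst (D (1, 0)) + snd (D (0, 1))" by (rule tendsto_add)
      moreover have "fst (D (1, 0)) + snd (D (0, 1)) = 0"
        using tr by (simp add: Basis_prod_def sum.union_disjoint inner_prod_def)
      ultimately show ?case by simp
    qed
  qed simp
  moreover have "(LINT p|lebesgue_on P. q1 n p + q2 n p) = integral P (q1 n) + integral P (q2 n)" for n
    using int[of "q1 n"] int[of "q2 n"] cq by simp
  ultimately have "(\<lambda>n. integral P (q1 n) + integral P (q2 n)) \<longlonglongrightarrow> 0" by simp
  then show ?thesis using LIMSEQ_unique tendsto_add[OF lim1 lim2] by blast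
qed

section \<open>Boxes cut by a line\<close>

text \<open>A relative interior point of \<open>e\<close> lies on the boundary of \<open>S\<close>,
  hence in some \<open>F\<close> of the family. A face that contains a relative interior point of
  \<open>e\<close> contains all of \<open>e\<close>, and equality of dimensions forces
  \<open>e = F\<close>.\<close>

lemma edge_of_mem_faces:
  fixes S :: "plane set"
  assumes "convex S" "interior S \<noteq> {}" and e: "e edge_of S"
    and Fs: "\<And>F. F \<in> \<F> \<Longrightarrow> F face_of S" "\<And>F. F \<in> \<F> \<Longrightarrow> aff_dim F \<le> 1"
    and cover: "S - interior S \<subseteq> \<Union>\<F>"
  shows "e \<in> \<F>"
proof -
  have ef: "e face_of S" and dim: "aff_dim e = 1" using e by (auto simp: edge_of_def)
  have "aff_dim S = 2" using aff_dim_nonempty_interior[OF assms(2)] by simp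
  with dim have "e \<noteq> S" by auto
  have "convex e" by (rule face_of_imp_convex[OF ef])
  moreover have "e \<noteq> {}" using dim by auto
  ultimately obtain x where x: "x \<in> rel_interior e" using rel_interior_eq_empty by blast
  then have "x \<in> e" using rel_interior_subset by blast
  then have "x \<in> S - interior S"
    using face_of_disjoint_interior[OF ef \<open>e \<noteq> S\<close>] face_of_imp_subset[OF ef] by blast
  then obtain F where F: "F \<in> \<F>" "x \<in> F" using cover by blast
  have "e \<subseteq> F"
    by (rule subset_of_face_of[OF Fs(1)[OF F(1)] face_of_imp_subset[OF ef]]) (use F x in blast)
  then have "e face_of F"
    by (rule face_of_subset[OF ef _ face_of_imp_subset[OF Fs(1)[OF F(1)]]])
  then have "e = F"
    using face_of_aff_dim_lt[of F e] face_of_imp_convex[OF Fs(1)[OF F(1)]] Fs(2)[OF F(1)] dim by fastforce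
  with F show ?thesis by simp
qed

lemma aff_dim_closed_segment: "aff_dim (closed_segment p q) = (if p = q then 0 else 1)"
  by (simp add: segment_convex_hull aff_dim_convex_hull)

text \<open>The mesh lines are cut off by the ramp line \<open>y = (x - x0) * m\<close>.\<close>

definition vface :: "real \<Rightarrow> real \<Rightarrow> real \<Rightarrow> real \<Rightarrow> real \<Rightarrow> plane set" where
  "vface x0 m x c d = {x} \<times> {max c ((x - x0) * m)..d}"

definition hface :: "real \<Rightarrow> real \<Rightarrow> real \<Rightarrow> real \<Rightarrow> real \<Rightarrow> plane set" where
  "hface x0 m y a b = {a..min b (x0 + y / m)} \<times> {y}"

text \<open>The upper left corner is the point of the box that lies highest above the ramp line, so
  \<open>corner\<close> is exactly the condition for the cut box to have interior points.\<close>

locale cut_box =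
  fixes a b c d x0 m :: real
  assumes ab: "a < b" and cd: "c < d" and m_pos: "0 < m" and corner: "(a - x0) * m < d"
begin

definition polygon :: "plane set" where
  "polygon = {(x, y). a \<le> x \<and> x \<le> b \<and> c \<le> y \<and> y \<le> d \<and> (x - x0) * m \<le> y}"

text \<open>A mesh cell is a closed box intersected with the open domain, in general neither open
  nor closed. The results are therefore stated for any set between \<open>inner_part\<close> and
  \<open>polygon\<close>.\<close>

definition inner_part :: "plane set" where
  "inner_part = {(x, y). a < x \<and> x < b \<and> c < y \<and> y < d \<and> (x - x0) * m < y}"

definition ramp_edge :: "plane set" where
  "ramp_edge = {(x, y) \<in> polygon. y = (x - x0) * m}"

abbreviation "left_edge \<equiv> vface x0 m a c d"
abbreviation "right_edge \<equiv> vface x0 m b c d"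
abbreviation "bottom_edge \<equiv> hface x0 m c a b"
abbreviation "top_edge \<equiv> hface x0 m d a b"

lemma ramp_le_iff: "(x - x0) * m \<le> y \<longleftrightarrow> x \<le> x0 + y / m"
  using m_pos by (simp add: field_simps)

lemma ramp_less_iff: "(x - x0) * m < y \<longleftrightarrow> x < x0 + y / m"
  using m_pos by (simp add: field_simps)

lemma polygon_eq:
  "polygon = cbox (a, c) (b, d) \<inter> {p. (m, -1) \<bullet> p \<le> m * x0}"
  unfolding polygon_def by (auto simp: cbox_Pair_eq algebra_simps)

lemma inner_part_eq:
  "inner_part = box (a, c) (b, d) \<inter> {p. (m, -1) \<bullet> p < m * x0}"
  unfolding inner_part_def by (auto simp: mem_box Basis_prod_def algebra_simps)

lemma compact_polygon: "compact polygon"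
  unfolding polygon_eq by (intro compact_Int_closed compact_cbox closed_halfspace_le)

lemma convex_polygon: "convex polygon"
  unfolding polygon_eq by (intro convex_Int convex_box convex_halfspace_le)

lemma open_inner_part: "open inner_part"
  unfolding inner_part_eq by (intro open_Int open_box open_halfspace_lt)

lemma inner_part_subset: "inner_part \<subseteq> polygon"
  unfolding inner_part_def polygon_def by auto

lemma inner_part_nonempty: "inner_part \<noteq> {}"
proof -
  define M where "M = max c ((a - x0) * m)"
  have M: "c \<le> M" "(a - x0) * m \<le> M" "M < d" using cd corner by (auto simp: M_def)
  define y where "y = (M + d) / 2"
  have y: "c < y" "(a - x0) * m < y" "y < d" using M by (auto simp: y_def)
  then have "a < min b (x0 + y / m)" using ab ramp_less_iff by auto
  then obtain x where "a < x" "x < min b (x0 + y / m)" using dense by blast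
  then have "(x, y) \<in> inner_part" using y ramp_less_iff[of x y] unfolding inner_part_def by auto
  then show ?thesis by blast
qed

lemma inner_part_subset_interior: "inner_part \<subseteq> interior polygon"
  by (rule interior_maximal[OF inner_part_subset open_inner_part])

lemma interior_polygon_nonempty: "interior polygon \<noteq> {}"
  using inner_part_subset_interior inner_part_nonempty by blast

text \<open>Closure commutes with the intersection of convex sets whose relative interiors meet, and
  a common point is given by \<open>inner_part_nonempty\<close>.\<close>

lemma closure_inner_part: "closure inner_part = polygon"
proof -
  have "rel_interior (box (a, c) (b, d)) \<inter> rel_interior {p. (m, -1) \<bullet> p < m * x0} \<noteq> {}"
    using inner_part_nonempty unfolding inner_part_eq
    by (simp add: rel_interior_open open_halfspace_lt open_box)
  then have "closure inner_part = closure (box (a, c) (b, d)) \<inter> closure {p. (m, -1) \<bullet> p < m * x0}"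
    unfolding inner_part_eq by (intro closure_Int_convex convex_box convex_halfspace_lt) auto
  moreover have "box (a, c) (b, d) \<noteq> {}" using ab cd by (auto simp: box_ne_empty Basis_prod_def)
  moreover have "(m, - 1 :: real) \<noteq> 0" by (simp add: zero_prod_def)
  ultimately show ?thesis unfolding polygon_eq by (simp add: closure_box)
qed

lemma left_edge_eq: "left_edge = polygon \<inter> {p. (1, 0) \<bullet> p = a}"
  unfolding vface_def polygon_def using ab by auto

lemma right_edge_eq: "right_edge = polygon \<inter> {p. (1, 0) \<bullet> p = b}"
  unfolding vface_def polygon_def using ab by auto

lemma bottom_edge_eq: "bottom_edge = polygon \<inter> {p. (0, 1) \<bullet> p = c}"
  unfolding hface_def polygon_def using cd by (auto simp: ramp_le_iff)

lemma top_edge_eq: "top_edge = polygon \<inter> {p. (0, 1) \<bullet> p = d}"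
  unfolding hface_def polygon_def using cd by (auto simp: ramp_le_iff)

lemma ramp_edge_eq: "ramp_edge = polygon \<inter> {p. (m, -1) \<bullet> p = m * x0}"
  unfolding ramp_edge_def by (auto simp: algebra_simps)

text \<open>Each set is cut out by a supporting line, which makes it a face even if it is a single
  point or empty. Which of them are genuine edges is decided later by the dimension.\<close>

lemma edges_face_of:
  "left_edge face_of polygon" "right_edge face_of polygon" "bottom_edge face_of polygon"
  "top_edge face_of polygon" "ramp_edge face_of polygon"
proof -
  show "left_edge face_of polygon"
    unfolding left_edge_eq by (rule face_of_Int_supporting_hyperplane_ge[OF convex_polygon]) (auto simp: polygon_def)
  show "right_edge face_of polygon"
    unfolding right_edge_eq by (rule face_of_Int_supporting_hyperplane_le[OF convex_polygon]) (auto simp: polygon_def)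
  show "bottom_edge face_of polygon"
    unfolding bottom_edge_eq by (rule face_of_Int_supporting_hyperplane_ge[OF convex_polygon]) (auto simp: polygon_def)
  show "top_edge face_of polygon"
    unfolding top_edge_eq by (rule face_of_Int_supporting_hyperplane_le[OF convex_polygon]) (auto simp: polygon_def)
  show "ramp_edge face_of polygon"
    unfolding ramp_edge_eq by (rule face_of_Int_supporting_hyperplane_le[OF convex_polygon])
      (auto simp: polygon_def algebra_simps)
qed

text \<open>The ramp line enters the box through the left or the bottom side, whichever abscissa is
  larger, and leaves at \<open>ramp_end\<close> through the right or the top side. If the line
  misses the box below, the two abscissas are in the wrong order.\<close>

definition ramp_start :: plane where
  "ramp_start = (max a (x0 + c / m), (max a (x0 + c / m) - x0) * m)"

definition ramp_end :: plane where
  "ramp_end = (min b (x0 + d / m), (min b (x0 + d / m) - x0) * m)"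

lemma ramp_ge_iff: "y \<le> (x - x0) * m \<longleftrightarrow> x0 + y / m \<le> x"
  using m_pos by (simp add: field_simps)

lemma ramp_greater_iff: "y < (x - x0) * m \<longleftrightarrow> x0 + y / m < x"
  using m_pos by (simp add: field_simps)

text \<open>The comparison of a maximum with a minimum consists of four inequalities. Three of them
  follow from \<open>ab\<close>, \<open>cd\<close> and \<open>corner\<close>; the fourth says that
  the bottom right corner lies strictly below the ramp line.\<close>

lemma bottom_right_cut_iff: "fst ramp_start < fst ramp_end \<longleftrightarrow> c < (b - x0) * m"
proof -
  have "c / m < d / m" using cd m_pos by (simp add: divide_strict_right_mono)
  then show ?thesis
    using ab ramp_less_iff[of a d] corner ramp_greater_iff[of c b]
    unfolding ramp_start_def ramp_end_def by auto
qed

lemma ramp_edge_image: "ramp_edge = (\<lambda>x. (x, (x - x0) * m)) ` {fst ramp_start..fst ramp_end}"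
  unfolding ramp_edge_def polygon_def ramp_start_def ramp_end_def
  by (auto simp: image_iff ramp_le_iff[of _ d] ramp_ge_iff[of c])

lemma ramp_edge_segment:
  assumes "fst ramp_start \<le> fst ramp_end"
  shows "ramp_edge = closed_segment ramp_start ramp_end"
proof -
  have pt: "(1 - u) *\<^sub>R (x1, (x1 - x0) * m) + u *\<^sub>R (x2, (x2 - x0) * m)
      = ((1 - u) * x1 + u * x2, ((1 - u) * x1 + u * x2 - x0) * m)" for u x1 x2
    by (simp add: algebra_simps)
  have "closed_segment (x1, (x1 - x0) * m) (x2, (x2 - x0) * m)
      = (\<lambda>x. (x, (x - x0) * m)) ` closed_segment x1 x2" for x1 x2
    unfolding closed_segment_def pt by auto
  then show ?thesis
    using assms unfolding ramp_edge_image
    by (simp add: closed_segment_eq_real_ivl ramp_start_def ramp_end_def)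
qed

lemma aff_dim_vface:
  "aff_dim (vface x0 m x c d) = (if max c ((x - x0) * m) < d then 1 else if max c ((x - x0) * m) = d then 0 else -1)"
proof (cases "max c ((x - x0) * m) \<le> d")
  case True
  then show ?thesis
    unfolding vface_def closed_segment_vertical[OF True, symmetric] aff_dim_closed_segment by auto
next
  case False
  then have "{max c ((x - x0) * m)..d} = {}" by auto
  with False show ?thesis unfolding vface_def by auto
qed

lemma aff_dim_hface:
  "aff_dim (hface x0 m y a b) = (if a < min b (x0 + y / m) then 1 else if a = min b (x0 + y / m) then 0 else -1)"
proof (cases "a \<le> min b (x0 + y / m)")
  case True
  then show ?thesis
    unfolding hface_def closed_segment_horizontal[OF True, symmetric] aff_dim_closed_segment by auto
next
  case False
  then have "{a..min b (x0 + y / m)} = {}" by auto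
  with False show ?thesis unfolding hface_def by auto
qed

lemma aff_dim_ramp_edge:
  "aff_dim ramp_edge \<le> 1" "aff_dim ramp_edge = 1 \<longleftrightarrow> c < (b - x0) * m"
proof -
  have "aff_dim ramp_edge \<le> 1 \<and> (aff_dim ramp_edge = 1 \<longleftrightarrow> fst ramp_start < fst ramp_end)"
  proof (cases "fst ramp_start \<le> fst ramp_end")
    case True
    have "ramp_start = ramp_end \<longleftrightarrow> fst ramp_start = fst ramp_end"
      unfolding ramp_start_def ramp_end_def by auto
    then show ?thesis using True unfolding ramp_edge_segment[OF True] aff_dim_closed_segment by auto
  next
    case False
    then show ?thesis unfolding ramp_edge_image by auto
  qed
  then show "aff_dim ramp_edge \<le> 1" "aff_dim ramp_edge = 1 \<longleftrightarrow> c < (b - x0) * m"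
    using bottom_right_cut_iff by auto
qed

text \<open>Every boundary point lies on one of five supporting lines, so the edges are those of the
  five candidates that have dimension one. The left and top edges carry no condition because they
  meet in the upper left corner, which lies above the ramp.\<close>

lemma edge_of_polygon_iff:
  "e edge_of polygon \<longleftrightarrow> e = left_edge \<or> e = top_edge \<or> e = right_edge \<and> (b - x0) * m < d
     \<or> e = bottom_edge \<and> (a - x0) * m < c \<or> e = ramp_edge \<and> c < (b - x0) * m"
  (is "?l \<longleftrightarrow> ?r")
proof
  assume e: ?l
  have "e \<in> {left_edge, top_edge, right_edge, bottom_edge, ramp_edge}"
  proof (rule edge_of_mem_faces[OF convex_polygon interior_polygon_nonempty e])
    show "polygon - interior polygon \<subseteq> \<Union> {left_edge, top_edge, right_edge, bottom_edge, ramp_edge}"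
    proof
      fix p assume "p \<in> polygon - interior polygon"
      then have "p \<in> polygon - inner_part" using inner_part_subset_interior by blast
      then show "p \<in> \<Union> {left_edge, top_edge, right_edge, bottom_edge, ramp_edge}"
        unfolding left_edge_eq right_edge_eq bottom_edge_eq top_edge_eq ramp_edge_def
        by (auto simp: polygon_def inner_part_def)
    qed
  qed (auto simp: edges_face_of aff_dim_vface aff_dim_hface aff_dim_ramp_edge(1))
  moreover have "aff_dim e = 1" using e by (simp add: edge_of_def)
  moreover have "(b - x0) * m < d" if "aff_dim right_edge = 1"
    using that unfolding aff_dim_vface by (simp split: if_split_asm)
  moreover have "(a - x0) * m < c" if "aff_dim bottom_edge = 1"
    using that unfolding aff_dim_hface ramp_less_iff by (simp split: if_split_asm)
  ultimately show ?r using aff_dim_ramp_edge(2) by blast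
next
  have v: "aff_dim (vface x0 m x c d) = 1" if "(x - x0) * m < d" for x
  proof -
    have "max c ((x - x0) * m) < d" using that cd by simp
    then show ?thesis by (simp only: aff_dim_vface if_True)
  qed
  have h: "aff_dim (hface x0 m y a b) = 1" if "(a - x0) * m < y" for y
  proof -
    have "a < min b (x0 + y / m)" using that ab ramp_less_iff by simp
    then show ?thesis by (simp only: aff_dim_hface if_True)
  qed
  note v[OF corner] h[OF corner] v[of b] h[of c]
  moreover assume ?r
  ultimately show ?l
    unfolding edge_of_def using edges_face_of aff_dim_ramp_edge(2) by metis
qed

text \<open>A right or bottom edge of positive length would give the polygon at least four vertices.\<close>

lemma simplex_imp_degenerate:
  assumes "2 simplex polygon"
  shows "d \<le> (b - x0) * m" "c \<le> (a - x0) * m"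
proof -
  obtain C where C: "\<not> affine_dependent C" "card C = 3" "polygon = convex hull C"
    using assms unfolding simplex_def by auto
  then have ext: "p \<in> C" if "p extreme_point_of polygon" for p
    using extreme_point_of_convex_hull_affine_independent that by metis
  \<comment> \<open>An endpoint of an edge is an extreme point of the edge, hence of the polygon,
    hence one of the three vertices.\<close>
  have ext_seg: "p \<in> C \<and> q \<in> C" if "closed_segment p q face_of polygon" for p q
  proof -
    have "p extreme_point_of closed_segment p q" "q extreme_point_of closed_segment p q"
      by (simp_all add: extreme_point_of_segment)
    then show ?thesis using ext extreme_point_of_face[OF that] by blast
  qed
  have few: "\<not> (p \<in> C \<and> q \<in> C \<and> r \<in> C \<and> s \<in> C \<and> distinct [p, q, r, s])" for p q r s
  proof
    assume *: "p \<in> C \<and> q \<in> C \<and> r \<in> C \<and> s \<in> C \<and> distinct [p, q, r, s]"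
    then have "card {p, q, r, s} \<le> card C"
      using C(2) by (intro card_mono) (auto intro: card_ge_0_finite)
    with * C(2) show False by simp
  qed
  have L: "max c ((a - x0) * m) \<le> d" using cd corner by simp
  have T: "a \<le> min b (x0 + d / m)" using ab corner ramp_less_iff by auto
  note Ls = ext_seg[OF edges_face_of(1)[unfolded vface_def closed_segment_vertical[OF L, symmetric]]]
  note Ts = ext_seg[OF edges_face_of(4)[unfolded hface_def closed_segment_horizontal[OF T, symmetric]]]
  show "d \<le> (b - x0) * m"
  proof (rule ccontr)
    assume "\<not> d \<le> (b - x0) * m"
    then have R: "max c ((b - x0) * m) < d" using cd by auto
    note Rs = ext_seg[OF edges_face_of(2)[unfolded vface_def closed_segment_vertical[OF less_imp_le[OF R], symmetric]]]
    show False
      using few[of "(a, max c ((a - x0) * m))" "(a, d)" "(b, max c ((b - x0) * m))" "(b, d)"] Ls Rs R ab cd corner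
      by auto
  qed
  show "c \<le> (a - x0) * m"
  proof (rule ccontr)
    assume *: "\<not> c \<le> (a - x0) * m"
    then have B: "a < min b (x0 + c / m)" using ab ramp_less_iff[of a c] by auto
    note Bs = ext_seg[OF edges_face_of(3)[unfolded hface_def closed_segment_horizontal[OF less_imp_le[OF B], symmetric]]]
    have "a < min b (x0 + d / m)" using ab corner ramp_less_iff[of a d] by auto
    then show False
      using few[of "(a, c)" "(min b (x0 + c / m), c)" "(a, d)" "(min b (x0 + d / m), d)"] Bs Ts B cd
      by auto
  qed
qed

text \<open>The ramp line now meets the left and the top side, and what remains is a right triangle
  with its right angle at \<open>(a, d)\<close> and legs \<open>l\<close> and
  \<open>l / m\<close>.\<close>

lemma degenerate_imp_simplex:
  assumes "d \<le> (b - x0) * m" "c \<le> (a - x0) * m"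
  shows "2 simplex polygon"
proof -
  define l where "l = d - (a - x0) * m"
  have l: "0 < l" using corner unfolding l_def by simp
  let ?p = "(a, d)" and ?q = "(a, (a - x0) * m)" and ?r = "(x0 + d / m, d)"
  let ?C = "{?p, ?q, ?r}"
  have r: "x0 + d / m = a + l / m" unfolding l_def using m_pos by (simp add: field_simps)
  have rb: "x0 + d / m \<le> b" using assms m_pos by (simp add: field_simps)
  have "0 < l / m" using l m_pos by simp
  with r have "a \<le> x0 + d / m" by linarith
  have ne: "?p \<noteq> ?q" "?p \<noteq> ?r" "?q \<noteq> ?r" using r \<open>0 < l / m\<close> l unfolding l_def by auto
  have "\<not> collinear ?C"
  proof
    assume "collinear ?C"
    then obtain u where u: "\<And>x y. x \<in> ?C \<Longrightarrow> y \<in> ?C \<Longrightarrow> \<exists>k. x - y = k *\<^sub>R u"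
      unfolding collinear_def by blast
    obtain k1 where k1: "?p - ?q = k1 *\<^sub>R u" using u by blast
    obtain k2 where k2: "?r - ?p = k2 *\<^sub>R u" using u by blast
    obtain u1 u2 where uu: "u = (u1, u2)" by (cases u)
    have "k1 * u1 = 0" "k1 * u2 = l" "k2 * u1 = l / m" "k2 * u2 = 0"
      using k1 k2 r unfolding uu l_def by auto
    then show False using l \<open>0 < l / m\<close> by (metis less_irrefl mult_eq_0_iff)
  qed
  then have "\<not> affine_dependent ?C" using collinear_3_eq_affine_dependent ne by blast
  moreover have "polygon = convex hull ?C"
  proof
    have "?C \<subseteq> polygon" unfolding polygon_def using ab cd corner assms rb m_pos \<open>a \<le> x0 + d / m\<close> by auto
    then show "convex hull ?C \<subseteq> polygon" by (intro hull_minimal convex_polygon)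
    show "polygon \<subseteq> convex hull ?C"
    proof
      fix z assume "z \<in> polygon"
      then obtain x y where z: "z = (x, y)" and xy: "a \<le> x" "y \<le> d" "(x - x0) * m \<le> y"
        unfolding polygon_def by auto
      \<comment> \<open>Barycentric coordinates: \<open>u\<close> is the depth below the top side
        relative to the leg \<open>l\<close>, \<open>v\<close> the distance from the left side
        relative to the leg \<open>l / m\<close>. Their sum is at most 1 exactly on and above the
        ramp line.\<close>
      define u v where "u = (d - y) / l" and "v = (x - a) * m / l"
      have "0 \<le> u" "0 \<le> v" unfolding u_def v_def using xy l m_pos by auto
      moreover have "u + v \<le> 1" unfolding u_def v_def using xy l
        by (simp add: add_divide_distrib[symmetric] l_def algebra_simps)
      moreover have "z = (1 - u - v) *\<^sub>R ?p + u *\<^sub>R ?q + v *\<^sub>R ?r"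
      proof -
        have "u * l = d - y" "v * l = (x - a) * m" unfolding u_def v_def using l by simp_all
        moreover have "u * l = u * d - u * ((a - x0) * m)" unfolding l_def by (simp add: algebra_simps)
        moreover have "v * (l / m) = x - a" unfolding v_def using l m_pos by simp
        ultimately show ?thesis unfolding z r by (simp add: algebra_simps)
      qed
      ultimately show "z \<in> convex hull ?C"
        unfolding convex_hull_3 mem_Collect_eq
        by (intro exI[of _ "1 - u - v"] exI[of _ u] exI[of _ v] conjI) linarith+
    qed
  qed
  moreover have "card ?C = 3" using ne by (simp del: Pair_inject)
  ultimately have "\<not> affine_dependent ?C \<and> int (card ?C) = 2 + 1 \<and> polygon = convex hull ?C" by simp
  then show ?thesis unfolding simplex_def by (rule exI)
qed

end

text \<open>A constant minus a maximum of affine functions is concave, so it lies above its chord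
  \<open>g\<close>, and the chord integrates to the area of the trapezoid.\<close>

lemma integral_trapezoid:
  fixes p q k c \<alpha> \<beta> :: real
  assumes "p \<le> q"
  defines "f \<equiv> \<lambda>x. k - max c (\<alpha> * x + \<beta>)"
  shows "(q - p) * (f p + f q) / 2 \<le> integral {p..q} f"
proof (cases "p = q")
  case False
  then have pq: "p < q" using assms by simp
  define r where "r = (f q - f p) / (q - p)"
  have r: "r * (q - p) = f q - f p" unfolding r_def using pq by simp
  define g where "g = (\<lambda>x. f p + r * (x - p))"
  have gle: "g x \<le> f x" if "x \<in> {p..q}" for x
  proof -
    define t where "t = (x - p) / (q - p)"
    have t: "0 \<le> t" "t \<le> 1" "x = p + t * (q - p)" using that pq by (auto simp: t_def)
    have "g x = f p + t * (r * (q - p))" unfolding g_def t(3) by (simp add: algebra_simps)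
    then have g: "g x = (1 - t) * f p + t * f q" unfolding r by (simp add: algebra_simps)
    have "\<alpha> * x + \<beta> = (1 - t) * (\<alpha> * p + \<beta>) + t * (\<alpha> * q + \<beta>)" unfolding t(3) by (simp add: algebra_simps)
    also have "\<dots> \<le> (1 - t) * max c (\<alpha> * p + \<beta>) + t * max c (\<alpha> * q + \<beta>)"
      using t by (intro add_mono mult_left_mono) auto
    finally have 1: "\<alpha> * x + \<beta> \<le> (1 - t) * max c (\<alpha> * p + \<beta>) + t * max c (\<alpha> * q + \<beta>)" .
    have "c = (1 - t) * c + t * c" by (simp add: algebra_simps)
    also have "\<dots> \<le> (1 - t) * max c (\<alpha> * p + \<beta>) + t * max c (\<alpha> * q + \<beta>)"
      using t by (intro add_mono mult_left_mono) auto
    finally have "max c (\<alpha> * x + \<beta>) \<le> (1 - t) * max c (\<alpha> * p + \<beta>) + t * max c (\<alpha> * q + \<beta>)"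
      using 1 by (intro max.boundedI)
    moreover have "g x = k - ((1 - t) * max c (\<alpha> * p + \<beta>) + t * max c (\<alpha> * q + \<beta>))"
      unfolding g f_def by (simp add: algebra_simps)
    ultimately show ?thesis unfolding f_def by linarith
  qed
  define G where "G = (\<lambda>x. f p * x + r * (x - p)\<^sup>2 / 2)"
  have "((\<lambda>x. A * x + r * (x - p)\<^sup>2 / 2) has_real_derivative A + r * (x - p)) (at x within {p..q})" for A x
    by (rule derivative_eq_intros refl | simp)+
  then have "(g has_integral (G q - G p)) {p..q}"
    unfolding g_def G_def using assms(1)
    by (intro fundamental_theorem_of_calculus) (simp_all add: has_real_derivative_iff_has_vector_derivative)
  moreover have "continuous_on {p..q} f" unfolding f_def by (intro continuous_intros)
  ultimately have "G q - G p \<le> integral {p..q} f"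
    by (intro has_integral_le[OF _ integrable_integral[OF integrable_continuous_real] gle])
  moreover have "G q - G p = f p * (q - p) + (r * (q - p)) * (q - p) / 2"
    unfolding G_def by (simp add: power2_eq_square algebra_simps)
  ultimately show ?thesis unfolding r by (simp add: field_simps)
qed (simp add: assms)

section \<open>Area and flux balance of a cut box\<close>

context cut_box
begin

text \<open>The range of \<open>y\<close> is cut down to the heights at which the slice is nonempty,
  so that its bounds are in the right order, as the divergence theorem demands.\<close>

lemma polygon_horizontal_slices:
  "polygon = {(x, y). y \<in> {max c ((a - x0) * m)..d} \<and> x \<in> {a..min b (x0 + y / m)}}"
proof -
  have "(a - x0) * m \<le> y" if "a \<le> x" "x \<le> x0 + y / m" for x y
    using that ramp_le_iff[of a y] by linarith
  then show ?thesis unfolding polygon_def by (auto simp: ramp_le_iff)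
qed

lemma polygon_vertical_slices:
  "polygon = {(x, y). x \<in> {a..min b (x0 + d / m)} \<and> y \<in> {max c ((x - x0) * m)..d}}"
proof -
  have "x \<le> x0 + d / m" if "(x - x0) * m \<le> y" "y \<le> d" for x y
    using that ramp_le_iff[of x d] by linarith
  then show ?thesis unfolding polygon_def by auto
qed

lemma left_length_pos: "max c ((a - x0) * m) < d"
  using cd corner by simp

lemma top_length_pos: "a < min b (x0 + d / m)"
  using ab corner ramp_less_iff[of a d] by simp

lemma measure_polygon: "measure lebesgue polygon = integral polygon (\<lambda>_. 1)"
  by (rule lmeasure_integral[OF lmeasurable_compact[OF compact_polygon]])

text \<open>The length of a vertical slice is a concave function of \<open>x\<close>, so the area is
  at least that of the trapezoid whose parallel sides are the left and the right edge. If the right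
  edge is missing, \<open>max 0\<close> degrades it to a triangle.\<close>

lemma measure_polygon_ge_vertical:
  "(min b (x0 + d / m) - a) * ((d - max c ((a - x0) * m)) + max 0 (d - max c ((b - x0) * m))) / 2
     \<le> measure lebesgue polygon"
proof -
  let ?q = "min b (x0 + d / m)" and ?f = "\<lambda>x. d - max c (m * x + - x0 * m)"
  have f: "?f x = d - max c ((x - x0) * m)" for x by (simp add: algebra_simps)
  have "0 \<le> d - max c ((x - x0) * m)" if "x \<in> {a..?q}" for x
    using that cd ramp_le_iff[of x d] by auto
  then have "integral {a..?q} (\<lambda>x. integral {max c ((x - x0) * m)..d} (\<lambda>y. 1)) = integral {a..?q} ?f"
    unfolding f by (intro integral_cong) auto
  then have eq: "measure lebesgue polygon = integral {a..?q} ?f"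
    unfolding measure_polygon fubini_vertical_slices(2)[OF compact_polygon polygon_vertical_slices continuous_on_const] .
  have "max 0 (d - max c ((b - x0) * m)) \<le> ?f ?q"
  proof (cases "(b - x0) * m < d")
    case True
    then have "?q = b" using ramp_less_iff[of b d] by simp
    then show ?thesis using True cd unfolding f by simp
  next
    case False
    moreover have "(?q - x0) * m \<le> d" unfolding ramp_le_iff by simp
    ultimately show ?thesis unfolding f using cd by auto
  qed
  then have "(?q - a) * ((d - max c ((a - x0) * m)) + max 0 (d - max c ((b - x0) * m)))
      \<le> (?q - a) * (?f a + ?f ?q)"
    unfolding f using top_length_pos by (intro mult_left_mono) auto
  also have "\<dots> \<le> 2 * integral {a..?q} ?f"
    using integral_trapezoid[of a ?q d c m "- x0 * m"] top_length_pos by simp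
  finally show ?thesis unfolding eq by simp
qed

lemma measure_polygon_ge_horizontal:
  "(d - max c ((a - x0) * m)) * ((min b (x0 + d / m) - a) + max 0 (min b (x0 + c / m) - a)) / 2
     \<le> measure lebesgue polygon"
proof -
  \<comment> \<open>The slice length \<open>min b (x0 + y / m) - a\<close> is written with a maximum
    of negatives to fit the form required by \<open>integral_trapezoid\<close>.\<close>
  let ?p = "max c ((a - x0) * m)" and ?f = "\<lambda>y. - a - max (- b) ((- 1 / m) * y + - x0)"
  have f: "?f y = min b (x0 + y / m) - a" for y by (simp add: max_def min_def)
  have "0 \<le> min b (x0 + y / m) - a" if "y \<in> {?p..d}" for y
    using that ab ramp_le_iff[of a y] by auto
  then have "integral {?p..d} (\<lambda>y. integral {a..min b (x0 + y / m)} (\<lambda>x. 1)) = integral {?p..d} ?f"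
    unfolding f by (intro integral_cong) auto
  then have eq: "measure lebesgue polygon = integral {?p..d} ?f"
    unfolding measure_polygon fubini_horizontal_slices(2)[OF compact_polygon polygon_horizontal_slices continuous_on_const] .
  have "max 0 (min b (x0 + c / m) - a) \<le> ?f ?p"
  proof (cases "(a - x0) * m < c")
    case True
    then have "?p = c" by simp
    then show ?thesis using True ab ramp_less_iff[of a c] unfolding f by simp
  next
    case False
    then have "min b (x0 + c / m) \<le> a" using ramp_less_iff[of a c] by auto
    moreover have "a \<le> x0 + ?p / m" unfolding ramp_le_iff[symmetric] by simp
    ultimately show ?thesis unfolding f using ab by auto
  qed
  then have "(d - ?p) * ((min b (x0 + d / m) - a) + max 0 (min b (x0 + c / m) - a))
      \<le> (d - ?p) * (?f ?p + ?f d)"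
    unfolding f using left_length_pos by (intro mult_left_mono) auto
  also have "\<dots> \<le> 2 * integral {?p..d} ?f"
    using integral_trapezoid[of ?p d "- a" "- b" "- 1 / m" "- x0"] left_length_pos by simp
  finally show ?thesis unfolding eq by simp
qed

text \<open>In the slice form of the divergence theorem the ramp occurs twice: as right end of
  horizontal slices and as lower end of vertical slices. Since dy = m dx along the ramp, the two
  contributions cancel by tangency of \<open>F\<close>, and only the four straight sides
  remain.\<close>

lemma flux_identity:
  fixes F :: "plane \<Rightarrow> plane"
  assumes F: "K-lipschitz_on UNIV F"
    and div: "AE p in lebesgue_on polygon. \<exists>D. (F has_derivative D) (at p) \<and> (\<Sum>b\<in>Basis. D b \<bullet> b) = 0"
    and ramp: "\<And>p. p \<in> ramp_edge \<Longrightarrow> snd (F p) = m * fst (F p)"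
  shows "integral {max c ((b - x0) * m)..d} (\<lambda>y. fst (F (b, y)))
      - integral {max c ((a - x0) * m)..d} (\<lambda>y. fst (F (a, y)))
      + integral {a..min b (x0 + d / m)} (\<lambda>x. snd (F (x, d)))
      - integral {a..min b (x0 + c / m)} (\<lambda>x. snd (F (x, c))) = 0"
proof -
  let ?c' = "max c ((a - x0) * m)" and ?b' = "min b (x0 + d / m)"
  let ?u = "\<lambda>y. min b (x0 + y / m)" and ?s = "\<lambda>x. max c ((x - x0) * m)"
  have cF: "continuous_on S F" for S
    using lipschitz_on_continuous_on[OF F] continuous_on_subset by blast
  have cFg: "continuous_on S (\<lambda>t. F (g t))" if "continuous_on S g" for S :: "real set" and g
    by (rule continuous_on_compose2[OF cF[of UNIV] that]) auto
  have cu: "continuous_on S ?u" and cs: "continuous_on S ?s" for S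
    by (intro continuous_intros; use m_pos in simp)+
  note ci = integrable_continuous_real continuous_intros cFg cu cs
  have "integral {?c'..d} (\<lambda>y. fst (F (?u y, y)) - fst (F (a, y)))
       + integral {a..?b'} (\<lambda>x. snd (F (x, d)) - snd (F (x, ?s x))) = 0"
  proof (rule divergence_theorem_divergence_free[OF F compact_polygon polygon_horizontal_slices
        _ _ _ cu polygon_vertical_slices _ _ cs _ div])
    show "a \<le> ?u y" if "y \<in> {?c'..d}" for y using that ab ramp_le_iff[of a y] by auto
    show "?s x \<le> d" if "x \<in> {a..?b'}" for x using that cd ramp_le_iff[of x d] by auto
  qed (use left_length_pos top_length_pos in auto)
  moreover have "integral {?c'..d} (\<lambda>y. fst (F (?u y, y)) - fst (F (a, y)))
      = integral {?c'..d} (\<lambda>y. fst (F (?u y, y))) - integral {?c'..d} (\<lambda>y. fst (F (a, y)))"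
    by (intro hk_diff ci)
  moreover have "integral {a..?b'} (\<lambda>x. snd (F (x, d)) - snd (F (x, ?s x)))
      = integral {a..?b'} (\<lambda>x. snd (F (x, d))) - integral {a..?b'} (\<lambda>x. snd (F (x, ?s x)))"
    by (intro hk_diff ci)
  moreover have "integral {?c'..d} (\<lambda>y. fst (F (?u y, y))) - integral {a..?b'} (\<lambda>x. snd (F (x, ?s x)))
      = integral {max c ((b - x0) * m)..d} (\<lambda>y. fst (F (b, y)))
        - integral {a..min b (x0 + c / m)} (\<lambda>x. snd (F (x, c)))"
  proof (cases "(b - x0) * m \<le> c")
    \<comment> \<open>The ramp line passes through or below the bottom right corner, so the polygon
      is the whole box.\<close>
    case True
    have lt: "(a - x0) * m < (b - x0) * m" using ab m_pos by simp
    have "min b (x0 + d / m) = b" "min b (x0 + c / m) = b"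
      using True cd ramp_le_iff[of b c] ramp_le_iff[of b d] by auto
    moreover have *: "?c' = c" "max c ((b - x0) * m) = c" using True lt by auto
    moreover have u: "?u y = b" if "y \<in> {c..d}" for y using that True ramp_le_iff[of b y] by auto
    moreover have s: "?s x = c" if "x \<in> {a..b}" for x
    proof -
      have "(x - x0) * m \<le> (b - x0) * m" using that m_pos by simp
      then show ?thesis using True by simp
    qed
    moreover have "integral {c..d} (\<lambda>y. fst (F (?u y, y))) = integral {c..d} (\<lambda>y. fst (F (b, y)))"
      by (rule integral_cong) (simp only: u)
    moreover have "integral {a..b} (\<lambda>x. snd (F (x, ?s x))) = integral {a..b} (\<lambda>x. snd (F (x, c)))"
      by (rule integral_cong) (simp only: s)
    ultimately show ?thesis by (simp only:)
  next
    case False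
    \<comment> \<open>The ramp edge runs from abscissa \<open>p\<close> to \<open>?b'\<close> and
      from height \<open>?c'\<close> to \<open>y1\<close>. The boundary integrals are split at these
      values into a straight part and a ramp part.\<close>
    define p where "p = max a (x0 + c / m)"
    define y1 where "y1 = min d ((b - x0) * m)"
    have yR: "c < (b - x0) * m" using False by simp
    have pb: "p < ?b'" using bottom_right_cut_iff yR unfolding p_def ramp_start_def ramp_end_def by simp
    have cp: "?c' = (p - x0) * m" unfolding p_def using m_pos
      by (simp add: max_mult_distrib_right max_def field_simps)
    have yb: "y1 = (?b' - x0) * m" unfolding y1_def using m_pos
      by (simp add: min_def field_simps)
    have cy: "?c' < y1" unfolding cp yb using pb m_pos by simp
    have "y1 \<le> d" unfolding y1_def by simp
    have "integral {?c'..d} (\<lambda>y. fst (F (?u y, y)))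
        = integral {?c'..y1} (\<lambda>y. fst (F (?u y, y))) + integral {y1..d} (\<lambda>y. fst (F (?u y, y)))"
      using cy \<open>y1 \<le> d\<close> by (intro hk_combine[symmetric] ci) auto
    also have "integral {?c'..y1} (\<lambda>y. fst (F (?u y, y))) = integral {?c'..y1} (\<lambda>y. fst (F (x0 + y / m, y)))"
    proof (rule integral_cong)
      fix y assume "y \<in> {?c'..y1}"
      then have "x0 + y / m \<le> b" unfolding y1_def using ramp_ge_iff[of y b] by auto
      then show "fst (F (?u y, y)) = fst (F (x0 + y / m, y))" by (simp add: min_def)
    qed
    also have "integral {y1..d} (\<lambda>y. fst (F (?u y, y))) = integral {max c ((b - x0) * m)..d} (\<lambda>y. fst (F (b, y)))"
    proof (cases "(b - x0) * m < d")
      case True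
      then have "y1 = max c ((b - x0) * m)" using yR unfolding y1_def by simp
      moreover have u: "?u y = b" if "y \<in> {y1..d}" for y
        using that ramp_le_iff[of b y] True unfolding y1_def by auto
      moreover have "integral {y1..d} (\<lambda>y. fst (F (?u y, y))) = integral {y1..d} (\<lambda>y. fst (F (b, y)))"
        by (rule integral_cong) (simp only: u)
      ultimately show ?thesis by (simp only:)
    next
      case False
      \<comment> \<open>The right edge is empty or a single point, and so both sides are 0.\<close>
      then have "y1 = d" "{max c ((b - x0) * m)..d} = {} \<or> {max c ((b - x0) * m)..d} = {d}"
        unfolding y1_def by auto
      then show ?thesis by auto
    qed
    finally have 1: "integral {?c'..d} (\<lambda>y. fst (F (?u y, y)))
        = integral {?c'..y1} (\<lambda>y. fst (F (x0 + y / m, y))) + integral {max c ((b - x0) * m)..d} (\<lambda>y. fst (F (b, y)))" .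
    have "a \<le> p" unfolding p_def by simp
    have "integral {a..?b'} (\<lambda>x. snd (F (x, ?s x)))
        = integral {a..p} (\<lambda>x. snd (F (x, ?s x))) + integral {p..?b'} (\<lambda>x. snd (F (x, ?s x)))"
      using pb \<open>a \<le> p\<close> by (intro hk_combine[symmetric] ci) auto
    also have "integral {p..?b'} (\<lambda>x. snd (F (x, ?s x))) = integral {p..?b'} (\<lambda>x. m * fst (F (x, (x - x0) * m)))"
    proof (rule integral_cong)
      fix x assume x: "x \<in> {p..?b'}"
      then have "(x, (x - x0) * m) \<in> ramp_edge"
        unfolding ramp_edge_image by (auto simp: p_def ramp_start_def ramp_end_def)
      moreover have "?s x = (x - x0) * m" using x ramp_ge_iff[of c x] unfolding p_def by auto
      ultimately show "snd (F (x, ?s x)) = m * fst (F (x, (x - x0) * m))" using ramp by simp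
    qed
    also have "integral {a..p} (\<lambda>x. snd (F (x, ?s x))) = integral {a..min b (x0 + c / m)} (\<lambda>x. snd (F (x, c)))"
    proof (cases "a < x0 + c / m")
      case True
      then have "p = min b (x0 + c / m)" using ramp_greater_iff[of c b] yR unfolding p_def by simp
      moreover have s: "?s x = c" if "x \<in> {a..p}" for x
        using that True ramp_le_iff[of x c] unfolding p_def by auto
      moreover have "integral {a..p} (\<lambda>x. snd (F (x, ?s x))) = integral {a..p} (\<lambda>x. snd (F (x, c)))"
        by (rule integral_cong) (simp only: s)
      ultimately show ?thesis by (simp only:)
    next
      case False
      then have "p = a" "{a..min b (x0 + c / m)} = {} \<or> {a..min b (x0 + c / m)} = {a}"
        unfolding p_def using ab by auto
      then show ?thesis by auto
    qed
    finally have 2: "integral {a..?b'} (\<lambda>x. snd (F (x, ?s x)))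
        = integral {a..min b (x0 + c / m)} (\<lambda>x. snd (F (x, c))) + m * integral {p..?b'} (\<lambda>x. fst (F (x, (x - x0) * m)))"
      by simp
    \<comment> \<open>The substitution y = (x - x0) * m along the ramp, carried out through the unit
      interval; it yields the factor \<open>m\<close> that tangency needs.\<close>
    have "integral {?c'..y1} (\<lambda>y. fst (F (x0 + y / m, y)))
        = (y1 - ?c') * integral {0..1} (\<lambda>t. fst (F (x0 + (?c' + t * (y1 - ?c')) / m, ?c' + t * (y1 - ?c'))))"
      by (rule integral_interval_unit[OF cy, symmetric])
    also have "\<dots> = m * ((?b' - p) * integral {0..1} (\<lambda>t. fst (F (p + t * (?b' - p), (p + t * (?b' - p) - x0) * m))))"
    proof -
      have "x0 + (?c' + t * (y1 - ?c')) / m = p + t * (?b' - p)"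
        "?c' + t * (y1 - ?c') = (p + t * (?b' - p) - x0) * m" for t
        unfolding cp yb using m_pos by (simp_all add: field_simps)
      moreover have "y1 - ?c' = m * (?b' - p)" unfolding cp yb by (simp add: algebra_simps)
      ultimately show ?thesis by (simp only: mult.assoc)
    qed
    also have "\<dots> = m * integral {p..?b'} (\<lambda>x. fst (F (x, (x - x0) * m)))"
      using integral_interval_unit[OF pb, of "\<lambda>x. fst (F (x, (x - x0) * m))"] by simp
    finally show ?thesis using 1 2 by simp
  qed
  ultimately show ?thesis by linarith
qed

end

section \<open>Distinct faces and their outer normals\<close>

lemma vface_neq_hface:
  assumes "max c ((x - x0) * m) < d"
  shows "vface x0 m x c d \<noteq> hface x0 m' y a b"
proof
  assume eq: "vface x0 m x c d = hface x0 m' y a b"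
  have "(x, d) \<in> vface x0 m x c d" "(x, max c ((x - x0) * m)) \<in> vface x0 m x c d"
    using assms unfolding vface_def by auto
  then have "d = y" "max c ((x - x0) * m) = y" unfolding eq hface_def by blast+
  with assms show False by simp
qed

lemma vface_eqD:
  assumes "max c ((x - x0) * m) < d" "vface x0 m x c d = vface x0 m x' c' d'"
  shows "x = x'" "d = d'"
proof -
  have "{max c ((x - x0) * m)..d} \<noteq> {}" using assms(1) by auto
  then have "{x} = {x'}" "{max c ((x - x0) * m)..d} = {max c' ((x' - x0) * m)..d'}"
    using assms(2) unfolding vface_def by (auto simp: times_eq_iff)
  then show "x = x'" "d = d'" using assms(1) by (auto simp: Icc_eq_Icc)
qed

lemma hface_eqD:
  assumes "a < min b (x0 + y / m)" "hface x0 m y a b = hface x0 m y' a' b'"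
  shows "y = y'" "a = a'"
proof -
  have "{a..min b (x0 + y / m)} \<noteq> {}" using assms(1) by auto
  then have "{y} = {y'}" "{a..min b (x0 + y / m)} = {a'..min b' (x0 + y' / m)}"
    using assms(2) unfolding hface_def by (auto simp: times_eq_iff)
  then show "y = y'" "a = a'" using assms(1) by (auto simp: Icc_eq_Icc)
qed

context cut_box
begin

lemma vface_neq_ramp_edge:
  assumes "max c' ((x - x0) * m) < d'"
  shows "vface x0 m x c' d' \<noteq> ramp_edge"
proof
  assume eq: "vface x0 m x c' d' = ramp_edge"
  have "(x, d') \<in> vface x0 m x c' d'" "(x, max c' ((x - x0) * m)) \<in> vface x0 m x c' d'"
    using assms unfolding vface_def by auto
  then have "d' = (x - x0) * m" "max c' ((x - x0) * m) = (x - x0) * m"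
    unfolding eq ramp_edge_def by blast+
  with assms show False by simp
qed

lemma hface_neq_ramp_edge:
  assumes "a' < min b' (x0 + y / m)"
  shows "hface x0 m y a' b' \<noteq> ramp_edge"
proof
  assume eq: "hface x0 m y a' b' = ramp_edge"
  have "(a', y) \<in> hface x0 m y a' b'" "(min b' (x0 + y / m), y) \<in> hface x0 m y a' b'"
    using assms unfolding hface_def by auto
  then have "(a' - x0) * m = (min b' (x0 + y / m) - x0) * m"
    unfolding eq ramp_edge_def by auto
  then have "a' = min b' (x0 + y / m)" using m_pos by auto
  with assms show False by (simp only: less_irrefl)
qed

lemma closure_between:
  assumes "inner_part \<subseteq> E" "E \<subseteq> polygon"
  shows "closure E = polygon"
  using closure_mono[OF assms(1)] closure_minimal[OF assms(2) compact_imp_closed[OF compact_polygon]]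
  unfolding closure_inner_part by blast

text \<open>One inner point serves as the strict witness for all five edges. The ramp normal is the
  normalised gradient of \<open>(x - x0) * m - y\<close>, which is nonpositive on the polygon and
  zero on the ramp.\<close>

lemma outer_normals:
  assumes E: "inner_part \<subseteq> E" "E \<subseteq> polygon"
  shows "outer_normal E left_edge = (-1, 0)"
    and "outer_normal E top_edge = (0, 1)"
    and "(b - x0) * m < d \<Longrightarrow> outer_normal E right_edge = (1, 0)"
    and "(a - x0) * m < c \<Longrightarrow> outer_normal E bottom_edge = (0, -1)"
    and "c < (b - x0) * m \<Longrightarrow> outer_normal E ramp_edge = (1 / sqrt (m\<^sup>2 + 1)) *\<^sub>R (m, -1)"
proof -
  obtain x y where xy: "(x, y) \<in> inner_part" using inner_part_nonempty by auto
  then have i: "a < x" "x < b" "c < y" "y < d" "(x - x0) * m < y" unfolding inner_part_def by auto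
  have xyE: "(x, y) \<in> E" using xy E by blast
  have sub: "F \<subseteq> closure E" if "F face_of polygon" for F
    unfolding closure_between[OF E] by (rule face_of_imp_subset[OF that])
  note subs = edges_face_of[THEN sub]
  have inP: "p \<in> polygon" if "p \<in> E" for p using that E by blast
  show "outer_normal E left_edge = (-1, 0)"
  proof (rule outer_normal_eqI[OF _ _ _ _ subs(1)])
    show "(a, d) \<in> left_edge" "(a, max c ((a - x0) * m)) \<in> left_edge" "(a, d) \<in> left_edge"
      "(a, d) \<noteq> (a, max c ((a - x0) * m))"
      using left_length_pos unfolding vface_def by auto
    show "(-1, 0) \<bullet> (q - p) \<le> 0" if "p \<in> left_edge" "q \<in> E" for p q
      using that(1) inP[OF that(2)] unfolding vface_def polygon_def by auto
    show "(-1, 0) \<bullet> ((x, y) - (a, d)) < 0" using i by simp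
  qed (use xyE in \<open>auto simp: norm_Pair\<close>)
  show "outer_normal E top_edge = (0, 1)"
  proof (rule outer_normal_eqI[OF _ _ _ _ subs(4)])
    show "(a, d) \<in> top_edge" "(min b (x0 + d / m), d) \<in> top_edge" "(a, d) \<in> top_edge"
      "(a, d) \<noteq> (min b (x0 + d / m), d)"
      using top_length_pos unfolding hface_def by auto
    show "(0, 1) \<bullet> (q - p) \<le> 0" if "p \<in> top_edge" "q \<in> E" for p q
      using that(1) inP[OF that(2)] unfolding hface_def polygon_def by auto
    show "(0, 1) \<bullet> ((x, y) - (a, d)) < 0" using i by simp
  qed (use xyE in \<open>auto simp: norm_Pair\<close>)
  show "outer_normal E right_edge = (1, 0)" if "(b - x0) * m < d"
  proof (rule outer_normal_eqI[OF _ _ _ _ subs(2)])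
    show "(b, d) \<in> right_edge" "(b, max c ((b - x0) * m)) \<in> right_edge" "(b, d) \<in> right_edge"
      "(b, d) \<noteq> (b, max c ((b - x0) * m))"
      using that cd unfolding vface_def by auto
    show "(1, 0) \<bullet> (q - p) \<le> 0" if "p \<in> right_edge" "q \<in> E" for p q
      using that(1) inP[OF that(2)] unfolding vface_def polygon_def by auto
    show "(1, 0) \<bullet> ((x, y) - (b, d)) < 0" using i by simp
  qed (use xyE in \<open>auto simp: norm_Pair\<close>)
  show "outer_normal E bottom_edge = (0, -1)" if "(a - x0) * m < c"
  proof (rule outer_normal_eqI[OF _ _ _ _ subs(3)])
    have "a < min b (x0 + c / m)" using that ab ramp_less_iff[of a c] by simp
    then show "(a, c) \<in> bottom_edge" "(min b (x0 + c / m), c) \<in> bottom_edge" "(a, c) \<in> bottom_edge"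
      "(a, c) \<noteq> (min b (x0 + c / m), c)"
      unfolding hface_def by auto
    show "(0, -1) \<bullet> (q - p) \<le> 0" if "p \<in> bottom_edge" "q \<in> E" for p q
      using that(1) inP[OF that(2)] unfolding hface_def polygon_def by auto
    show "(0, -1) \<bullet> ((x, y) - (a, c)) < 0" using i by simp
  qed (use xyE in \<open>auto simp: norm_Pair\<close>)
  show "outer_normal E ramp_edge = (1 / sqrt (m\<^sup>2 + 1)) *\<^sub>R (m, -1)" if "c < (b - x0) * m"
  proof (rule outer_normal_eqI[OF _ _ _ _ subs(5)])
    have lt: "fst ramp_start < fst ramp_end" using bottom_right_cut_iff that by simp
    show "ramp_start \<in> ramp_edge" "ramp_end \<in> ramp_edge" "ramp_start \<in> ramp_edge"
      unfolding ramp_edge_segment[OF less_imp_le[OF lt]] by auto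
    show "ramp_start \<noteq> ramp_end" using lt by auto
    have s: "0 < sqrt (m\<^sup>2 + 1)" by (simp add: add_nonneg_pos)
    show "norm ((1 / sqrt (m\<^sup>2 + 1)) *\<^sub>R (m, - 1 :: real)) = 1"
      using s by (simp add: norm_Pair del: scaleR_Pair)
    have inner: "((1 / sqrt (m\<^sup>2 + 1)) *\<^sub>R (m, -1)) \<bullet> (q - p)
        = ((snd p - (fst p - x0) * m) - (snd q - (fst q - x0) * m)) / sqrt (m\<^sup>2 + 1)" for p q :: plane
      by (simp add: inner_prod_def algebra_simps diff_divide_distrib add_divide_distrib)
    show "((1 / sqrt (m\<^sup>2 + 1)) *\<^sub>R (m, -1)) \<bullet> (q - p) \<le> 0" if "p \<in> ramp_edge" "q \<in> E" for p q
      unfolding inner using that(1) inP[OF that(2)] s unfolding ramp_edge_def polygon_def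
      by (auto simp: divide_le_0_iff)
    have "snd ramp_start = (fst ramp_start - x0) * m" unfolding ramp_start_def by simp
    then show "((1 / sqrt (m\<^sup>2 + 1)) *\<^sub>R (m, -1)) \<bullet> ((x, y) - ramp_start) < 0"
      unfolding inner using i s by (simp add: divide_less_0_iff)
  qed (use xyE in auto)
qed

end

section \<open>Cells and faces of the cut mesh\<close>

context dod_setting
begin

definition N :: nat where
  "N = (SOME N. L = real N * h)"

lemma L_eq: "L = real N * h"
  unfolding N_def using cartesian by (rule someI_ex)

definition m :: real where
  "m = tan \<gamma>"

lemma m_pos: "0 < m"
  using gamma_range by (simp add: m_def tan_gt_zero)

lemma Omega_eq: "Omega = {(x, y). 0 < x \<and> x < L \<and> 0 < y \<and> y < L \<and> y > (x - x0) * m}"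
  unfolding Omega_def m_def ..

lemma cos_pos: "0 < cos \<gamma>"
  using gamma_range by (simp add: cos_gt_zero_pi)

definition cell :: "nat \<Rightarrow> nat \<Rightarrow> plane set" where
  "cell i j = cbox (real i * h, real j * h) (real (Suc i) * h, real (Suc j) * h) \<inter> Omega"

text \<open>The last conjunct is the assumption \<open>corner\<close> of \<open>cut_box\<close>. It
  singles out the background boxes whose cut has positive area; the others do not meet the domain at
  all.\<close>

definition cell_index :: "nat \<Rightarrow> nat \<Rightarrow> bool" where
  "cell_index i j \<longleftrightarrow> i < N \<and> j < N \<and> (real i * h - x0) * m < real (Suc j) * h"

text \<open>Faces are indexed by the grid and not by cells: \<open>vf (Suc i) j\<close> is the right
  face of \<open>cell i j\<close> and the left face of \<open>cell (Suc i) j\<close>. The cut-off by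
  the ramp depends only on the grid line, so both cells see the same set.\<close>

definition vf :: "nat \<Rightarrow> nat \<Rightarrow> plane set" where
  "vf i j = vface x0 m (real i * h) (real j * h) (real (Suc j) * h)"

definition hf :: "nat \<Rightarrow> nat \<Rightarrow> plane set" where
  "hf i j = hface x0 m (real j * h) (real i * h) (real (Suc i) * h)"

definition rf :: "nat \<Rightarrow> nat \<Rightarrow> plane set" where
  "rf i j = cut_box.ramp_edge (real i * h) (real (Suc i) * h) (real j * h) (real (Suc j) * h) x0 m"

abbreviation "cpoly i j \<equiv> cut_box.polygon (real i * h) (real (Suc i) * h) (real j * h) (real (Suc j) * h) x0 m"
abbreviation "cinner i j \<equiv> cut_box.inner_part (real i * h) (real (Suc i) * h) (real j * h) (real (Suc j) * h) x0 m"

text \<open>Positive length of the grid face: the remaining inequality between consecutive grid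
  lines always holds.\<close>

definition v_nondeg :: "nat \<Rightarrow> nat \<Rightarrow> bool" where
  "v_nondeg i j \<longleftrightarrow> (real i * h - x0) * m < real (Suc j) * h"

definition h_nondeg :: "nat \<Rightarrow> nat \<Rightarrow> bool" where
  "h_nondeg i j \<longleftrightarrow> (real i * h - x0) * m < real j * h"

definition r_nondeg :: "nat \<Rightarrow> nat \<Rightarrow> bool" where
  "r_nondeg i j \<longleftrightarrow> real j * h < (real (Suc i) * h - x0) * m"

lemma cut_box_cell:
  assumes "cell_index i j"
  shows "cut_box (real i * h) (real (Suc i) * h) (real j * h) (real (Suc j) * h) x0 m"
proof (rule cut_box.intro)
  show "real i * h < real (Suc i) * h" "real j * h < real (Suc j) * h" using h_pos by simp_all
  show "(real i * h - x0) * m < real (Suc j) * h" using assms unfolding cell_index_def by blast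
qed (rule m_pos)

lemma background_index: "real (Suc i) * h \<le> L \<longleftrightarrow> i < N"
proof -
  have "real (Suc i) * h \<le> real N * h \<longleftrightarrow> i < N" using h_pos by (simp del: of_nat_Suc add: Suc_le_eq)
  then show ?thesis by (simp only: L_eq[symmetric])
qed

lemma cell_between:
  assumes "cell_index i j"
  shows "cinner i j \<subseteq> cell i j" "cell i j \<subseteq> cpoly i j"
proof -
  interpret cut_box "real i * h" "real (Suc i) * h" "real j * h" "real (Suc j) * h" x0 m
    by (rule cut_box_cell[OF assms])
  have b: "real (Suc i) * h \<le> L" "real (Suc j) * h \<le> L" "0 \<le> real i * h" "0 \<le> real j * h"
  proof -
    have "i < N" "j < N" using assms by (simp_all only: cell_index_def)
    then show "real (Suc i) * h \<le> L" "real (Suc j) * h \<le> L" by (simp_all only: background_index)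
    show "0 \<le> real i * h" "0 \<le> real j * h" using h_pos by simp_all
  qed
  show "inner_part \<subseteq> cell i j"
  proof
    fix p assume "p \<in> inner_part"
    then obtain x y where p: "p = (x, y)" and i: "real i * h < x" "x < real (Suc i) * h"
      "real j * h < y" "y < real (Suc j) * h" "(x - x0) * m < y"
      unfolding inner_part_def by blast
    have "0 < x" "x < L" "0 < y" "y < L"
      using le_less_trans[OF b(3) i(1)] less_le_trans[OF i(2) b(1)]
        le_less_trans[OF b(4) i(3)] less_le_trans[OF i(4) b(2)] by (simp_all only:)
    with i show "p \<in> cell i j"
      unfolding p cell_def Omega_eq cbox_Pair_eq by (simp del: of_nat_Suc)
  qed
  show "cell i j \<subseteq> polygon"
  proof
    fix p assume p: "p \<in> cell i j"
    obtain x y where xy: "p = (x, y)" by (cases p)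
    show "p \<in> polygon"
      using p unfolding xy polygon_def cell_def Omega_eq cbox_Pair_eq by (simp del: of_nat_Suc)
  qed
qed

lemma closure_cell: "cell_index i j \<Longrightarrow> closure (cell i j) = cpoly i j"
  by (rule cut_box.closure_between[OF cut_box_cell cell_between])

lemma Omega_box_halfspace: "Omega = box (0, 0) (L, L) \<inter> {p. (m, -1) \<bullet> p < m * x0}"
  unfolding Omega_eq by (auto simp: mem_box Basis_prod_def algebra_simps)

lemma open_Omega: "open Omega"
  unfolding Omega_box_halfspace by (simp add: open_Int open_box open_halfspace_lt)

lemma convex_Omega: "convex Omega"
  unfolding Omega_box_halfspace by (simp add: convex_Int convex_box convex_halfspace_lt)

lemma bounded_Omega: "bounded Omega"
  by (rule bounded_subset[OF bounded_cbox[of "(0, 0)" "(L, L)"]]) (auto simp: Omega_eq cbox_Pair_eq)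

lemma lmeasurable_cell: "cell i j \<in> lmeasurable"
  unfolding cell_def
  by (intro bounded_set_imp_lmeasurable bounded_Int sets.Int) (auto simp: bounded_Omega open_Omega borel_open)

text \<open>The frontier of a convex set is negligible, so passing to the closure does not change
  the area.\<close>

lemma measure_cell:
  assumes "cell_index i j"
  shows "measure lebesgue (cell i j) = measure lebesgue (cpoly i j)"
proof -
  have "convex (cell i j)" unfolding cell_def by (intro convex_Int convex_box convex_Omega)
  moreover have "bounded (cell i j)" unfolding cell_def using bounded_Omega by blast
  ultimately have "measure lebesgue (closure (cell i j)) = measure lebesgue (cell i j)"
    using measure_closure negligible_convex_frontier by blast
  then show ?thesis unfolding closure_cell[OF assms] by simp
qed

lemma measure_cell_pos:
  assumes "cell_index i j"
  shows "0 < measure lebesgue (cell i j)"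
proof -
  interpret cut_box "real i * h" "real (Suc i) * h" "real j * h" "real (Suc j) * h" x0 m
    by (rule cut_box_cell[OF assms])
  define w l where "w = min (real (Suc i) * h) (x0 + real (Suc j) * h / m) - real i * h"
    and "l = real (Suc j) * h - max (real j * h) ((real i * h - x0) * m)"
  have "0 < w" "0 < l" unfolding w_def l_def using left_length_pos top_length_pos by (simp_all only: diff_gt_0_iff_gt)
  then have "0 < w * l / 2" by simp
  also have "w * l / 2 \<le> w * (l + max 0 r) / 2" for r
    using \<open>0 < w\<close> by (intro divide_right_mono mult_left_mono) auto
  finally have "0 < w * (l + max 0 r) / 2" for r .
  then show ?thesis
    unfolding measure_cell[OF assms] w_def l_def using measure_polygon_ge_vertical by (rule less_le_trans)
qed

lemma cell_empty:
  assumes "\<not> (real i * h - x0) * m < real (Suc j) * h"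
  shows "cell i j = {}"
proof -
  have False if "(x, y) \<in> cell i j" for x y
  proof -
    have "real i * h \<le> x" "y \<le> real (Suc j) * h" "(x - x0) * m < y"
      using that unfolding cell_def Omega_eq cbox_Pair_eq by (simp_all del: of_nat_Suc)
    moreover from this(1) have "(real i * h - x0) * m \<le> (x - x0) * m" using m_pos by simp
    ultimately show False using assms by linarith
  qed
  then show ?thesis by auto
qed

lemma cells_eq: "cells = {cell i j | i j. cell_index i j}"
proof -
  have *: "measure lebesgue (cell i j) > 0 \<longleftrightarrow> cell_index i j" if "i < N" "j < N" for i j
  proof (cases "cell_index i j")
    case False
    then have "cell i j = {}" using that cell_empty unfolding cell_index_def by blast
    with False show ?thesis by simp
  qed (simp add: measure_cell_pos)
  show ?thesis
  proof (intro set_eqI iffI)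
    fix E assume "E \<in> cells"
    then obtain i j where "i < N" "j < N" "E = cell i j" "measure lebesgue E > 0"
      unfolding cells_def background_cells_def background_index cell_def by blast
    then show "E \<in> {cell i j | i j. cell_index i j}" using * by blast
  next
    fix E assume "E \<in> {cell i j | i j. cell_index i j}"
    then obtain i j where E: "E = cell i j" "cell_index i j" by blast
    then have "i < N" "j < N" unfolding cell_index_def by auto
    then show "E \<in> cells" using * E
      unfolding cells_def background_cells_def background_index cell_def by blast
  qed
qed

lemma finite_cells: "finite cells"
proof -
  have "cells \<subseteq> (\<lambda>ij. cell (fst ij) (snd ij)) ` ({..<N} \<times> {..<N})"
  proof
    fix E assume "E \<in> cells"
    then obtain i j where "E = cell i j" "i < N" "j < N" unfolding cells_eq cell_index_def by blast
    then show "E \<in> (\<lambda>ij. cell (fst ij) (snd ij)) ` ({..<N} \<times> {..<N})"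
      by (intro image_eqI[of _ _ "(i, j)"]) simp_all
  qed
  then show ?thesis by (rule finite_subset) simp
qed

lemma grid_interval_unique:
  assumes "real i * h < x" "x < real (Suc i) * h" "real k * h \<le> x" "x \<le> real (Suc k) * h"
  shows "i = k"
proof -
  have "real i * h < real (Suc k) * h" "real k * h < real (Suc i) * h"
    using less_le_trans[OF assms(1,4)] le_less_trans[OF assms(3,2)] by (simp_all only:)
  then have "i < Suc k" "k < Suc i" using h_pos by (simp_all del: of_nat_Suc)
  then show ?thesis by simp
qed

text \<open>The background boxes are closed and overlap along grid lines, so the indices of a cell
  are recovered from points of the inner part.\<close>

lemma inner_mem_cell:
  assumes "cell_index i j" "p \<in> cinner i j" "p \<in> cell k l"
  shows "i = k \<and> j = l"
proof -
  obtain x y where p: "p = (x, y)" by (cases p)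
  then have "real i * h < x" "x < real (Suc i) * h" "real j * h < y" "y < real (Suc j) * h"
    using assms(2) cut_box.inner_part_def[OF cut_box_cell[OF assms(1)]] by (simp_all del: of_nat_Suc)
  moreover have "real k * h \<le> x" "x \<le> real (Suc k) * h" "real l * h \<le> y" "y \<le> real (Suc l) * h"
    using assms(3) unfolding p cell_def cbox_Pair_eq by (simp_all del: of_nat_Suc)
  ultimately show ?thesis using grid_interval_unique by blast
qed

lemma cell_inj:
  assumes "cell_index i j" "cell i j = cell k l"
  shows "i = k" "j = l"
proof -
  obtain p where p: "p \<in> cinner i j"
    using cut_box.inner_part_nonempty[OF cut_box_cell[OF assms(1)]] by blast
  then have "p \<in> cell k l" using cell_between(1)[OF assms(1)] assms(2) by blast
  then show "i = k" "j = l" using inner_mem_cell[OF assms(1) p] by blast+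
qed

lemma mem_cell_faces_iff:
  assumes "cell_index i j"
  shows "e \<in> cell_faces (cell i j) \<longleftrightarrow> e = vf i j \<or> e = hf i (Suc j) \<or> e = vf (Suc i) j \<and> v_nondeg (Suc i) j
     \<or> e = hf i j \<and> h_nondeg i j \<or> e = rf i j \<and> r_nondeg i j"
  unfolding cell_faces_def mem_Collect_eq closure_cell[OF assms]
    cut_box.edge_of_polygon_iff[OF cut_box_cell[OF assms]]
    vf_def hf_def rf_def v_nondeg_def h_nondeg_def r_nondeg_def ..

lemma cell_index_nondeg:
  assumes "cell_index i j"
  shows "v_nondeg i j" "h_nondeg i (Suc j)"
  using assms unfolding cell_index_def v_nondeg_def h_nondeg_def by simp_all

lemma v_nondeg_iff: "v_nondeg i j \<longleftrightarrow> max (real j * h) ((real i * h - x0) * m) < real (Suc j) * h"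
  unfolding v_nondeg_def using h_pos by simp

lemma h_nondeg_iff: "h_nondeg i j \<longleftrightarrow> real i * h < min (real (Suc i) * h) (x0 + real j * h / m)"
  unfolding h_nondeg_def using h_pos m_pos by (simp add: field_simps)

lemma vf_neq_hf: "v_nondeg i j \<Longrightarrow> vf i j \<noteq> hf k l"
  unfolding vf_def hf_def v_nondeg_iff by (rule vface_neq_hface)

lemma vf_neq_rf: "v_nondeg i j \<Longrightarrow> cell_index k l \<Longrightarrow> vf i j \<noteq> rf k l"
  unfolding vf_def rf_def v_nondeg_iff by (rule cut_box.vface_neq_ramp_edge[OF cut_box_cell])

lemma hf_neq_rf: "h_nondeg i j \<Longrightarrow> cell_index k l \<Longrightarrow> hf i j \<noteq> rf k l"
  unfolding hf_def rf_def h_nondeg_iff by (rule cut_box.hface_neq_ramp_edge[OF cut_box_cell])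

lemma vf_eq_iff: "v_nondeg i j \<Longrightarrow> vf i j = vf k l \<longleftrightarrow> i = k \<and> j = l"
  unfolding vf_def v_nondeg_iff using vface_eqD h_pos by (metis mult_right_cancel of_nat_eq_iff less_irrefl Suc_inject)

lemma hf_eq_iff: "h_nondeg i j \<Longrightarrow> hf i j = hf k l \<longleftrightarrow> i = k \<and> j = l"
  unfolding hf_def h_nondeg_iff using hface_eqD h_pos by (metis mult_right_cancel of_nat_eq_iff less_irrefl)

text \<open>\<open>cell_faces\<close> is a set, so splitting the sum rests on the candidates that
  are present being pairwise different.\<close>

lemma sum_cell_faces:
  fixes g :: "plane set \<Rightarrow> real"
  assumes "cell_index i j"
  shows "sum g (cell_faces (cell i j)) = g (vf i j) + g (hf i (Suc j))
     + (if v_nondeg (Suc i) j then g (vf (Suc i) j) else 0)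
     + (if h_nondeg i j then g (hf i j) else 0)
     + (if r_nondeg i j then g (rf i j) else 0)"
proof -
  note nd = cell_index_nondeg[OF assms]
  have "cell_faces (cell i j) = {vf i j, hf i (Suc j)} \<union> (if v_nondeg (Suc i) j then {vf (Suc i) j} else {})
    \<union> (if h_nondeg i j then {hf i j} else {}) \<union> (if r_nondeg i j then {rf i j} else {})"
    by (rule set_eqI) (auto simp only: mem_cell_faces_iff[OF assms] Un_iff insert_iff empty_iff split: if_splits)
  moreover have "vf i j \<noteq> hf i (Suc j)" "vf i j \<noteq> vf (Suc i) j" "vf i j \<noteq> hf i j" "vf i j \<noteq> rf i j"
      "hf i (Suc j) \<noteq> hf i j" "hf i (Suc j) \<noteq> rf i j"
    using vf_neq_hf[OF nd(1)] vf_neq_rf[OF nd(1) assms] vf_eq_iff[OF nd(1)] hf_eq_iff[OF nd(2)] hf_neq_rf[OF nd(2) assms]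
    by auto
  moreover have "vf (Suc i) j \<noteq> hf i (Suc j)" "vf (Suc i) j \<noteq> hf i j" "vf (Suc i) j \<noteq> rf i j" if "v_nondeg (Suc i) j"
    using vf_neq_hf[OF that] vf_neq_rf[OF that assms] by auto
  moreover have "hf i j \<noteq> rf i j" if "h_nondeg i j" using hf_neq_rf[OF that assms] .
  ultimately show ?thesis by (cases "v_nondeg (Suc i) j"; cases "h_nondeg i j"; cases "r_nondeg i j") auto
qed

lemma finite_cell_faces: "E \<in> cells \<Longrightarrow> finite (cell_faces E)"
proof -
  assume "E \<in> cells"
  then obtain i j where E: "E = cell i j" "cell_index i j" unfolding cells_eq by blast
  have "cell_faces E \<subseteq> {vf i j, hf i (Suc j), vf (Suc i) j, hf i j, rf i j}"
    using mem_cell_faces_iff[OF E(2)] unfolding E(1) by blast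
  then show ?thesis by (rule finite_subset) simp
qed

lemma adjacent_vf:
  assumes "v_nondeg i j"
  shows "E \<in> adjacent_cells (vf i j) \<longleftrightarrow> (cell_index i j \<and> E = cell i j)
     \<or> (\<exists>k. i = Suc k \<and> cell_index k j \<and> E = cell k j)"
proof
  assume "E \<in> adjacent_cells (vf i j)"
  then obtain k l where kl: "E = cell k l" "cell_index k l" "vf i j \<in> cell_faces (cell k l)"
    unfolding adjacent_cells_def cells_eq by blast
  then have "vf i j = vf k l \<or> vf i j = vf (Suc k) l"
    using vf_neq_hf[OF assms] vf_neq_rf[OF assms kl(2)] unfolding mem_cell_faces_iff[OF kl(2)] by blast
  then show "(cell_index i j \<and> E = cell i j) \<or> (\<exists>k. i = Suc k \<and> cell_index k j \<and> E = cell k j)"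
    unfolding vf_eq_iff[OF assms] using kl(1,2) by auto
next
  have "cell k l \<in> adjacent_cells (vf i j)" if "cell_index k l" "vf i j = vf k l \<or> vf i j = vf (Suc k) l" for k l
    unfolding adjacent_cells_def cells_eq mem_Collect_eq 
  proof (intro conjI exI)
    show "vf i j \<in> cell_faces (cell k l)"
      using that(2) assms unfolding mem_cell_faces_iff[OF that(1)] vf_eq_iff[OF assms] by auto
  qed (rule refl that(1))+
  then show "E \<in> adjacent_cells (vf i j)"
    if "(cell_index i j \<and> E = cell i j) \<or> (\<exists>k. i = Suc k \<and> cell_index k j \<and> E = cell k j)"
    using that by blast
qed

lemma adjacent_hf:
  assumes "h_nondeg i j"
  shows "E \<in> adjacent_cells (hf i j) \<longleftrightarrow> (cell_index i j \<and> E = cell i j)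
     \<or> (\<exists>k. j = Suc k \<and> cell_index i k \<and> E = cell i k)"
proof
  assume "E \<in> adjacent_cells (hf i j)"
  then obtain k l where kl: "E = cell k l" "cell_index k l" "hf i j \<in> cell_faces (cell k l)"
    unfolding adjacent_cells_def cells_eq by blast
  have "hf i j \<noteq> vf k l" "hf i j = vf (Suc k) l \<Longrightarrow> \<not> v_nondeg (Suc k) l"
    using vf_neq_hf[of k l] vf_neq_hf[of "Suc k" l] cell_index_nondeg[OF kl(2)] by metis+
  then have "hf i j = hf k l \<or> hf i j = hf k (Suc l)"
    using kl hf_neq_rf[OF assms kl(2)] unfolding mem_cell_faces_iff[OF kl(2)] by blast
  then show "(cell_index i j \<and> E = cell i j) \<or> (\<exists>k. j = Suc k \<and> cell_index i k \<and> E = cell i k)"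
    unfolding hf_eq_iff[OF assms] using kl(1,2) by auto
next
  have "cell k l \<in> adjacent_cells (hf i j)" if "cell_index k l" "hf i j = hf k l \<or> hf i j = hf k (Suc l)" for k l
    unfolding adjacent_cells_def cells_eq mem_Collect_eq 
  proof (intro conjI exI)
    show "hf i j \<in> cell_faces (cell k l)"
      using that(2) assms unfolding mem_cell_faces_iff[OF that(1)] hf_eq_iff[OF assms] by auto
  qed (rule refl that(1))+
  then show "E \<in> adjacent_cells (hf i j)"
    if "(cell_index i j \<and> E = cell i j) \<or> (\<exists>k. j = Suc k \<and> cell_index i k \<and> E = cell i k)"
    using that by blast
qed

end

section \<open>Fluxes\<close>

text \<open>The default value that makes the fluxes \<open>v_flux\<close> and \<open>h_flux\<close>
  of missing faces vanish.\<close>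

lemma integral_reversed_interval:
  fixes f :: "real \<Rightarrow> real"
  assumes "b \<le> a"
  shows "integral {a..b} f = 0"
  using assms by (cases "b = a") simp_all

context cut_box
begin

lemma edge_segment_normal:
  assumes E: "inner_part \<subseteq> E" "E \<subseteq> polygon" and e: "e edge_of polygon"
  shows "\<exists>p q. p \<noteq> q \<and> e = closed_segment p q"
    and "norm (outer_normal E e) = 1"
    and "\<And>x y. x \<in> e \<Longrightarrow> y \<in> e \<Longrightarrow> outer_normal E e \<bullet> (y - x) = 0"
proof -
  note on = outer_normals[OF E]
  have s: "0 < sqrt (m\<^sup>2 + 1)" by (simp add: add_nonneg_pos)
  have v: "\<exists>p q. p \<noteq> q \<and> vface x0 m x c d = closed_segment p q" if "(x - x0) * m < d" for x
  proof -
    have lt: "max c ((x - x0) * m) < d" using that cd by simp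
    then have "(x, max c ((x - x0) * m)) \<noteq> (x, d)" by (metis less_irrefl Pair_inject)
    then show ?thesis unfolding vface_def closed_segment_vertical[OF less_imp_le[OF lt], symmetric] by blast
  qed
  have hh: "\<exists>p q. p \<noteq> q \<and> hface x0 m y a b = closed_segment p q" if "(a - x0) * m < y" for y
  proof -
    have lt: "a < min b (x0 + y / m)" using that ab ramp_less_iff by simp
    then have "(a, y) \<noteq> (min b (x0 + y / m), y)" by (metis less_irrefl Pair_inject)
    then show ?thesis unfolding hface_def closed_segment_horizontal[OF less_imp_le[OF lt], symmetric] by blast
  qed
  have vo: "x \<in> vface x0 m z c d \<Longrightarrow> y \<in> vface x0 m z c d \<Longrightarrow> (r, 0) \<bullet> (y - x) = 0" for x y z r
    by (auto simp: vface_def)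
  have ho: "x \<in> hface x0 m z a b \<Longrightarrow> y \<in> hface x0 m z a b \<Longrightarrow> (0, r) \<bullet> (y - x) = 0" for x y z r
    by (auto simp: hface_def)
  consider "e = left_edge" | "e = top_edge" | "e = right_edge" "(b - x0) * m < d"
    | "e = bottom_edge" "(a - x0) * m < c" | "e = ramp_edge" "c < (b - x0) * m"
    using e unfolding edge_of_polygon_iff by blast
  then have "(\<exists>p q. p \<noteq> q \<and> e = closed_segment p q) \<and> norm (outer_normal E e) = 1
    \<and> (\<forall>x\<in>e. \<forall>y\<in>e. outer_normal E e \<bullet> (y - x) = 0)"
  proof cases
    case 1
    show ?thesis unfolding 1 on(1) using v[OF corner] vo by (simp add: norm_Pair)
  next
    case 2
    show ?thesis unfolding 2 on(2) using hh[OF corner] ho by (simp add: norm_Pair)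
  next
    case 3
    show ?thesis unfolding 3(1) on(3)[OF 3(2)] using v[OF 3(2)] vo by (simp add: norm_Pair)
  next
    case 4
    show ?thesis unfolding 4(1) on(4)[OF 4(2)] using hh[OF 4(2)] ho by (simp add: norm_Pair)
  next
    case 5
    have lt: "fst ramp_start < fst ramp_end" using bottom_right_cut_iff 5 by simp
    then have "ramp_start \<noteq> ramp_end" by auto
    moreover have "((1 / sqrt (m\<^sup>2 + 1)) *\<^sub>R (m, -1)) \<bullet> (y - x) = 0"
      if "x \<in> ramp_edge" "y \<in> ramp_edge" for x y
    proof -
      have "((1 / sqrt (m\<^sup>2 + 1)) *\<^sub>R (m, -1)) \<bullet> (y - x)
          = ((snd x - (fst x - x0) * m) - (snd y - (fst y - x0) * m)) / sqrt (m\<^sup>2 + 1)"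
        by (simp add: inner_prod_def algebra_simps diff_divide_distrib add_divide_distrib)
      then show ?thesis using that unfolding ramp_edge_def by auto
    qed
    moreover have "norm ((1 / sqrt (m\<^sup>2 + 1)) *\<^sub>R (m, - 1 :: real)) = 1"
      using s by (simp add: norm_Pair del: scaleR_Pair)
    ultimately show ?thesis
      unfolding 5(1) on(5)[OF 5(2)] using ramp_edge_segment[OF less_imp_le[OF lt]] by blast
  qed
  then show "\<exists>p q. p \<noteq> q \<and> e = closed_segment p q" "norm (outer_normal E e) = 1"
    "\<And>x y. x \<in> e \<Longrightarrow> y \<in> e \<Longrightarrow> outer_normal E e \<bullet> (y - x) = 0"
    by blast+
qed

end

context dod_setting
begin

definition flux :: "plane set \<Rightarrow> plane set \<Rightarrow> real" where
  "flux E e = seg_integral e (\<lambda>x. \<beta> x \<bullet> outer_normal E e)"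

text \<open>The orientation belongs to the grid, in the direction of increasing \<open>x\<close>, so
  the same number enters the two neighbouring cells with opposite signs.\<close>

definition v_flux :: "nat \<Rightarrow> nat \<Rightarrow> real" where
  "v_flux i j = integral {max (real j * h) ((real i * h - x0) * m)..real (Suc j) * h} (\<lambda>y. fst (\<beta> (real i * h, y)))"

definition h_flux :: "nat \<Rightarrow> nat \<Rightarrow> real" where
  "h_flux i j = integral {real i * h..min (real (Suc i) * h) (x0 + real j * h / m)} (\<lambda>x. snd (\<beta> (x, real j * h)))"

lemma continuous_beta: "continuous_on (closure Omega) \<beta>"
  using beta_lipschitz lipschitz_on_continuous_on by blast

lemma cpoly_subset: "cell_index i j \<Longrightarrow> cpoly i j \<subseteq> closure Omega"
  using closure_mono[of "cell i j" Omega] closure_cell unfolding cell_def by blast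

lemma face_edge:
  assumes "cell_index i j" "e \<in> cell_faces (cell i j)"
  shows "e edge_of cpoly i j"
  using assms(2) unfolding cell_faces_def closure_cell[OF assms(1)] by blast

lemma face_subset: "E \<in> cells \<Longrightarrow> e \<in> cell_faces E \<Longrightarrow> e \<subseteq> closure E"
  unfolding cell_faces_def edge_of_def using face_of_imp_subset by blast

lemma face_subset_Omega: "E \<in> cells \<Longrightarrow> e \<in> cell_faces E \<Longrightarrow> e \<subseteq> closure Omega"
  using face_subset closure_mono[of E Omega] unfolding cells_def by blast

lemma face_segment_normal:
  assumes "E \<in> cells" "e \<in> cell_faces E"
  shows "\<exists>p q. p \<noteq> q \<and> e = closed_segment p q"
    and "norm (outer_normal E e) = 1"
    and "\<And>x y. x \<in> e \<Longrightarrow> y \<in> e \<Longrightarrow> outer_normal E e \<bullet> (y - x) = 0"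
proof -
  obtain i j where E: "E = cell i j" "cell_index i j" using assms(1) unfolding cells_eq by blast
  note * = cut_box.edge_segment_normal[OF cut_box_cell[OF E(2)] cell_between[OF E(2)]
      face_edge[OF E(2) assms(2)[unfolded E(1)]], folded E(1)]
  show "\<exists>p q. p \<noteq> q \<and> e = closed_segment p q" by (rule *(1))
  show "norm (outer_normal E e) = 1" by (rule *(2))
  show "\<And>x y. x \<in> e \<Longrightarrow> y \<in> e \<Longrightarrow> outer_normal E e \<bullet> (y - x) = 0" by (rule *(3))
qed

lemma continuous_normal_component:
  assumes "E \<in> cells" "e \<in> cell_faces E"
  shows "continuous_on e (\<lambda>x. \<beta> x \<bullet> n)"
  by (intro continuous_intros continuous_on_subset[OF continuous_beta face_subset_Omega[OF assms]])

lemma normal_speed_eq: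
  assumes "E \<in> cells" "e \<in> cell_faces E"
  shows "normal_speed e x = \<bar>\<beta> x \<bullet> outer_normal E e\<bar>"
proof -
  note f = face_segment_normal[OF assms]
  obtain p q where "p \<noteq> q" "e = closed_segment p q" using f(1) by blast
  then show ?thesis
    unfolding normal_speed_def using f(2,3) by (intro abs_inner_seg_normal[of _ p _ q]) auto
qed

text \<open>By \<open>beta_sign\<close> the integrand has constant sign along the face, so the
  absolute value can be taken outside the integral, and by continuity the flux is zero only if the
  integrand vanishes on the whole face.\<close>

lemma
  assumes "E \<in> cells" "e \<in> cell_faces E"
  shows outflow_iff: "outflow E e \<longleftrightarrow> 0 < flux E e"
    and inflow_iff: "inflow E e \<longleftrightarrow> flux E e < 0"
    and speed_integral: "seg_integral e (normal_speed e) = \<bar>flux E e\<bar>"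
proof -
  let ?f = "\<lambda>x. \<beta> x \<bullet> outer_normal E e"
  obtain p q where pq: "p \<noteq> q" "e = closed_segment p q" using face_segment_normal(1)[OF assms] by blast
  then have ex: "\<exists>p q. e = closed_segment p q" by blast
  note c = continuous_normal_component[OF assms, of "outer_normal E e"]
  have cn: "continuous_on e (\<lambda>x. - ?f x)" by (intro continuous_intros c)
  have neg: "seg_integral e (\<lambda>x. - ?f x) = - flux E e"
    using seg_integral_mult_left[of e "-1" ?f] unfolding flux_def by simp
  have sp: "seg_integral e (normal_speed e) = seg_integral e (\<lambda>x. \<bar>?f x\<bar>)"
    by (rule seg_integral_cong[OF normal_speed_eq[OF assms] ex])
  consider "\<forall>x\<in>e. 0 \<le> ?f x" | "\<forall>x\<in>e. ?f x \<le> 0" using beta_sign[OF assms] by blast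
  then have "(outflow E e \<longleftrightarrow> 0 < flux E e) \<and> (inflow E e \<longleftrightarrow> flux E e < 0)
    \<and> seg_integral e (normal_speed e) = \<bar>flux E e\<bar>"
  proof cases
    case 1
    have nn: "0 \<le> flux E e" unfolding flux_def pq(2)
      by (rule seg_integral_nonneg) (use 1 c pq in auto)
    have "seg_integral e (\<lambda>x. \<bar>?f x\<bar>) = flux E e"
      unfolding flux_def by (rule seg_integral_cong[OF _ ex]) (use 1 in auto)
    moreover have "0 < flux E e" if o: "outflow E e"
    proof -
      obtain z where "z \<in> e" "0 < ?f z" using o unfolding outflow_def by blast
      then show ?thesis unfolding flux_def pq(2)
        by (intro seg_integral_pos[of p q _ z]) (use 1 c pq in auto)
    qed
    moreover have "flux E e = 0" if "\<not> outflow E e"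
    proof -
      have "?f x = 0" if "x \<in> e" for x using that 1 \<open>\<not> outflow E e\<close> unfolding outflow_def by force
      then have "flux E e = seg_integral e (\<lambda>x. 0)"
        unfolding flux_def by (intro seg_integral_cong ex)
      then show ?thesis using seg_integral_mult_left[of e 0 "\<lambda>x. 0"] by simp
    qed
    moreover have "\<not> inflow E e" using 1 unfolding inflow_def by force
    ultimately show ?thesis using nn sp by (cases "outflow E e") auto
  next
    case 2
    have nn: "0 \<le> - flux E e" unfolding neg[symmetric] unfolding pq(2)
      by (rule seg_integral_nonneg) (use 2 cn pq in auto)
    have "seg_integral e (\<lambda>x. \<bar>?f x\<bar>) = - flux E e"
      unfolding neg[symmetric] by (rule seg_integral_cong[OF _ ex]) (use 2 in auto)
    moreover have "0 < - flux E e" if o: "inflow E e"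
    proof -
      obtain z where "z \<in> e" "?f z < 0" using o unfolding inflow_def by blast
      then show ?thesis unfolding neg[symmetric] unfolding pq(2)
        by (intro seg_integral_pos[of p q _ z]) (use 2 cn pq in auto)
    qed
    moreover have "flux E e = 0" if "\<not> inflow E e"
    proof -
      have "?f x = 0" if "x \<in> e" for x using that 2 \<open>\<not> inflow E e\<close> unfolding inflow_def by force
      then have "flux E e = seg_integral e (\<lambda>x. 0)"
        unfolding flux_def by (intro seg_integral_cong ex)
      then show ?thesis using seg_integral_mult_left[of e 0 "\<lambda>x. 0"] by simp
    qed
    moreover have "\<not> outflow E e" using 2 unfolding outflow_def by force
    ultimately show ?thesis using nn sp by (cases "inflow E e") auto
  qed
  then show "outflow E e \<longleftrightarrow> 0 < flux E e" "inflow E e \<longleftrightarrow> flux E e < 0"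
    "seg_integral e (normal_speed e) = \<bar>flux E e\<bar>" by blast+
qed

lemma seg_integral_vf:
  assumes "v_nondeg i j"
  shows "seg_integral (vf i j) (\<lambda>x. \<beta> x \<bullet> (r, 0)) = r * v_flux i j"
  unfolding vf_def vface_def seg_integral_vertical[OF assms[unfolded v_nondeg_iff]] v_flux_def
  by (simp add: inner_prod_def mult.commute)

lemma seg_integral_hf:
  assumes "h_nondeg i j"
  shows "seg_integral (hf i j) (\<lambda>x. \<beta> x \<bullet> (0, r)) = r * h_flux i j"
  unfolding hf_def hface_def seg_integral_horizontal[OF assms[unfolded h_nondeg_iff]] h_flux_def
  by (simp add: inner_prod_def mult.commute)

lemma ramp_edge_subset_ramp:
  assumes "cell_index i j"
  shows "rf i j \<subseteq> ramp"
proof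
  interpret cut_box "real i * h" "real (Suc i) * h" "real j * h" "real (Suc j) * h" x0 m
    by (rule cut_box_cell[OF assms])
  fix p assume "p \<in> rf i j"
  then have p: "p \<in> polygon" "snd p = (fst p - x0) * m" unfolding rf_def ramp_edge_def by auto
  then have "p \<in> closure Omega" using cpoly_subset[OF assms] by blast
  moreover have "p \<notin> Omega" using p(2) unfolding Omega_eq by auto
  ultimately have "p \<in> frontier Omega" using open_Omega by (simp add: frontier_def interior_open)
  then show "p \<in> ramp" using p(2) unfolding ramp_def m_def[symmetric] by auto
qed

lemma beta_tangential:
  assumes "p \<in> ramp"
  shows "snd (\<beta> p) = m * fst (\<beta> p)"
proof -
  have "fst (\<beta> p) * sin \<gamma> = snd (\<beta> p) * cos \<gamma>"
    using beta_ramp[OF assms] by (simp add: inner_prod_def)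
  then show ?thesis using cos_pos unfolding m_def tan_def by (simp add: field_simps)
qed

lemma flux_faces:
  assumes "cell_index i j"
  shows "flux (cell i j) (vf i j) = - v_flux i j"
    and "flux (cell i j) (hf i (Suc j)) = h_flux i (Suc j)"
    and "v_nondeg (Suc i) j \<Longrightarrow> flux (cell i j) (vf (Suc i) j) = v_flux (Suc i) j"
    and "h_nondeg i j \<Longrightarrow> flux (cell i j) (hf i j) = - h_flux i j"
    and "r_nondeg i j \<Longrightarrow> flux (cell i j) (rf i j) = 0"
proof -
  interpret cut_box "real i * h" "real (Suc i) * h" "real j * h" "real (Suc j) * h" x0 m
    by (rule cut_box_cell[OF assms])
  note on = outer_normals[OF cell_between[OF assms], folded vf_def hf_def rf_def]
  note nd = cell_index_nondeg[OF assms]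
  show "flux (cell i j) (vf i j) = - v_flux i j"
    unfolding flux_def on(1) using seg_integral_vf[OF nd(1), of "-1"] by simp
  show "flux (cell i j) (hf i (Suc j)) = h_flux i (Suc j)"
    unfolding flux_def on(2) using seg_integral_hf[OF nd(2), of 1] by simp
  show "flux (cell i j) (vf (Suc i) j) = v_flux (Suc i) j" if "v_nondeg (Suc i) j"
    unfolding flux_def on(3)[folded v_nondeg_def, OF that] using seg_integral_vf[OF that, of 1] by simp
  show "flux (cell i j) (hf i j) = - h_flux i j" if "h_nondeg i j"
    unfolding flux_def on(4)[folded h_nondeg_def, OF that] using seg_integral_hf[OF that, of "-1"] by simp
  show "flux (cell i j) (rf i j) = 0" if "r_nondeg i j"
  proof -
    have mem: "rf i j \<in> cell_faces (cell i j)" using mem_cell_faces_iff[OF assms] that by blast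
    have "cell i j \<in> cells" unfolding cells_eq using assms by blast
    note seg = face_segment_normal(1)[OF this mem]
    have "\<beta> x \<bullet> outer_normal (cell i j) (rf i j) = 0" if "x \<in> rf i j" for x
      using beta_tangential[of x] ramp_edge_subset_ramp[OF assms] that
      unfolding on(5)[folded r_nondeg_def, OF \<open>r_nondeg i j\<close>] by (auto simp: inner_prod_def)
    then have "flux (cell i j) (rf i j) = seg_integral (rf i j) (\<lambda>x. 0)"
      unfolding flux_def by (intro seg_integral_cong) (use seg in blast)+
    then show ?thesis using seg_integral_mult_left[of "rf i j" 0 "\<lambda>x. 0"] by simp
  qed
qed

lemma degenerate_flux:
  "\<not> v_nondeg i j \<Longrightarrow> v_flux i j = 0" "\<not> h_nondeg i j \<Longrightarrow> h_flux i j = 0"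
  by (simp_all only: v_nondeg_iff v_flux_def h_nondeg_iff h_flux_def not_less integral_reversed_interval)

lemma sum_flux_indexed:
  assumes "cell_index i j"
  shows "v_flux (Suc i) j - v_flux i j + h_flux i (Suc j) - h_flux i j = 0"
proof -
  interpret cut_box "real i * h" "real (Suc i) * h" "real j * h" "real (Suc j) * h" x0 m
    by (rule cut_box_cell[OF assms])
  obtain K where K: "K-lipschitz_on (closure Omega) \<beta>" using beta_lipschitz by blast
  have sub: "polygon \<subseteq> closure Omega" by (rule cpoly_subset[OF assms])
  then have ne: "closure Omega \<noteq> {}" using inner_part_nonempty inner_part_subset by (metis subset_empty)
  have cv: "convex (closure Omega)" by (rule convex_closure[OF convex_Omega])
  txt \<open>The projection to the convex set \<open>closure Omega\<close> gives a Lipschitz extension of \<open>\<beta>\<close> to the plane.\<close>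
  define F where "F = (\<lambda>x. \<beta> (closest_point (closure Omega) x))"
  have F_eq: "F x = \<beta> x" if "x \<in> closure Omega" for x
    unfolding F_def using that by (simp add: closest_point_self)
  have "1-lipschitz_on UNIV (closest_point (closure Omega))"
    by (rule lipschitz_onI) (simp_all add: closest_point_lipschitz[OF cv closed_closure ne])
  then have F: "K-lipschitz_on UNIV F"
    unfolding F_def using lipschitz_on_compose2[of 1 UNIV "closest_point (closure Omega)" K \<beta>]
      lipschitz_on_subset[OF K] closest_point_in_set[OF closed_closure ne]
    by (simp add: image_subset_iff)
  \<comment> \<open>Differentiability is local, and \<open>F\<close> agrees with \<beta> on the open
    set \<open>Omega\<close>.\<close>
  have deriv: "(F has_derivative D) (at p)" if "(\<beta> has_derivative D) (at p)" "p \<in> Omega" for D p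
    by (rule has_derivative_transform_within_open[OF that(1) open_Omega that(2)])
      (use F_eq closure_subset in \<open>metis subsetD\<close>)
  have "AE p in lebesgue. p \<in> Omega \<longrightarrow> (\<exists>D. (\<beta> has_derivative D) (at p) \<and> (\<Sum>b\<in>Basis. D b \<bullet> b) = 0)"
    using beta_div_free open_Omega by (simp add: AE_restrict_space_iff borel_open)
  \<comment> \<open>The polygon lies only in the closure of \<open>Omega\<close>; its points outside
    \<open>Omega\<close> form a null set because the frontier of a convex set is negligible.\<close>
  moreover have "AE p in lebesgue. p \<notin> frontier Omega"
    using negligible_convex_frontier[OF convex_Omega]
    by (simp add: negligible_iff_null_sets AE_not_in)
  ultimately have "AE p in lebesgue. p \<in> polygon \<longrightarrow> (\<exists>D. (F has_derivative D) (at p) \<and> (\<Sum>b\<in>Basis. D b \<bullet> b) = 0)"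
  proof eventually_elim
    case (elim p)
    show ?case
    proof
      assume "p \<in> polygon"
      then have "p \<in> Omega" using sub elim(2) open_Omega by (auto simp: frontier_def interior_open)
      then show "\<exists>D. (F has_derivative D) (at p) \<and> (\<Sum>b\<in>Basis. D b \<bullet> b) = 0"
        using elim(1) deriv by blast
    qed
  qed
  then have div: "AE p in lebesgue_on polygon. \<exists>D. (F has_derivative D) (at p) \<and> (\<Sum>b\<in>Basis. D b \<bullet> b) = 0"
    using lmeasurable_compact[OF compact_polygon] by (simp add: AE_restrict_space_iff fmeasurableD)
  have "snd (F p) = m * fst (F p)" if "p \<in> ramp_edge" for p
  proof -
    have "p \<in> closure Omega" using that sub unfolding ramp_edge_def by auto
    moreover have "p \<in> ramp" using that ramp_edge_subset_ramp[OF assms] unfolding rf_def by blast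
    ultimately show ?thesis using F_eq beta_tangential by simp
  qed
  note fi = flux_identity[OF F div this]
  have e: "left_edge \<subseteq> closure Omega" "right_edge \<subseteq> closure Omega" "bottom_edge \<subseteq> closure Omega" "top_edge \<subseteq> closure Omega"
    using edges_face_of[THEN face_of_imp_subset] sub by blast+
  have v: "integral {max (real j * h) ((x - x0) * m)..real (Suc j) * h} (\<lambda>y. fst (F (x, y)))
      = integral {max (real j * h) ((x - x0) * m)..real (Suc j) * h} (\<lambda>y. fst (\<beta> (x, y)))"
    if "vface x0 m x (real j * h) (real (Suc j) * h) \<subseteq> closure Omega" for x
  proof (rule integral_cong)
    fix y assume "y \<in> {max (real j * h) ((x - x0) * m)..real (Suc j) * h}"
    then have "(x, y) \<in> closure Omega" by (intro subsetD[OF that]) (simp add: vface_def del: of_nat_Suc)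
    then show "fst (F (x, y)) = fst (\<beta> (x, y))" by (simp only: F_eq)
  qed
  have hh: "integral {real i * h..min (real (Suc i) * h) (x0 + y / m)} (\<lambda>x. snd (F (x, y)))
      = integral {real i * h..min (real (Suc i) * h) (x0 + y / m)} (\<lambda>x. snd (\<beta> (x, y)))"
    if "hface x0 m y (real i * h) (real (Suc i) * h) \<subseteq> closure Omega" for y
  proof (rule integral_cong)
    fix x assume "x \<in> {real i * h..min (real (Suc i) * h) (x0 + y / m)}"
    then have "(x, y) \<in> closure Omega" by (intro subsetD[OF that]) (simp add: hface_def del: of_nat_Suc)
    then show "snd (F (x, y)) = snd (\<beta> (x, y))" by (simp only: F_eq)
  qed
  show ?thesis
    using fi unfolding v[OF e(1)] v[OF e(2)] hh[OF e(3)] hh[OF e(4)] v_flux_def h_flux_def .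
qed

lemma sum_flux:
  assumes "E \<in> cells"
  shows "sum (flux E) (cell_faces E) = 0"
proof -
  obtain i j where E: "E = cell i j" "cell_index i j" using assms unfolding cells_eq by blast
  show ?thesis
    unfolding E(1) sum_cell_faces[OF E(2)]
    using sum_flux_indexed[OF E(2)] flux_faces[OF E(2)] degenerate_flux by auto
qed

section \<open>Neighbouring cells and boundary faces\<close>

lemma outer_normal_faces:
  assumes "cell_index i j"
  shows "outer_normal (cell i j) (vf i j) = (-1, 0)"
    and "outer_normal (cell i j) (hf i (Suc j)) = (0, 1)"
    and "v_nondeg (Suc i) j \<Longrightarrow> outer_normal (cell i j) (vf (Suc i) j) = (1, 0)"
    and "h_nondeg i j \<Longrightarrow> outer_normal (cell i j) (hf i j) = (0, -1)"
  unfolding vf_def hf_def v_nondeg_def h_nondeg_def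
  using cut_box.outer_normals[OF cut_box_cell[OF assms] cell_between[OF assms]] by blast+

definition neighbours :: "plane set \<Rightarrow> plane set \<Rightarrow> plane set \<Rightarrow> bool" where
  "neighbours E E' e \<longleftrightarrow> E \<noteq> E' \<and> adjacent_cells e = {E, E'} \<and> flux E' e = - flux E e
     \<and> outer_normal E' e = - outer_normal E e"

lemma neighbours_sym: "neighbours E E' e \<Longrightarrow> neighbours E' E e"
  unfolding neighbours_def by auto

lemma neighbours_vf:
  assumes "cell_index i j" "cell_index (Suc i) j"
  shows "neighbours (cell i j) (cell (Suc i) j) (vf (Suc i) j)"
proof -
  note nd = cell_index_nondeg(1)[OF assms(2)]
  have "cell i j \<noteq> cell (Suc i) j" using cell_inj[OF assms(1)] by force
  moreover have "adjacent_cells (vf (Suc i) j) = {cell i j, cell (Suc i) j}"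
    using adjacent_vf[OF nd] assms by auto
  ultimately show ?thesis
    unfolding neighbours_def flux_faces(3)[OF assms(1) nd] flux_faces(1)[OF assms(2)]
      outer_normal_faces(3)[OF assms(1) nd] outer_normal_faces(1)[OF assms(2)]
    by simp
qed

lemma neighbours_hf:
  assumes "cell_index i j" "cell_index i (Suc j)"
  shows "neighbours (cell i j) (cell i (Suc j)) (hf i (Suc j))"
proof -
  note nd = cell_index_nondeg(2)[OF assms(1)]
  have "cell i j \<noteq> cell i (Suc j)" using cell_inj[OF assms(1)] by force
  moreover have "adjacent_cells (hf i (Suc j)) = {cell i j, cell i (Suc j)}"
    using adjacent_hf[OF nd] assms by auto
  ultimately show ?thesis
    unfolding neighbours_def flux_faces(2)[OF assms(1)] flux_faces(4)[OF assms(2) nd]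
      outer_normal_faces(2)[OF assms(1)] outer_normal_faces(4)[OF assms(2) nd]
    by simp
qed

lemma boundary_faceI:
  assumes "E \<in> cells" "e \<in> cell_faces E" "\<And>p. p \<in> e \<Longrightarrow> p \<notin> Omega"
  shows "e \<in> boundary_faces"
proof -
  have "e \<subseteq> frontier Omega"
    using assms(3) face_subset_Omega[OF assms(1,2)] open_Omega by (auto simp: frontier_def interior_open)
  then show ?thesis unfolding boundary_faces_def using assms by blast
qed

lemma cell_in_cells: "cell_index i j \<Longrightarrow> cell i j \<in> cells"
  unfolding cells_eq by blast

text \<open>Nonzero flux excludes ramp edges. On other faces the indices decide between the boundary
  of the square and a neighbour. The neighbour is again a cell: going left or up keeps its upper
  left corner above the ramp, and going right or down this is the nondegeneracy of the shared
  face.\<close>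

lemma face_cases:
  assumes "E \<in> cells" "e \<in> cell_faces E" "flux E e \<noteq> 0"
  shows "(e \<in> boundary_faces \<and> adjacent_cells e = {E}) \<or> (\<exists>E'. neighbours E E' e)"
proof -
  obtain i j where E: "E = cell i j" "cell_index i j" using assms(1) unfolding cells_eq by blast
  have ij: "i < N" "j < N" "(real i * h - x0) * m < real (Suc j) * h" using E(2) unfolding cell_index_def by auto
  note nd = cell_index_nondeg[OF E(2)]
  consider "e = vf i j" | "e = hf i (Suc j)" | "e = vf (Suc i) j" "v_nondeg (Suc i) j"
    | "e = hf i j" "h_nondeg i j" | "e = rf i j" "r_nondeg i j"
    using assms(2) unfolding E(1) mem_cell_faces_iff[OF E(2)] by blast
  then show ?thesis
  proof cases
    case 1
    show ?thesis
    proof (cases i)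
      case 0
      have "adjacent_cells e = {E}"
        using adjacent_vf[OF nd(1)] E 0 unfolding 1 by auto
      moreover have "e \<in> boundary_faces"
        by (rule boundary_faceI[OF assms(1,2)]) (auto simp: 1 0 vf_def vface_def Omega_eq)
      ultimately show ?thesis by blast
    next
      case (Suc k)
      have "(real k * h - x0) * m \<le> (real i * h - x0) * m"
        unfolding Suc using h_pos m_pos by (intro mult_right_mono) (auto simp: algebra_simps)
      then have "cell_index k j" using ij Suc unfolding cell_index_def by auto
      then show ?thesis using neighbours_vf[of k j] E neighbours_sym unfolding 1 Suc by blast
    qed
  next
    case 2
    show ?thesis
    proof (cases "Suc j < N")
      case True
      have "real (Suc j) * h \<le> real (Suc (Suc j)) * h" using h_pos by (intro mult_right_mono) auto
      then have "cell_index i (Suc j)" using ij True unfolding cell_index_def by linarith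
      then show ?thesis using neighbours_hf[OF E(2)] E unfolding 2 by blast
    next
      case False
      then have N: "Suc j = N" using ij by simp
      have "adjacent_cells e = {E}"
        using adjacent_hf[OF nd(2)] E False unfolding 2 cell_index_def by auto
      moreover have "e \<in> boundary_faces"
      proof (rule boundary_faceI[OF assms(1,2)])
        fix p assume "p \<in> e"
        then have "snd p = L" unfolding 2 N hf_def hface_def L_eq[symmetric] by auto
        then show "p \<notin> Omega" unfolding Omega_eq by auto
      qed
      ultimately show ?thesis by blast
    qed
  next
    case 3
    show ?thesis
    proof (cases "Suc i < N")
      case True
      then have "cell_index (Suc i) j" using 3 ij unfolding cell_index_def v_nondeg_def by blast
      then show ?thesis using neighbours_vf[OF E(2)] E unfolding 3(1) by blast
    next
      case False
      then have N: "Suc i = N" using ij by simp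
      have "adjacent_cells e = {E}"
        using adjacent_vf[OF 3(2)] E False unfolding 3(1) cell_index_def by auto
      moreover have "e \<in> boundary_faces"
      proof (rule boundary_faceI[OF assms(1,2)])
        fix p assume "p \<in> e"
        then have "fst p = L" unfolding 3(1) N vf_def vface_def L_eq[symmetric] by auto
        then show "p \<notin> Omega" unfolding Omega_eq by auto
      qed
      ultimately show ?thesis by blast
    qed
  next
    case 4
    show ?thesis
    proof (cases j)
      case 0
      have "adjacent_cells e = {E}"
        using adjacent_hf[OF 4(2)] E 0 unfolding 4(1) by auto
      moreover have "e \<in> boundary_faces"
        by (rule boundary_faceI[OF assms(1,2)]) (auto simp: 4(1) 0 hf_def hface_def Omega_eq)
      ultimately show ?thesis by blast
    next
      case (Suc k)
      have "cell_index i k" using ij Suc 4(2) unfolding cell_index_def h_nondeg_def by auto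
      then show ?thesis using neighbours_hf[of i k] E neighbours_sym unfolding 4(1) Suc by blast
    qed
  next
    case 5
    then show ?thesis using flux_faces(5)[OF E(2)] assms(3) E by simp
  qed
qed

text \<open>The lower end of the left face lies on the ramp, where \<beta> is nonzero and has slope
  \<open>m\<close>, so its horizontal component is nonzero there. Constant sign and continuity carry
  this over to the integral.\<close>

lemma triangle_flux_nonzero:
  assumes "cell_index i j" "\<not> h_nondeg i j"
  shows "v_flux i j \<noteq> 0"
proof -
  interpret cut_box "real i * h" "real (Suc i) * h" "real j * h" "real (Suc j) * h" x0 m
    by (rule cut_box_cell[OF assms(1)])
  let ?p = "(real i * h, (real i * h - x0) * m)"
  have le: "real j * h \<le> (real i * h - x0) * m" using assms(2) unfolding h_nondeg_def by simp
  have "?p \<in> rf i j"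
    unfolding rf_def ramp_edge_def polygon_def using le corner ab by auto
  then have ramp: "?p \<in> ramp" using ramp_edge_subset_ramp[OF assms(1)] by blast
  then have "fst (\<beta> ?p) \<noteq> 0"
    using beta_tangential[OF ramp] beta_ramp_nonzero[OF ramp] by (auto simp: prod_eq_iff)
  then have "\<beta> ?p \<bullet> outer_normal (cell i j) (vf i j) \<noteq> 0"
    unfolding outer_normal_faces(1)[OF assms(1)] by (simp add: inner_prod_def)
  moreover have "?p \<in> vf i j" unfolding vf_def vface_def using le corner by auto
  ultimately have "inflow (cell i j) (vf i j) \<or> outflow (cell i j) (vf i j)"
    unfolding inflow_def outflow_def by (meson linorder_neqE_linordered_idom)
  moreover have "vf i j \<in> cell_faces (cell i j)" using mem_cell_faces_iff[OF assms(1)] by blast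
  ultimately have "flux (cell i j) (vf i j) \<noteq> 0"
    using inflow_iff outflow_iff cell_in_cells[OF assms(1)] by fastforce
  then show ?thesis unfolding flux_faces(1)[OF assms(1)] by simp
qed

text \<open>The right and bottom faces are missing and the ramp is impermeable, so whatever enters
  through one leg leaves through the other. As this flux is nonzero, the descriptions in
  \<open>e_in\<close> and \<open>e_out\<close> are unique.\<close>

lemma triangle_faces:
  assumes ij: "cell_index i j" and nd: "\<not> v_nondeg (Suc i) j" "\<not> h_nondeg i j"
  shows "h_flux i (Suc j) = v_flux i j"
    and "e_in (cell i j) = (if 0 < v_flux i j then vf i j else hf i (Suc j))"
    and "e_out (cell i j) = (if 0 < v_flux i j then hf i (Suc j) else vf i j)"
proof -
  show eq: "h_flux i (Suc j) = v_flux i j"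
    using sum_flux_indexed[OF ij] degenerate_flux nd by simp
  note nz = triangle_flux_nonzero[OF ij nd(2)]
  have mem: "e \<in> cell_faces (cell i j) \<longleftrightarrow> e = vf i j \<or> e = hf i (Suc j) \<or> e = rf i j \<and> r_nondeg i j" for e
    using mem_cell_faces_iff[OF ij] nd by blast
  note io = inflow_iff[OF cell_in_cells[OF ij]] outflow_iff[OF cell_in_cells[OF ij]]
  note ff = flux_faces(1,2,5)[OF ij]
  show "e_in (cell i j) = (if 0 < v_flux i j then vf i j else hf i (Suc j))"
    unfolding e_in_def
  proof (rule the_equality)
    let ?X = "if 0 < v_flux i j then vf i j else hf i (Suc j)"
    have X: "?X \<in> cell_faces (cell i j)" unfolding mem by simp
    have "inflow (cell i j) ?X" unfolding io(1)[OF X] using ff nz eq by simp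
    with X show "?X \<in> cell_faces (cell i j) \<and> inflow (cell i j) ?X" by (rule conjI)
    fix e assume e: "e \<in> cell_faces (cell i j) \<and> inflow (cell i j) e"
    then have fe: "flux (cell i j) e < 0" using io(1) by blast
    consider "e = vf i j" | "e = hf i (Suc j)" | "e = rf i j" "r_nondeg i j"
      using e unfolding mem by blast
    then show "e = ?X"
    proof cases
      case 1
      then show ?thesis using fe unfolding 1 ff(1) by simp
    next
      case 2
      then show ?thesis using fe unfolding 2 ff(2) eq by simp
    next
      case 3
      then show ?thesis using fe ff(3) by simp
    qed
  qed
  show "e_out (cell i j) = (if 0 < v_flux i j then hf i (Suc j) else vf i j)"
    unfolding e_out_def
  proof (rule the_equality)
    let ?X = "if 0 < v_flux i j then hf i (Suc j) else vf i j"
    have X: "?X \<in> cell_faces (cell i j)" unfolding mem by simp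
    have "outflow (cell i j) ?X" unfolding io(2)[OF X] using ff nz eq by simp
    with X show "?X \<in> cell_faces (cell i j) \<and> outflow (cell i j) ?X" by (rule conjI)
    fix e assume e: "e \<in> cell_faces (cell i j) \<and> outflow (cell i j) e"
    then have fe: "0 < flux (cell i j) e" using io(2) by blast
    consider "e = vf i j" | "e = hf i (Suc j)" | "e = rf i j" "r_nondeg i j"
      using e unfolding mem by blast
    then show "e = ?X"
    proof cases
      case 1
      then show ?thesis using fe unfolding 1 ff(1) by simp
    next
      case 2
      then show ?thesis using fe unfolding 2 ff(2) eq by simp
    next
      case 3
      then show ?thesis using fe ff(3) by simp
    qed
  qed
qed

lemma stab_cellE:
  assumes "E \<in> stab_cells"
  obtains i j where "E = cell i j" "cell_index i j" "\<not> v_nondeg (Suc i) j" "\<not> h_nondeg i j"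
proof -
  have "E \<in> cells" "2 simplex closure E" using assms unfolding stab_cells_def by auto
  then obtain i j where E: "E = cell i j" "cell_index i j" unfolding cells_eq by blast
  then have "2 simplex cpoly i j" using \<open>2 simplex closure E\<close> closure_cell by simp
  note s = cut_box.simplex_imp_degenerate[OF cut_box_cell[OF E(2)] this]
  have "\<not> v_nondeg (Suc i) j" "\<not> h_nondeg i j"
    using s unfolding v_nondeg_def h_nondeg_def not_less by blast+
  with E that show ?thesis by blast
qed

lemma stab_subset_cells: "stab_cells \<subseteq> cells"
  unfolding stab_cells_def by blast

lemma stab_faces:
  assumes "E \<in> stab_cells"
  shows "e_in E \<in> cell_faces E" "e_out E \<in> cell_faces E"
    and "flux E (e_in E) < 0" "flux E (e_out E) = - flux E (e_in E)"
    and "\<And>e. e \<in> cell_faces E \<Longrightarrow> flux E e \<noteq> 0 \<Longrightarrow> e = e_in E \<or> e = e_out E"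
proof -
  obtain i j where E: "E = cell i j" "cell_index i j" "\<not> v_nondeg (Suc i) j" "\<not> h_nondeg i j"
    by (rule stab_cellE[OF assms])
  note t = triangle_faces[OF E(2-4), folded E(1)]
  note ff = flux_faces(1,2,5)[OF E(2), folded E(1)]
  note mem = mem_cell_faces_iff[OF E(2), folded E(1)]
  note nz = triangle_flux_nonzero[OF E(2,4)]
  show "e_in E \<in> cell_faces E" "e_out E \<in> cell_faces E" unfolding mem t by simp_all
  show "flux E (e_in E) < 0" "flux E (e_out E) = - flux E (e_in E)"
    unfolding t using ff nz t(1) by simp_all
  show "e = e_in E \<or> e = e_out E" if "e \<in> cell_faces E" "flux E e \<noteq> 0" for e
    using that ff E(3,4) unfolding mem t by auto
qed

text \<open>A cell to the left of a triangle has the shared face as a right face of positive length,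
  and a cell above it has a bottom face of positive length, whereas a stabilised triangle has
  neither. This makes \<open>e_in\<close> and \<open>e_out\<close> injective with disjoint
  images.\<close>

lemma stab_cells_share_no_face:
  assumes "E \<in> stab_cells" "F \<in> stab_cells" "e \<in> cell_faces E" "e \<in> cell_faces F" "flux E e \<noteq> 0"
  shows "E = F"
proof -
  obtain i j where E: "E = cell i j" "cell_index i j" "\<not> v_nondeg (Suc i) j" "\<not> h_nondeg i j"
    by (rule stab_cellE[OF assms(1)])
  obtain k l where F: "F = cell k l" "cell_index k l" "\<not> v_nondeg (Suc k) l" "\<not> h_nondeg k l"
    by (rule stab_cellE[OF assms(2)])
  note nd = cell_index_nondeg[OF E(2)]
  have ad: "F \<in> adjacent_cells e"
    using assms(4) F(1) cell_in_cells[OF F(2)] unfolding adjacent_cells_def by blast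
  consider "e = vf i j" | "e = hf i (Suc j)"
    using assms(3,5) flux_faces(5)[OF E(2)] E(3,4) unfolding E(1) mem_cell_faces_iff[OF E(2)] by blast
  then show ?thesis
  proof cases
    case 1
    have "\<not> (i = Suc k' \<and> cell_index k' j \<and> F = cell k' j)" for k'
      using cell_inj[OF F(2)] F nd(1) by metis
    then show ?thesis using ad unfolding 1 adjacent_vf[OF nd(1)] E(1) by blast
  next
    case 2
    have "F \<noteq> cell i (Suc j)"
      using cell_inj[OF F(2)] F nd(2) by metis
    then show ?thesis using ad unfolding 2 adjacent_hf[OF nd(2)] E(1) by blast
  qed
qed

section \<open>Face lengths against cell areas\<close>

definition v_length :: "nat \<Rightarrow> nat \<Rightarrow> real" where
  "v_length i j = max 0 (real (Suc j) * h - max (real j * h) ((real i * h - x0) * m))"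

definition h_length :: "nat \<Rightarrow> nat \<Rightarrow> real" where
  "h_length i j = max 0 (min (real (Suc i) * h) (x0 + real j * h / m) - real i * h)"

lemma length_bounds: "0 \<le> v_length i j" "v_length i j \<le> h" "0 \<le> h_length i j" "h_length i j \<le> h"
  unfolding v_length_def h_length_def using h_pos by (auto simp: algebra_simps)

lemma norm_beta_le:
  assumes "p \<in> closure Omega"
  shows "norm (\<beta> p) \<le> beta_max"
proof -
  have "compact (closure Omega)" using bounded_Omega by (simp add: compact_closure)
  then have "bounded (\<beta> ` closure Omega)"
    by (intro compact_imp_bounded compact_continuous_image continuous_beta)
  then have "bdd_above ((\<lambda>x. norm (\<beta> x)) ` closure Omega)"
    unfolding bounded_iff bdd_above_def by auto
  then show ?thesis unfolding beta_max_def using assms by (intro cSUP_upper)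
qed

lemma beta_max_nonneg: "p \<in> closure Omega \<Longrightarrow> 0 \<le> beta_max"
  using norm_beta_le norm_ge_zero[of "\<beta> p"] by (rule order_trans[rotated])

lemma v_flux_bound:
  assumes "vf i j \<subseteq> closure Omega" "0 \<le> beta_max"
  shows "\<bar>v_flux i j\<bar> \<le> beta_max * v_length i j"
proof (cases "max (real j * h) ((real i * h - x0) * m) \<le> real (Suc j) * h")
  case True
  let ?I = "{max (real j * h) ((real i * h - x0) * m)..real (Suc j) * h}"
  have mem: "(real i * h, y) \<in> closure Omega" if "y \<in> ?I" for y
    using assms(1) that unfolding vf_def vface_def by blast
  have "continuous_on ?I (\<lambda>y. fst (\<beta> (real i * h, y)))"
    by (intro continuous_intros continuous_on_compose2[OF continuous_beta]) (use mem in auto)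
  moreover have "norm (fst (\<beta> (real i * h, y))) \<le> beta_max" if "y \<in> ?I" for y
    using norm_fst_le[of "fst (\<beta> (real i * h, y))" "snd (\<beta> (real i * h, y))"] norm_beta_le[OF mem[OF that]] by simp
  ultimately have "norm (v_flux i j) \<le> beta_max * (real (Suc j) * h - max (real j * h) ((real i * h - x0) * m))"
    unfolding v_flux_def using True by (intro integral_bound)
  then show ?thesis unfolding v_length_def using True by simp
next
  case False
  then have "\<not> v_nondeg i j" unfolding v_nondeg_iff by linarith
  then show ?thesis using degenerate_flux(1) assms(2) length_bounds by simp
qed

lemma h_flux_bound:
  assumes "hf i j \<subseteq> closure Omega" "0 \<le> beta_max"
  shows "\<bar>h_flux i j\<bar> \<le> beta_max * h_length i j"
proof (cases "real i * h \<le> min (real (Suc i) * h) (x0 + real j * h / m)")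
  case True
  let ?I = "{real i * h..min (real (Suc i) * h) (x0 + real j * h / m)}"
  have mem: "(x, real j * h) \<in> closure Omega" if "x \<in> ?I" for x
    using assms(1) that unfolding hf_def hface_def by blast
  have "continuous_on ?I (\<lambda>x. snd (\<beta> (x, real j * h)))"
    by (intro continuous_intros continuous_on_compose2[OF continuous_beta]) (use mem in auto)
  moreover have "norm (snd (\<beta> (x, real j * h))) \<le> beta_max" if "x \<in> ?I" for x
    using norm_snd_le[of "snd (\<beta> (x, real j * h))" "fst (\<beta> (x, real j * h))"] norm_beta_le[OF mem[OF that]] by simp
  ultimately have "norm (h_flux i j) \<le> beta_max * (min (real (Suc i) * h) (x0 + real j * h / m) - real i * h)"
    unfolding h_flux_def using True by (intro integral_bound)
  then show ?thesis unfolding h_length_def using True by simp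
next
  case False
  then have "\<not> h_nondeg i j" unfolding h_nondeg_iff by linarith
  then show ?thesis using degenerate_flux(2) assms(2) length_bounds by simp
qed

text \<open>Upper bounds suffice: a triangle that is not stabilised has a face of diameter at least
  h/2, and this lower bound has to reach the lengths in the area estimate.\<close>

lemma diameter_faces:
  assumes "cell_index i j"
  shows "diameter (vf i j) \<le> v_length i j" "diameter (hf i (Suc j)) \<le> h_length i (Suc j)"
proof -
  show "diameter (vf i j) \<le> v_length i j"
  proof (rule diameter_le)
    show "norm (p - q) \<le> v_length i j" if "p \<in> vf i j" "q \<in> vf i j" for p q
      using that unfolding vf_def vface_def v_length_def by (auto simp: norm_Pair)
  qed (simp add: length_bounds)
  show "diameter (hf i (Suc j)) \<le> h_length i (Suc j)"
  proof (rule diameter_le)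
    show "norm (p - q) \<le> h_length i (Suc j)" if "p \<in> hf i (Suc j)" "q \<in> hf i (Suc j)" for p q
      using that unfolding hf_def hface_def h_length_def by (auto simp: norm_Pair)
  qed (simp add: length_bounds)
qed

end

text \<open>
  The letters \<open>L\<close>, \<open>R\<close>, \<open>T\<close>, \<open>B\<close> stand for the left, right, top and bottom face, with flux \<open>b\<close> and
  length \<open>l\<close>. The two lower bounds of \<open>A\<close> are the areas of trapezoids.
\<close>

lemma inflow_area_bound:
  fixes M A h :: real
  assumes bal: "bR - bL + bT - bB = 0"
    and b: "\<bar>bL\<bar> \<le> M * lL" "\<bar>bR\<bar> \<le> M * lR" "\<bar>bT\<bar> \<le> M * lT" "\<bar>bB\<bar> \<le> M * lB"
    and l: "0 \<le> lL" "0 \<le> lR" "0 \<le> lT" "0 \<le> lB" "lL \<le> h" "lR \<le> h" "lT \<le> h" "lB \<le> h"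
    and A: "lT * (lL + lR) / 2 \<le> A" "lL * (lT + lB) / 2 \<le> A"
    and R: "lT = h \<or> bR = 0" and B: "lL = h \<or> bB = 0"
    and tri: "bR = 0 \<Longrightarrow> bB = 0 \<Longrightarrow> h / 2 \<le> max lL lT \<or> lT = h \<or> lL = h"
    and "0 < h" "0 \<le> M"
  shows "(\<bar>bL\<bar> + \<bar>bR\<bar> + \<bar>bT\<bar> + \<bar>bB\<bar>) * h \<le> 8 * M * A"
proof -
  have MA: "M * (lT * (lL + lR)) \<le> 2 * M * A" "M * (lL * (lT + lB)) \<le> 2 * M * A"
    using A mult_left_mono[OF A(1) \<open>0 \<le> M\<close>] mult_left_mono[OF A(2) \<open>0 \<le> M\<close>] by simp_all
  have A0: "0 \<le> M * A"
  proof -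
    have "0 \<le> lT * (lL + lR) / 2" using l by simp
    then show ?thesis using A(1) \<open>0 \<le> M\<close> by simp
  qed
  consider "bR \<noteq> 0" "bB \<noteq> 0" | "bR = 0" "lL = h" | "bB = 0" "lT = h" | "bR = 0" "bB = 0" "h / 2 \<le> max lL lT"
    using R B tri by blast
  then show ?thesis
  proof cases
    case 1
    \<comment> \<open>Flux through both the right and the bottom side means full left and top sides.
      The area is then at least h^2/2, and bounding all four lengths by \<open>h\<close> is good
      enough.\<close>
    then have "lT = h" "lL = h" using R B by auto
    have "h * h * M \<le> 2 * M * A"
    proof -
      have "0 \<le> M * (h * lR)" using l(2) \<open>0 < h\<close> \<open>0 \<le> M\<close> by simp
      then show ?thesis using MA(1) unfolding \<open>lT = h\<close> \<open>lL = h\<close> by (simp add: algebra_simps)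
    qed
    moreover have "M * lL \<le> M * h" "M * lR \<le> M * h" "M * lT \<le> M * h" "M * lB \<le> M * h"
      using l \<open>0 \<le> M\<close> by (simp_all add: mult_left_mono)
    then have "\<bar>bL\<bar> + \<bar>bR\<bar> + \<bar>bT\<bar> + \<bar>bB\<bar> \<le> 4 * (M * h)" using b by linarith
    then have "(\<bar>bL\<bar> + \<bar>bR\<bar> + \<bar>bT\<bar> + \<bar>bB\<bar>) * h \<le> 4 * (M * h) * h"
      using \<open>0 < h\<close> by (intro mult_right_mono) auto
    ultimately show ?thesis by (simp add: algebra_simps)
  next
    case 2
    \<comment> \<open>The left flux is expressed by the top and bottom fluxes through the balance,
      because their lengths are the parallel sides of the trapezoid of height
      \<open>lL = h\<close>.\<close>
    have "\<bar>bL\<bar> + \<bar>bR\<bar> + \<bar>bT\<bar> + \<bar>bB\<bar> \<le> 2 * (M * (lT + lB))"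
      using bal 2(1) b by (simp add: distrib_left)
    then have "(\<bar>bL\<bar> + \<bar>bR\<bar> + \<bar>bT\<bar> + \<bar>bB\<bar>) * h \<le> 2 * (M * (lT + lB)) * h"
      using \<open>0 < h\<close> by (intro mult_right_mono) auto
    also have "\<dots> = 2 * (M * (lL * (lT + lB)))" using 2 by simp
    finally show ?thesis using MA(2) A0 by linarith
  next
    case 3
    have "\<bar>bL\<bar> + \<bar>bR\<bar> + \<bar>bT\<bar> + \<bar>bB\<bar> \<le> 2 * (M * (lL + lR))"
      using bal 3(1) b by (simp add: distrib_left)
    then have "(\<bar>bL\<bar> + \<bar>bR\<bar> + \<bar>bT\<bar> + \<bar>bB\<bar>) * h \<le> 2 * (M * (lL + lR)) * h"
      using \<open>0 < h\<close> by (intro mult_right_mono) auto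
    also have "\<dots> = 2 * (M * (lT * (lL + lR)))" using 3 by simp
    finally show ?thesis using MA(1) A0 by linarith
  next
    case 4
    \<comment> \<open>The same amount passes through both legs, so it may be estimated on either of
      them. The leg of length at least h/2 is kept to absorb \<open>h\<close>, and the product of
      the legs is at most \<open>2 * A\<close>.\<close>
    have eq: "bL = bT" using bal 4 by simp
    have "M * (lT * lL) \<le> 2 * M * A"
      using MA(1) mult_nonneg_nonneg[OF \<open>0 \<le> M\<close> mult_nonneg_nonneg[OF l(3,2)]] by (simp add: distrib_left)
    moreover have "\<bar>bL\<bar> * h \<le> 2 * (M * (lT * lL))"
    proof (cases "h / 2 \<le> lL")
      case True
      have "\<bar>bL\<bar> * h \<le> (M * lT) * (2 * lL)"
        using True b(3) eq l \<open>0 < h\<close> \<open>0 \<le> M\<close> by (intro mult_mono) auto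
      then show ?thesis by (simp add: mult_ac)
    next
      case False
      then have "h / 2 \<le> lT" using 4(3) by auto
      then have "\<bar>bL\<bar> * h \<le> (M * lL) * (2 * lT)"
        using b(1) l \<open>0 < h\<close> \<open>0 \<le> M\<close> by (intro mult_mono) auto
      then show ?thesis by (simp add: mult_ac)
    qed
    ultimately have "\<bar>bL\<bar> * h \<le> 4 * M * A" by linarith
    then show ?thesis unfolding eq 4(1,2) by (simp add: algebra_simps)
  qed
qed

context dod_setting
begin

text \<open>The sum counts inflow and outflow, which are equal; hence 8 here and 4 in
  \<open>C_tr\<close>. That the cell is not stabilised enters through the triangular case, where it
  makes one leg at least h/2 long.\<close>

lemma total_flux_bound:
  assumes "E \<in> cells" "E \<notin> stab_cells"
  shows "(\<Sum>e\<in>cell_faces E. \<bar>flux E e\<bar>) * h \<le> 8 * beta_max * measure lebesgue E"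
proof -
  obtain i j where E: "E = cell i j" "cell_index i j" using assms(1) unfolding cells_eq by blast
  interpret cut_box "real i * h" "real (Suc i) * h" "real j * h" "real (Suc j) * h" x0 m
    by (rule cut_box_cell[OF E(2)])
  have sub: "left_edge \<subseteq> closure Omega" "right_edge \<subseteq> closure Omega" "bottom_edge \<subseteq> closure Omega" "top_edge \<subseteq> closure Omega"
    using edges_face_of[THEN face_of_imp_subset] cpoly_subset[OF E(2)] by blast+
  have "vf i j \<noteq> {}" using left_length_pos unfolding vf_def vface_def by auto
  then have M: "0 \<le> beta_max" using beta_max_nonneg sub(1) unfolding vf_def by blast
  have lL: "v_length i j = real (Suc j) * h - max (real j * h) ((real i * h - x0) * m)"
    unfolding v_length_def using left_length_pos by linarith
  have lT: "h_length i (Suc j) = min (real (Suc i) * h) (x0 + real (Suc j) * h / m) - real i * h"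
    unfolding h_length_def using top_length_pos by linarith
  have "(\<bar>v_flux i j\<bar> + \<bar>v_flux (Suc i) j\<bar> + \<bar>h_flux i (Suc j)\<bar> + \<bar>h_flux i j\<bar>) * h \<le> 8 * beta_max * measure lebesgue (cpoly i j)"
  proof (rule inflow_area_bound[where lL="v_length i j" and lR="v_length (Suc i) j" and lT="h_length i (Suc j)" and lB="h_length i j"])
    show "v_flux (Suc i) j - v_flux i j + h_flux i (Suc j) - h_flux i j = 0" by (rule sum_flux_indexed[OF E(2)])
    show "h_length i (Suc j) * (v_length i j + v_length (Suc i) j) / 2 \<le> measure lebesgue polygon"
      unfolding lL lT v_length_def[of "Suc i" j] by (rule measure_polygon_ge_vertical)
    show "v_length i j * (h_length i (Suc j) + h_length i j) / 2 \<le> measure lebesgue polygon"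
      unfolding lL lT h_length_def[of i j] by (rule measure_polygon_ge_horizontal)
    show "h_length i (Suc j) = h \<or> v_flux (Suc i) j = 0"
    proof (cases "v_nondeg (Suc i) j")
      case True
      then have "real (Suc i) * h < x0 + real (Suc j) * h / m" unfolding v_nondeg_def ramp_less_iff .
      then show ?thesis unfolding lT by (simp add: algebra_simps)
    qed (simp add: degenerate_flux)
    show "v_length i j = h \<or> h_flux i j = 0"
    proof (cases "h_nondeg i j")
      case True
      then show ?thesis unfolding lL h_nondeg_def by (simp add: algebra_simps)
    qed (simp add: degenerate_flux)
    show "h / 2 \<le> max (v_length i j) (h_length i (Suc j)) \<or> h_length i (Suc j) = h \<or> v_length i j = h"
    proof (cases "v_nondeg (Suc i) j \<or> h_nondeg i j")
      case True
      then show ?thesis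
      proof
        assume "v_nondeg (Suc i) j"
        then have "real (Suc i) * h < x0 + real (Suc j) * h / m" unfolding v_nondeg_def ramp_less_iff .
        then show ?thesis unfolding lT by (simp add: algebra_simps)
      next
        assume "h_nondeg i j"
        then show ?thesis unfolding lL h_nondeg_def by (simp add: algebra_simps)
      qed
    next
      case False
      \<comment> \<open>A cell without right and bottom face is a triangle, so it can be outside
        \<open>stab_cells\<close> only because one of its legs is too long.\<close>
      then have "2 simplex polygon"
        unfolding v_nondeg_def h_nondeg_def not_less by (intro degenerate_imp_simplex) auto
      then have "\<not> max (diameter (e_in E)) (diameter (e_out E)) < h / 2"
        using assms closure_cell[OF E(2)] unfolding stab_cells_def E(1) by simp
      moreover have "{e_in E, e_out E} = {vf i j, hf i (Suc j)}"
        using triangle_faces(2,3)[OF E(2)] False unfolding E(1) by auto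
      then have "max (diameter (e_in E)) (diameter (e_out E)) = max (diameter (vf i j)) (diameter (hf i (Suc j)))"
        by (auto simp: doubleton_eq_iff max.commute)
      ultimately show ?thesis using diameter_faces[OF E(2)] by auto
    qed
  qed (use v_flux_bound h_flux_bound sub M length_bounds h_pos in \<open>simp_all add: vf_def hf_def\<close>)
  moreover have "(\<Sum>e\<in>cell_faces E. \<bar>flux E e\<bar>)
      = \<bar>v_flux i j\<bar> + \<bar>v_flux (Suc i) j\<bar> + \<bar>h_flux i (Suc j)\<bar> + \<bar>h_flux i j\<bar>"
    unfolding E(1) sum_cell_faces[OF E(2)]
    using flux_faces[OF E(2)] degenerate_flux by auto
  ultimately show ?thesis unfolding E(1) measure_cell[OF E(2)] by simp
qed

section \<open>Traces and norms of piecewise constant functions\<close>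

definition val :: "(plane \<Rightarrow> real) \<Rightarrow> plane set \<Rightarrow> real" where
  "val v E = (SOME c. AE x in lebesgue_on E. v x = c)"

lemma AE_val:
  assumes "v \<in> V0" "E \<in> cells"
  shows "AE x in lebesgue_on E. v x = val v E"
  unfolding val_def using assms someI_ex[of "\<lambda>c. AE x in lebesgue_on E. v x = c"] unfolding V0_def by blast

lemma lmeasurable_cells: "E \<in> cells \<Longrightarrow> E \<in> lmeasurable"
  unfolding cells_eq using lmeasurable_cell by blast

lemma lmeasurable_Omega: "Omega \<in> lmeasurable"
  using open_Omega bounded_Omega by (simp add: lmeasurable_open)

lemma cells_subset_Omega: "E \<in> cells \<Longrightarrow> E \<subseteq> Omega"
  unfolding cells_def by blast

lemma measure_cells_pos: "E \<in> cells \<Longrightarrow> 0 < measure lebesgue E"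
  unfolding cells_def by blast

lemma V0_measurable: "v \<in> V0 \<Longrightarrow> v \<in> borel_measurable (lebesgue_on Omega)"
  unfolding V0_def L2_def by blast

text \<open>Every ball around a point of the closure meets the inner part in a nonempty open set.
  The denominator is therefore positive, and the average equals the constant for every radius, not
  only in the limit.\<close>

lemma cell_trace_eq:
  assumes v: "v \<in> V0" and E: "E \<in> cells" and x: "x \<in> closure E"
  shows "cell_trace E v x = val v E"
proof -
  have *: "(LINT y|lebesgue_on (E \<inter> ball x r). v y) / measure lebesgue (E \<inter> ball x r) = val v E"
    if "0 < r" for r
  proof -
    let ?S = "E \<inter> ball x r"
    obtain i j where ij: "E = cell i j" "cell_index i j" using E unfolding cells_eq by blast
    interpret cut_box "real i * h" "real (Suc i) * h" "real j * h" "real (Suc j) * h" x0 m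
      by (rule cut_box_cell[OF ij(2)])
    have S: "?S \<in> lmeasurable" by (intro fmeasurable.Int lmeasurable_cells[OF E]) simp
    have "x \<in> closure inner_part" using x closure_cell[OF ij(2)] closure_inner_part ij(1) by simp
    then obtain y where "y \<in> inner_part" "dist y x < r"
      using \<open>0 < r\<close> unfolding closure_approachable by blast
    then have "y \<in> inner_part \<inter> ball x r" by (simp add: dist_commute)
    then have "inner_part \<inter> ball x r \<noteq> {}" by blast
    moreover have "open (inner_part \<inter> ball x r)" by (intro open_Int open_inner_part open_ball)
    ultimately have "\<not> negligible (inner_part \<inter> ball x r)" by (rule open_not_negligible[rotated])
    moreover have "inner_part \<inter> ball x r \<subseteq> ?S" using cell_between(1)[OF ij(2)] ij(1) by blast
    ultimately have "\<not> negligible ?S" using negligible_subset by blast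
    then have pos: "measure lebesgue ?S \<noteq> 0" using S negligible_iff_measure by blast
    have sub: "?S \<subseteq> E" "?S \<subseteq> Omega" using cells_subset_Omega[OF E] by auto
    have "AE y in lebesgue. y \<in> E \<longrightarrow> v y = val v E"
      using AE_val[OF v E] lmeasurable_cells[OF E] by (simp add: AE_restrict_space_iff fmeasurableD)
    then have ae: "AE y in lebesgue_on ?S. v y = val v E"
      using S by (subst AE_restrict_space_iff) (auto elim!: eventually_mono)
    have "v \<in> borel_measurable (lebesgue_on ?S)"
      by (rule measurable_restrict_mono[OF V0_measurable[OF v] sub(2)])
    then have "(LINT y|lebesgue_on ?S. v y) = (LINT y|lebesgue_on ?S. val v E)"
      by (intro integral_cong_AE ae) auto
    also have "\<dots> = measure lebesgue ?S * val v E"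
      using S by (simp add: measure_restrict_space fmeasurableD)
    finally show ?thesis using pos by simp
  qed
  have "((\<lambda>r. (LINT y|lebesgue_on (E \<inter> ball x r). v y) / measure lebesgue (E \<inter> ball x r)) \<longlongrightarrow> val v E) (at_right 0)"
    by (rule tendsto_eventually) (use * in \<open>auto simp: eventually_at_right_field intro!: exI[of _ 1]\<close>)
  then show ?thesis unfolding cell_trace_def by (intro tendsto_Lim) simp_all
qed

text \<open>The mean is a quotient by the absolute flux. On a face without flux the division by zero
  gives 0, so the constant of the cell is visible only on faces that carry flux.\<close>

lemma wmean_eq:
  assumes "v \<in> V0" "E \<in> cells" "e \<in> cell_faces E"
  shows "wmean v E e = (if flux E e = 0 then 0 else val v E)"
proof -
  have "seg_integral e (\<lambda>x. normal_speed e x * cell_trace E v x) = seg_integral e (\<lambda>x. val v E * normal_speed e x)"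
  proof (rule seg_integral_cong)
    fix x assume "x \<in> e"
    then have "x \<in> closure E" using face_subset[OF assms(2,3)] by blast
    then show "normal_speed e x * cell_trace E v x = val v E * normal_speed e x"
      using cell_trace_eq[OF assms(1,2)] by simp
  qed (use face_segment_normal(1)[OF assms(2,3)] in blast)
  then show ?thesis
    unfolding wmean_def seg_integral_mult_left speed_integral[OF assms(2,3)] by simp
qed

section \<open>Piecewise constant functions up to null sets\<close>

lemma grid_index:
  assumes "0 < x" "x < L" "\<And>i. x \<noteq> real i * h"
  obtains i where "i < N" "real i * h < x" "x < real (Suc i) * h"
proof -
  define i where "i = nat \<lfloor>x / h\<rfloor>"
  have "0 \<le> \<lfloor>x / h\<rfloor>" using assms(1) h_pos by simp
  then have r: "real i = of_int \<lfloor>x / h\<rfloor>" unfolding i_def by simp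
  have "real i \<le> x / h" "x / h < real i + 1" unfolding r by linarith+
  then have b: "real i * h \<le> x" "x < real (Suc i) * h"
    using h_pos by (simp_all add: field_simps)
  moreover have "real i * h \<noteq> x" using assms(3)[of i] by simp
  moreover have "i < N"
  proof -
    have "real i * h < real N * h" using b(1) assms(2) by (simp only: L_eq[symmetric])
    then show ?thesis using h_pos by simp
  qed
  ultimately show ?thesis using that by simp
qed

text \<open>Neighbouring cells overlap on grid lines, so the cells partition the domain only away
  from them.\<close>

lemma cell_partition:
  assumes p: "p \<in> Omega" and off: "\<And>i. fst p \<noteq> real i * h" "\<And>i. snd p \<noteq> real i * h"
  shows "\<exists>E\<in>cells. \<forall>F\<in>cells. p \<in> F \<longleftrightarrow> F = E"
proof -
  obtain x y where xy: "p = (x, y)" by (cases p)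
  have b: "0 < x" "x < L" "0 < y" "y < L" "(x - x0) * m < y" using p unfolding xy Omega_eq by auto
  obtain i where i: "i < N" "real i * h < x" "x < real (Suc i) * h"
    using grid_index[OF b(1,2)] off(1) unfolding xy by auto
  obtain j where j: "j < N" "real j * h < y" "y < real (Suc j) * h"
    using grid_index[OF b(3,4)] off(2) unfolding xy by auto
  have mem: "p \<in> cell i j"
    using i j p unfolding cell_def xy cbox_Pair_eq by (simp del: of_nat_Suc)
  have idx: "cell_index i j"
    using cell_empty mem i(1) j(1) unfolding cell_index_def by blast
  have "p \<in> cinner i j"
    unfolding cut_box.inner_part_def[OF cut_box_cell[OF idx]] xy using i j b by (simp del: of_nat_Suc)
  then have "\<forall>F\<in>cells. p \<in> F \<longleftrightarrow> F = cell i j"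
    using inner_mem_cell[OF idx] mem unfolding cells_eq by blast
  then show ?thesis using cell_in_cells[OF idx] by blast
qed

lemma AE_off_grid: "AE p in lebesgue. \<forall>i. fst p \<noteq> real i * h \<and> snd (p :: plane) \<noteq> real i * h"
proof -
  have "AE p in lebesgue. fst p \<noteq> c \<and> snd (p :: plane) \<noteq> c" for c
  proof -
    have "negligible {p :: plane. p \<bullet> (1, 0) = c}" "negligible {p :: plane. p \<bullet> (0, 1) = c}"
      by (rule negligible_standard_hyperplane; simp add: Basis_prod_def)+
    then have "AE p in lebesgue. p \<notin> {p :: plane. p \<bullet> (1, 0) = c}" "AE p in lebesgue. p \<notin> {p :: plane. p \<bullet> (0, 1) = c}"
      using AE_not_in negligible_iff_null_sets by blast+
    then show ?thesis by eventually_elim (auto simp: inner_prod_def)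
  qed
  then show ?thesis by (simp add: AE_all_countable)
qed

text \<open>A representative with prescribed cell values. On a grid line shared by several cells
  their values are added, which affects a null set only.\<close>

definition step :: "(plane set \<Rightarrow> real) \<Rightarrow> plane \<Rightarrow> real" where
  "step c p = (\<Sum>E\<in>cells. c E * indicator E p)"

lemma step_eq:
  assumes "E \<in> cells" "\<forall>F\<in>cells. p \<in> F \<longleftrightarrow> F = E"
  shows "step c p = c E"
proof -
  have "step c p = (\<Sum>F\<in>cells. if F = E then c F else 0)"
    unfolding step_def by (intro sum.cong refl) (use assms in \<open>auto simp: indicator_def\<close>)
  then show ?thesis using assms(1) finite_cells by simp
qed

lemma AE_step:
  assumes "\<And>E. E \<in> cells \<Longrightarrow> AE p in lebesgue_on E. g p = c E"
  shows "AE p in lebesgue_on Omega. g p = step c p"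
proof -
  have "AE p in lebesgue. \<forall>E\<in>cells. p \<in> E \<longrightarrow> g p = c E"
    using assms lmeasurable_cells
    by (intro AE_finite_allI finite_cells) (simp add: AE_restrict_space_iff fmeasurableD)
  then have "AE p in lebesgue. p \<in> Omega \<longrightarrow> g p = step c p"
    using AE_off_grid
  proof eventually_elim
    case (elim p)
    show ?case
    proof
      assume "p \<in> Omega"
      then obtain E where E: "E \<in> cells" "\<forall>F\<in>cells. p \<in> F \<longleftrightarrow> F = E"
        using cell_partition elim(2) by blast
      then show "g p = step c p" using elim(1) step_eq by simp
    qed
  qed
  then show ?thesis using lmeasurable_Omega by (simp add: AE_restrict_space_iff fmeasurableD)
qed

lemma integrable_step:
  "integrable (lebesgue_on Omega) (step c)"
  "(LINT p|lebesgue_on Omega. step c p) = (\<Sum>E\<in>cells. c E * measure lebesgue E)"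
proof -
  have ind: "integrable (lebesgue_on Omega) (indicator E :: plane \<Rightarrow> real)"
    "(LINT p|lebesgue_on Omega. indicator E p) = measure lebesgue E" if "E \<in> cells" for E
  proof -
    have "E \<inter> Omega = E" using cells_subset_Omega[OF that] by blast
    moreover have "E \<in> sets (lebesgue_on Omega)"
      using lmeasurable_cells[OF that] lmeasurable_Omega cells_subset_Omega[OF that]
      by (simp add: sets_restrict_space_iff fmeasurableD)
    moreover have "emeasure (lebesgue_on Omega) E < \<infinity>"
    proof -
      have "emeasure lebesgue E < \<infinity>"
        using fmeasurableD2[OF lmeasurable_cells[OF that]] by (simp only: top.not_eq_extremum infinity_ennreal_def)
      then show ?thesis
        using lmeasurable_Omega cells_subset_Omega[OF that] by (subst emeasure_restrict_space) auto
    qed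
    ultimately show "integrable (lebesgue_on Omega) (indicator E :: plane \<Rightarrow> real)"
      "(LINT p|lebesgue_on Omega. indicator E p) = measure lebesgue E"
      using lmeasurable_Omega cells_subset_Omega[OF that]
      by (simp_all add: integrable_real_indicator measure_restrict_space fmeasurableD)
  qed
  show "integrable (lebesgue_on Omega) (step c)"
    unfolding step_def[abs_def] by (intro Bochner_Integration.integrable_sum integrable_mult_right ind)
  show "(LINT p|lebesgue_on Omega. step c p) = (\<Sum>E\<in>cells. c E * measure lebesgue E)"
    unfolding step_def using ind by simp
qed

lemma L2_inner_V0:
  assumes "u \<in> V0" "w \<in> V0"
  shows "L2_inner u w = (\<Sum>E\<in>cells. val u E * val w E * measure lebesgue E)"
proof -
  have "AE p in lebesgue_on Omega. u p * w p = step (\<lambda>E. val u E * val w E) p"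
  proof (rule AE_step)
    fix E assume "E \<in> cells"
    then show "AE p in lebesgue_on E. u p * w p = val u E * val w E"
      using AE_val[OF assms(1)] AE_val[OF assms(2)] by fastforce
  qed
  then have "L2_inner u w = (LINT p|lebesgue_on Omega. step (\<lambda>E. val u E * val w E) p)"
    unfolding L2_inner_def using assms[THEN V0_measurable] borel_measurable_integrable[OF integrable_step(1)]
    by (intro integral_cong_AE) auto
  then show ?thesis unfolding integrable_step(2) .
qed

lemma L2_norm_V0:
  assumes "w \<in> V0"
  shows "L2_norm w = sqrt (\<Sum>E\<in>cells. (val w E)\<^sup>2 * measure lebesgue E)"
  using L2_inner_V0[OF assms assms] unfolding L2_norm_def L2_inner_def power2_eq_square by simp

lemma AE_cell_step:
  assumes "E \<in> cells"
  shows "AE p in lebesgue_on E. step c p = c E"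
proof -
  have "AE p in lebesgue. p \<in> E \<longrightarrow> step c p = c E"
    using AE_off_grid
  proof eventually_elim
    case (elim p)
    show ?case
    proof
      assume p: "p \<in> E"
      then have "p \<in> Omega" using cells_subset_Omega[OF assms] by blast
      then obtain F where F: "F \<in> cells" "\<forall>G\<in>cells. p \<in> G \<longleftrightarrow> G = F"
        using cell_partition elim by blast
      then have "F = E" using p assms by blast
      then show "step c p = c E" using F step_eq by blast
    qed
  qed
  then show ?thesis using lmeasurable_cells[OF assms] by (simp add: AE_restrict_space_iff fmeasurableD)
qed

lemma step_in_V0: "step c \<in> V0"
proof -
  have m: "step c \<in> borel_measurable (lebesgue_on Omega)"
    by (rule borel_measurable_integrable[OF integrable_step(1)])
  have "AE p in lebesgue_on Omega. (step c p)\<^sup>2 = step (\<lambda>E. (c E)\<^sup>2) p"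
  proof (rule AE_step)
    fix E assume "E \<in> cells"
    from AE_cell_step[OF this, of c] show "AE p in lebesgue_on E. (step c p)\<^sup>2 = (c E)\<^sup>2"
      by eventually_elim simp
  qed
  then have "AE p in lebesgue_on Omega. step (\<lambda>E. (c E)\<^sup>2) p = (step c p)\<^sup>2"
    by eventually_elim simp
  then have "integrable (lebesgue_on Omega) (\<lambda>p. (step c p)\<^sup>2)"
    by (rule integrable_cong_AE_imp[OF integrable_step(1) borel_measurable_power[OF m]])
  then show ?thesis unfolding V0_def L2_def using m AE_cell_step by blast
qed

text \<open>A cell has positive measure, so the constant chosen by \<open>val\<close> is
  unique.\<close>

lemma val_step:
  assumes "E \<in> cells"
  shows "val (step c) E = c E"
proof -
  have "AE p in lebesgue_on E. val (step c) E = c E"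
    using AE_val[OF step_in_V0 assms, of c] AE_cell_step[OF assms, of c] by eventually_elim simp
  then have imp: "AE p in lebesgue. p \<in> E \<longrightarrow> val (step c) E = c E"
    using lmeasurable_cells[OF assms] by (simp add: AE_restrict_space_iff fmeasurableD)
  show ?thesis
  proof (rule ccontr)
    assume "val (step c) E \<noteq> c E"
    with imp have "AE p in lebesgue. p \<notin> E" by simp
    then have "E \<in> null_sets lebesgue"
      using AE_iff_null_sets[OF fmeasurableD[OF lmeasurable_cells[OF assms]]] by blast
    then have "measure lebesgue E = 0" by (simp add: measure_eq_0_null_sets)
    then show False using measure_cells_pos[OF assms] by simp
  qed
qed

end

section \<open>Stability of the bilinear form\<close>

lemma convex_square:
  fixes x y t :: real
  assumes "0 \<le> t" "t \<le> 1"
  shows "(t * x + (1 - t) * y)\<^sup>2 \<le> t * x\<^sup>2 + (1 - t) * y\<^sup>2"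
proof -
  have "t * x\<^sup>2 + (1 - t) * y\<^sup>2 - (t * x + (1 - t) * y)\<^sup>2 = t * (1 - t) * (x - y)\<^sup>2"
    by (simp add: power2_eq_square algebra_simps)
  moreover have "0 \<le> t * (1 - t) * (x - y)\<^sup>2" using assms by simp
  ultimately show ?thesis by linarith
qed

context dod_setting
begin

section \<open>Upwind values and jumps on faces that carry flux\<close>

lemma adjacent_iff: "E \<in> adjacent_cells e \<longleftrightarrow> E \<in> cells \<and> e \<in> cell_faces E"
  unfolding adjacent_cells_def by simp

lemma finite_adjacent: "finite (adjacent_cells e)"
  using finite_cells unfolding adjacent_cells_def by simp

lemma faces_adjacent: "e \<in> faces \<Longrightarrow> \<exists>E\<in>cells. e \<in> cell_faces E"
  unfolding faces_def interior_faces_def boundary_faces_def by blast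

lemma finite_faces: "finite faces"
  by (rule finite_subset[of _ "\<Union> (cell_faces ` cells)"])
    (use faces_adjacent finite_cells finite_cell_faces in auto)

lemma active_in_faces:
  assumes "E \<in> cells" "e \<in> cell_faces E" "flux E e \<noteq> 0"
  shows "e \<in> faces"
  using face_cases[OF assms]
proof (elim disjE exE)
  fix E' assume n: "neighbours E E' e"
  then have "E \<in> adjacent_cells e" "E' \<in> adjacent_cells e" "E \<noteq> E'" unfolding neighbours_def by auto
  then show ?thesis unfolding adjacent_iff faces_def interior_faces_def by blast
qed (simp add: faces_def)

text \<open>The two sides of a face see opposite fluxes. The product covers both uses: a face has at
  most one outflow cell and at most one inflow cell.\<close>

lemma same_sign_unique:
  assumes "E \<in> adjacent_cells e" "E' \<in> adjacent_cells e" "0 < flux E e * flux E' e"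
  shows "E = E'"
proof -
  have E: "E \<in> cells" "e \<in> cell_faces E" "flux E e \<noteq> 0" using assms adjacent_iff by auto
  from face_cases[OF E] show ?thesis
  proof (elim disjE exE)
    fix E'' assume n: "neighbours E E'' e"
    show ?thesis
    proof (rule ccontr)
      assume "E \<noteq> E'"
      then have "E' = E''" using n assms(2) unfolding neighbours_def by blast
      then have "flux E' e = - flux E e" using n unfolding neighbours_def by blast
      then show False using assms(3) by (simp add: zero_less_mult_iff)
    qed
  qed (use assms(2) in auto)
qed

lemma wmean_active:
  assumes "v \<in> V0" "E \<in> adjacent_cells e" "flux E e \<noteq> 0"
  shows "wmean v E e = val v E"
  using wmean_eq[OF assms(1)] assms unfolding adjacent_iff by simp

lemma upwind_outflow:
  assumes "v \<in> V0" "E \<in> adjacent_cells e" "0 < flux E e"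
  shows "upwind v e = val v E"
proof -
  have "outflow F e \<longleftrightarrow> F = E" if F: "F \<in> adjacent_cells e" for F
  proof -
    have "outflow F e \<longleftrightarrow> 0 < flux F e" using outflow_iff F unfolding adjacent_iff by blast
    then show ?thesis using same_sign_unique[OF assms(2) F] assms(3) by auto
  qed
  then have "{F. F \<in> adjacent_cells e \<and> outflow F e} = {E}" using assms(2) by blast
  then show ?thesis unfolding upwind_def using wmean_active[OF assms(1,2)] assms(3) by simp
qed

text \<open>On an interior face \<open>upwind\<close> is the value on the other side, and the jump
  is the difference times a unit normal. On a boundary inflow face \<open>upwind\<close> is 0 by
  convention and the jump has a single term, so one formula covers both.\<close>

lemma jump_inflow:
  assumes v: "v \<in> V0" and E: "E \<in> adjacent_cells e" "flux E e < 0"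
  shows "jump v e \<bullet> jump v e = (upwind v e - val v E)\<^sup>2"
proof -
  have EF: "E \<in> cells" "e \<in> cell_faces E" "flux E e \<noteq> 0" using E unfolding adjacent_iff by auto
  have nn: "outer_normal E e \<bullet> outer_normal E e = 1"
    using face_segment_normal(2)[OF EF(1,2)] by (simp add: dot_square_norm)
  from face_cases[OF EF] show ?thesis
  proof (elim disjE exE)
    assume a: "e \<in> boundary_faces \<and> adjacent_cells e = {E}"
    have "\<not> outflow E e" using outflow_iff[OF EF(1,2)] E(2) by simp
    then have "upwind v e = 0" using a unfolding upwind_def by (auto intro!: sum.neutral)
    moreover have "jump v e = val v E *\<^sub>R outer_normal E e"
      unfolding jump_def using a wmean_active[OF v E(1) EF(3)] by simp
    ultimately show ?thesis using nn by (simp add: power2_eq_square)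
  next
    fix E' assume n: "neighbours E E' e"
    then have E': "E' \<in> adjacent_cells e" "flux E' e = - flux E e" "E \<noteq> E'"
      "outer_normal E' e = - outer_normal E e" "adjacent_cells e = {E, E'}"
      unfolding neighbours_def by auto
    have "upwind v e = val v E'" using upwind_outflow[OF v E'(1)] E'(2) E(2) by simp
    moreover have "jump v e = (val v E - val v E') *\<^sub>R outer_normal E e"
      unfolding jump_def E'(5) using wmean_active[OF v E(1) EF(3)] wmean_active[OF v E'(1)] E' EF(3)
      by (simp add: algebra_simps)
    ultimately have "jump v e \<bullet> jump v e = (val v E - val v E') * (val v E - val v E')" "upwind v e = val v E'"
      by (simp_all add: nn)
    then show ?thesis by (simp add: power2_eq_square algebra_simps)
  qed
qed

abbreviation speed :: "plane set \<Rightarrow> real" where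
  "speed e \<equiv> seg_integral e (normal_speed e)"

lemma speed_nonneg: "e \<in> faces \<Longrightarrow> 0 \<le> speed e"
  using faces_adjacent speed_integral by fastforce

lemma speed_eq: "E \<in> adjacent_cells e \<Longrightarrow> speed e = \<bar>flux E e\<bar>"
  using speed_integral unfolding adjacent_iff by blast

lemma seg_integral_speed: "seg_integral e (\<lambda>x. normal_speed e x * c) = c * speed e"
  using seg_integral_mult_left[of e c "normal_speed e"] by (simp add: mult.commute)

text \<open>The jump is a sum over the adjacent cells, so the integral splits into one flux per
  cell. Replacing \<open>wmean\<close> by \<open>val\<close> is legitimate since they can differ
  only where the flux factor is 0.\<close>

lemma face_integral:
  assumes w: "w \<in> V0" and e: "e \<in> faces"
  shows "seg_integral e (\<lambda>x. U * (\<beta> x \<bullet> jump w e)) = (\<Sum>E\<in>adjacent_cells e. val w E * (U * flux E e))"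
proof -
  obtain E0 where E0: "E0 \<in> cells" "e \<in> cell_faces E0" using faces_adjacent[OF e] by blast
  have "seg_integral e (\<lambda>x. \<beta> x \<bullet> jump w e)
      = seg_integral e (\<lambda>x. \<Sum>E\<in>adjacent_cells e. wmean w E e * (\<beta> x \<bullet> outer_normal E e))"
    unfolding jump_def by (simp add: inner_sum_right)
  also have "\<dots> = (\<Sum>E\<in>adjacent_cells e. seg_integral e (\<lambda>x. wmean w E e * (\<beta> x \<bullet> outer_normal E e)))"
  proof (rule seg_integral_sum[OF finite_adjacent])
    show "\<exists>a b. e = closed_segment a b" using face_segment_normal(1)[OF E0] by blast
    show "continuous_on e (\<lambda>x. wmean w E e * (\<beta> x \<bullet> outer_normal E e))" for E
      by (intro continuous_intros continuous_normal_component[OF E0])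
  qed
  also have "\<dots> = (\<Sum>E\<in>adjacent_cells e. val w E * flux E e)"
  proof (rule sum.cong[OF refl])
    fix E assume E: "E \<in> adjacent_cells e"
    show "seg_integral e (\<lambda>x. wmean w E e * (\<beta> x \<bullet> outer_normal E e)) = val w E * flux E e"
      unfolding seg_integral_mult_left flux_def[symmetric]
      using wmean_active[OF w E] by (cases "flux E e = 0") simp_all
  qed
  finally show ?thesis unfolding seg_integral_mult_left by (simp add: sum_distrib_left mult_ac)
qed

lemma stab_adjacent:
  assumes "F \<in> stab_cells"
  shows "F \<in> cells" "F \<in> adjacent_cells (e_in F)" "F \<in> adjacent_cells (e_out F)"
    and "e_in F \<in> faces" "e_out F \<in> faces" "0 < flux F (e_out F)"
proof -
  note s = stab_faces[OF assms]
  show F: "F \<in> cells" using stab_subset_cells assms by blast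
  show "F \<in> adjacent_cells (e_in F)" "F \<in> adjacent_cells (e_out F)" unfolding adjacent_iff using F s by auto
  show "0 < flux F (e_out F)" using s by simp
  then show "e_in F \<in> faces" "e_out F \<in> faces" using active_in_faces[OF F] s by auto
qed

lemma inj_e_in: "inj_on e_in stab_cells"
proof (rule inj_onI)
  fix F G assume *: "F \<in> stab_cells" "G \<in> stab_cells" "e_in F = e_in G"
  show "F = G"
    by (rule stab_cells_share_no_face[OF *(1,2) stab_faces(1)[OF *(1)]])
      (use stab_faces(1)[OF *(2)] stab_faces(3)[OF *(1)] *(3) in auto)
qed

lemma inj_e_out: "inj_on e_out stab_cells"
proof (rule inj_onI)
  fix F G assume *: "F \<in> stab_cells" "G \<in> stab_cells" "e_out F = e_out G"
  show "F = G"
    by (rule stab_cells_share_no_face[OF *(1,2) stab_faces(2)[OF *(1)]])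
      (use stab_faces(2)[OF *(2)] stab_adjacent(6)[OF *(1)] *(3) in auto)
qed

lemma e_in_neq_e_out:
  assumes "F \<in> stab_cells" "G \<in> stab_cells"
  shows "e_in F \<noteq> e_out G"
proof
  assume eq: "e_in F = e_out G"
  have "F = G"
    by (rule stab_cells_share_no_face[OF assms stab_faces(1)[OF assms(1)]])
      (use stab_faces(2)[OF assms(2)] stab_faces(3)[OF assms(1)] eq in auto)
  then show False using eq stab_faces(3)[OF assms(1)] stab_adjacent(6)[OF assms(1)] by simp
qed

text \<open>By \<open>stab_not_boundary\<close> the inflow face has a second cell, which is then
  \<open>E_in F\<close>, and its opposite flux makes it the upwind cell.\<close>

lemma v_in_eq:
  assumes v: "v \<in> V0" and F: "F \<in> stab_cells"
  shows "v_in v F = upwind v (e_in F)"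
proof -
  note s = stab_faces[OF F] and a = stab_adjacent[OF F]
  have "e_in F \<notin> boundary_faces" using stab_not_boundary[OF F] by blast
  then obtain E' where n: "neighbours F E' (e_in F)" using face_cases[OF a(1) s(1)] s(3) by auto
  then have E': "E' \<in> adjacent_cells (e_in F)" "flux E' (e_in F) = - flux F (e_in F)" "E' \<noteq> F"
    "adjacent_cells (e_in F) = {F, E'}" unfolding neighbours_def by auto
  have "E_in F = E'" unfolding E_in_def
    by (rule the_equality) (use E' adjacent_iff in blast)+
  then show ?thesis
    unfolding v_in_def using upwind_outflow[OF v E'(1)] wmean_active[OF v E'(1)] E'(2) s(3) by simp
qed

lemma v_out_eq:
  assumes v: "v \<in> V0" and F: "F \<in> stab_cells" and E: "E \<in> adjacent_cells (e_out F)" "flux E (e_out F) < 0"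
  shows "v_out v F = val v E"
proof -
  note s = stab_faces[OF F] and a = stab_adjacent[OF F]
  have "E \<noteq> F" using a(6) E(2) by auto
  have "adjacent_cells (e_out F) = {F, E}"
    using face_cases[OF a(1) s(2)] a(6) E(1) \<open>E \<noteq> F\<close> unfolding neighbours_def by auto
  then have "E_out F = E" unfolding E_out_def
    by (intro the_equality) (use E(1) \<open>E \<noteq> F\<close> adjacent_iff in blast)+
  then show ?thesis unfolding v_out_def using wmean_active[OF v E(1)] E(2) by simp
qed

text \<open>The last bound comes from the first argument of the minimum in \<open>capacity\<close>;
  it is the origin of 1 / \<tau> in \<open>C_tr\<close>.\<close>

lemma capacity_bounds:
  assumes F: "F \<in> stab_cells"
  shows "0 \<le> capacity F" "capacity F \<le> 1"
    and "capacity F * \<bar>flux F (e_in F)\<bar> * h \<le> measure lebesgue F / \<tau>"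
proof -
  let ?B = "\<bar>flux F (e_in F)\<bar>"
  have B: "0 < ?B" using stab_faces(3)[OF F] by simp
  have c: "capacity F = min (measure lebesgue F / (\<tau> * h * ?B)) 1"
    unfolding capacity_def speed_eq[OF stab_adjacent(2)[OF F]] ..
  show "0 \<le> capacity F" "capacity F \<le> 1" unfolding c using B tau_pos h_pos by auto
  have "capacity F * (?B * h) \<le> measure lebesgue F / (\<tau> * h * ?B) * (?B * h)"
    unfolding c using B h_pos by (intro mult_right_mono) auto
  also have "\<dots> = measure lebesgue F / \<tau>" using B h_pos tau_pos by (simp add: field_simps)
  finally show "capacity F * ?B * h \<le> measure lebesgue F / \<tau>" by (simp add: mult_ac)
qed

text \<open>
  The numerical flux through \<open>e\<close> is \<open>flux_value v e\<close> times the flux of \<open>\<beta>\<close>, and \<open>face_seminorm v e\<close> is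
  the contribution of \<open>e\<close> to the square of the seminorm.
\<close>

definition flux_value :: "(plane \<Rightarrow> real) \<Rightarrow> plane set \<Rightarrow> real" where
  "flux_value v e = (if e \<in> e_out ` stab_cells
     then let F = inv_into stab_cells e_out e in capacity F * upwind v e + (1 - capacity F) * v_in v F
     else upwind v e)"

definition face_seminorm :: "(plane \<Rightarrow> real) \<Rightarrow> plane set \<Rightarrow> real" where
  "face_seminorm v e = (let J = jump v e \<bullet> jump v e in
     if e \<in> e_in ` stab_cells then capacity (inv_into stab_cells e_in e) * (J * speed e)
     else if e \<in> e_out ` stab_cells then let F = inv_into stab_cells e_out e in
       capacity F * (J * speed e) + (1 - capacity F) * ((v_out v F - v_in v F)\<^sup>2 * speed e)
     else J * speed e)"

text \<open>Injectivity of \<open>e_out\<close> lets \<open>inv_into\<close> recover the stabilised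
  cell from its outflow face, so data of cells can be attached to faces.\<close>

lemma flux_value_e_out:
  "F \<in> stab_cells \<Longrightarrow> flux_value v (e_out F) = capacity F * upwind v (e_out F) + (1 - capacity F) * v_in v F"
  unfolding flux_value_def by (simp add: inv_into_f_f[OF inj_e_out])

lemma flux_value_other: "e \<notin> e_out ` stab_cells \<Longrightarrow> flux_value v e = upwind v e"
  unfolding flux_value_def by simp

lemma face_seminorm_e_in:
  "F \<in> stab_cells \<Longrightarrow> face_seminorm v (e_in F) = capacity F * ((jump v (e_in F) \<bullet> jump v (e_in F)) * speed (e_in F))"
  unfolding face_seminorm_def by (simp add: inv_into_f_f[OF inj_e_in])

lemma face_seminorm_e_out:
  assumes "F \<in> stab_cells"
  shows "face_seminorm v (e_out F) = capacity F * ((jump v (e_out F) \<bullet> jump v (e_out F)) * speed (e_out F))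
    + (1 - capacity F) * ((v_out v F - v_in v F)\<^sup>2 * speed (e_out F))"
proof -
  have "e_out F \<notin> e_in ` stab_cells" using e_in_neq_e_out[OF _ assms] by force
  then show ?thesis
    unfolding face_seminorm_def using assms by (simp add: inv_into_f_f[OF inj_e_out] Let_def)
qed

lemma face_seminorm_other:
  "e \<notin> e_in ` stab_cells \<Longrightarrow> e \<notin> e_out ` stab_cells \<Longrightarrow> face_seminorm v e = (jump v e \<bullet> jump v e) * speed e"
  unfolding face_seminorm_def by simp

lemma face_seminorm_nonneg:
  assumes "e \<in> faces"
  shows "0 \<le> face_seminorm v e"
proof -
  note S = speed_nonneg[OF assms]
  consider F where "F \<in> stab_cells" "e = e_in F" | F where "F \<in> stab_cells" "e = e_out F"
    | "e \<notin> e_in ` stab_cells" "e \<notin> e_out ` stab_cells" by blast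
  then show ?thesis
  proof cases
    case 1
    then show ?thesis using face_seminorm_e_in[OF 1(1)] capacity_bounds[OF 1(1)] S by simp
  next
    case 2
    then show ?thesis using face_seminorm_e_out[OF 2(1)] capacity_bounds[OF 2(1)] S by simp
  next
    case 3
    then show ?thesis using face_seminorm_other S by simp
  qed
qed

section \<open>Seminorm and bilinear form as sums over faces and cells\<close>

lemma finite_stab: "finite stab_cells"
  using finite_subset[OF stab_subset_cells finite_cells] .

text \<open>The inflow faces, the outflow faces of stabilised cells and all other faces are
  disjoint, and no face belongs to two stabilised cells in the same role. The sum over cells can
  thus be reindexed by faces.\<close>

lemma seminorm_eq: "seminorm_beta v = sqrt (\<Sum>e\<in>faces. face_seminorm v e)"
proof -
  let ?T = "face_seminorm v" and ?I = "e_in ` stab_cells" and ?O = "e_out ` stab_cells"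
  have sub: "?I \<subseteq> faces" "?O \<subseteq> faces" using stab_adjacent by blast+
  have disj: "?I \<inter> ?O = {}" using e_in_neq_e_out by blast
  have fin: "finite ?I" "finite ?O" "finite faces_no_inout"
    using finite_stab finite_faces unfolding faces_no_inout_def by auto
  have "sum ?T faces = sum ?T faces_no_inout + sum ?T (?I \<union> ?O)"
    unfolding faces_no_inout_def using sub by (intro sum.subset_diff finite_faces Un_least)
  also have "sum ?T (?I \<union> ?O) = sum ?T ?I + sum ?T ?O"
    by (rule sum.union_disjoint[OF fin(1,2) disj])
  also have "sum ?T ?I = (\<Sum>F\<in>stab_cells. ?T (e_in F))" by (simp add: sum.reindex[OF inj_e_in])
  also have "sum ?T ?O = (\<Sum>F\<in>stab_cells. ?T (e_out F))" by (simp add: sum.reindex[OF inj_e_out])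
  also have "sum ?T faces_no_inout = (\<Sum>e\<in>faces_no_inout. seg_integral e (\<lambda>x. normal_speed e x * (jump v e \<bullet> jump v e)))"
    by (rule sum.cong[OF refl]) (simp add: faces_no_inout_def face_seminorm_other seg_integral_speed)
  also have "(\<Sum>F\<in>stab_cells. ?T (e_in F)) + (\<Sum>F\<in>stab_cells. ?T (e_out F)) = (\<Sum>F\<in>stab_cells. ?T (e_in F) + ?T (e_out F))"
    by (simp add: sum.distrib)
  also have "\<dots> = (\<Sum>E\<in>stab_cells.
        capacity E * (\<Sum>e\<in>{e_in E, e_out E}.
           seg_integral e (\<lambda>x. normal_speed e x * (jump v e \<bullet> jump v e))) +
        (1 - capacity E) *
           seg_integral (e_out E) (\<lambda>x. normal_speed (e_out E) x * (v_out v E - v_in v E)\<^sup>2))"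
  proof (rule sum.cong[OF refl])
    fix E assume E: "E \<in> stab_cells"
    show "?T (e_in E) + ?T (e_out E) = capacity E * (\<Sum>e\<in>{e_in E, e_out E}.
           seg_integral e (\<lambda>x. normal_speed e x * (jump v e \<bullet> jump v e))) +
        (1 - capacity E) *
           seg_integral (e_out E) (\<lambda>x. normal_speed (e_out E) x * (v_out v E - v_in v E)\<^sup>2)"
      unfolding seg_integral_speed face_seminorm_e_in[OF E] face_seminorm_e_out[OF E]
      using e_in_neq_e_out[OF E E] by (simp add: distrib_left)
  qed
  finally show ?thesis unfolding seminorm_beta_def by simp
qed

text \<open>The net numerical flux out of the cell; divided by the area it is the value of
  \<open>A_DoD v\<close> on the cell.\<close>

definition residual :: "(plane \<Rightarrow> real) \<Rightarrow> plane set \<Rightarrow> real" where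
  "residual v E = (\<Sum>e\<in>cell_faces E. flux_value v e * flux E e)"

text \<open>Discrete summation by parts: the sum over faces and their adjacent cells is exchanged
  for a sum over cells and their faces, which isolates the value of \<open>w\<close> on each
  cell.\<close>

lemma a_DoD_eq:
  assumes v: "v \<in> V0" and w: "w \<in> V0"
  shows "a_DoD v w = (\<Sum>E\<in>cells. val w E * residual v E)"
proof -
  let ?g = "\<lambda>e. \<Sum>E\<in>adjacent_cells e. val w E * (flux_value v e * flux E e)"
  let ?O = "e_out ` stab_cells"
  have sub: "?O \<subseteq> faces" using stab_adjacent by blast
  have "(\<Sum>e\<in>faces_no_out. seg_integral e (\<lambda>x. upwind v e * (\<beta> x \<bullet> jump w e))) = sum ?g faces_no_out"
  proof (rule sum.cong[OF refl])
    fix e assume "e \<in> faces_no_out"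
    then show "seg_integral e (\<lambda>x. upwind v e * (\<beta> x \<bullet> jump w e)) = ?g e"
      unfolding faces_no_out_def by (simp add: face_integral[OF w] flux_value_other)
  qed
  moreover have "(\<Sum>E\<in>stab_cells. seg_integral (e_out E)
        (\<lambda>x. (capacity E * upwind v (e_out E) + (1 - capacity E) * v_in v E) * (\<beta> x \<bullet> jump w (e_out E))))
      = sum ?g ?O"
    unfolding sum.reindex[OF inj_e_out] o_def
  proof (rule sum.cong[OF refl])
    fix E assume E: "E \<in> stab_cells"
    show "seg_integral (e_out E)
        (\<lambda>x. (capacity E * upwind v (e_out E) + (1 - capacity E) * v_in v E) * (\<beta> x \<bullet> jump w (e_out E)))
        = ?g (e_out E)"
      unfolding face_integral[OF w stab_adjacent(5)[OF E]] flux_value_e_out[OF E] ..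
  qed
  moreover have "sum ?g faces_no_out + sum ?g ?O = sum ?g faces"
    unfolding faces_no_out_def by (rule sum.subset_diff[OF sub finite_faces, symmetric])
  ultimately have "a_DoD v w = sum ?g faces" unfolding a_DoD_def by simp
  also have "\<dots> = (\<Sum>e\<in>faces. \<Sum>E | E \<in> cells \<and> e \<in> cell_faces E. val w E * (flux_value v e * flux E e))"
    unfolding adjacent_cells_def ..
  also have "\<dots> = (\<Sum>E\<in>cells. \<Sum>e | e \<in> faces \<and> e \<in> cell_faces E. val w E * (flux_value v e * flux E e))"
    by (rule sum.swap_restrict[OF finite_faces finite_cells])
  also have "\<dots> = (\<Sum>E\<in>cells. val w E * residual v E)"
  proof (rule sum.cong[OF refl])
    fix E assume E: "E \<in> cells"
    have "(\<Sum>e | e \<in> faces \<and> e \<in> cell_faces E. val w E * (flux_value v e * flux E e))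
        = (\<Sum>e\<in>cell_faces E. val w E * (flux_value v e * flux E e))"
      \<comment> \<open>The terms that the restriction to \<open>faces\<close> leaves out vanish,
        because a cell face with nonzero flux always belongs to \<open>faces\<close>.\<close>
      by (rule sum.mono_neutral_left[OF finite_cell_faces[OF E]])
        (use active_in_faces[OF E] in auto)
    then show "(\<Sum>e | e \<in> faces \<and> e \<in> cell_faces E. val w E * (flux_value v e * flux E e)) = val w E * residual v E"
      unfolding residual_def by (simp add: sum_distrib_left)
  qed
  finally show ?thesis .
qed

lemma residual_eq:
  assumes "E \<in> cells"
  shows "residual v E = (\<Sum>e\<in>cell_faces E. (flux_value v e - val v E) * flux E e)"
  using sum_flux[OF assms] unfolding residual_def
  by (simp add: left_diff_distrib sum_subtractf sum_distrib_left[symmetric])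

section \<open>Bounds for the residual of a cell\<close>

lemma C_tr_ge: "4 * beta_max \<le> C_tr" "1 / \<tau> \<le> C_tr" "0 < C_tr"
proof -
  show "4 * beta_max \<le> C_tr" "1 / \<tau> \<le> C_tr" unfolding C_tr_def by auto
  then show "0 < C_tr" using tau_pos by (auto intro: less_le_trans[of 0 "1 / \<tau>"])
qed

text \<open>With \<open>p\<close> the difference across the inflow face, the inflow face contributes
  \<open>- p * B\<close> and the outflow face \<open>(1 - capacity E) * p * B\<close>, because the
  stabilisation replaces that fraction of the cell value by the inflow value. What remains is
  \<open>- capacity E * p * B\<close>. In its square one capacity belongs to the seminorm, and the
  other makes \<open>B * h\<close> comparable to the area.\<close>

lemma residual_bound_stab:
  assumes v: "v \<in> V0" and E: "E \<in> stab_cells"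
  shows "(residual v E)\<^sup>2 * h \<le> C_tr * measure lebesgue E * (\<Sum>e | e \<in> cell_faces E \<and> flux E e < 0. face_seminorm v e)"
proof -
  note s = stab_faces[OF E] and a = stab_adjacent[OF E]
  define B where "B = \<bar>flux E (e_in E)\<bar>"
  define p where "p = upwind v (e_in E) - val v E"
  have B: "flux E (e_in E) = - B" "flux E (e_out E) = B" using s unfolding B_def by auto
  have out: "flux_value v (e_out E) - val v E = (1 - capacity E) * p"
    unfolding flux_value_e_out[OF E] upwind_outflow[OF v a(3,6)] v_in_eq[OF v E] p_def
    by (simp add: algebra_simps)
  have inn: "flux_value v (e_in E) - val v E = p"
    unfolding p_def using e_in_neq_e_out[OF E] by (subst flux_value_other) auto
  have "residual v E = (\<Sum>e\<in>{e_in E, e_out E}. (flux_value v e - val v E) * flux E e)"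
    unfolding residual_eq[OF a(1)]
    by (rule sum.mono_neutral_right[OF finite_cell_faces[OF a(1)]]) (use s in auto)
  also have "\<dots> = (flux_value v (e_in E) - val v E) * flux E (e_in E)
      + (flux_value v (e_out E) - val v E) * flux E (e_out E)"
    using e_in_neq_e_out[OF E E] by simp
  also have "\<dots> = - (capacity E * p * B)"
    unfolding out inn B by (simp add: algebra_simps)
  finally have R: "(residual v E)\<^sup>2 * h = (capacity E * B * h) * (capacity E * (p\<^sup>2 * B))"
    by (simp add: power2_eq_square algebra_simps)
  have "{e. e \<in> cell_faces E \<and> flux E e < 0} = {e_in E}"
    using s(1,3) s(5) a(6) by force
  then have T: "(\<Sum>e | e \<in> cell_faces E \<and> flux E e < 0. face_seminorm v e) = capacity E * (p\<^sup>2 * B)"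
    unfolding B_def p_def using jump_inflow[OF v a(2) s(3)] speed_eq[OF a(2)]
    by (simp add: face_seminorm_e_in[OF E])
  have "capacity E * B * h \<le> (1 / \<tau>) * measure lebesgue E"
    using capacity_bounds(3)[OF E] unfolding B_def by simp
  also have "\<dots> \<le> C_tr * measure lebesgue E" by (intro mult_right_mono C_tr_ge) simp
  finally show ?thesis
    unfolding R T using capacity_bounds[OF E] by (intro mult_right_mono) (simp_all add: B_def)
qed

text \<open>The case of interest is a cell \<open>E\<close> downstream of a stabilised
  \<open>F\<close>. The flux value is a convex combination of the values on \<open>F\<close> and on
  its inflow neighbour; convexity of the square gives the jump and the difference
  \<open>v_out - v_in\<close> with precisely the weights of the seminorm.\<close>

lemma inflow_term_le:
  assumes v: "v \<in> V0" and E: "E \<in> cells" "E \<notin> stab_cells" and e: "e \<in> cell_faces E" "flux E e < 0"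
  shows "\<bar>flux E e\<bar> * (flux_value v e - val v E)\<^sup>2 \<le> face_seminorm v e"
proof -
  have ad: "E \<in> adjacent_cells e" using E(1) e(1) adjacent_iff by blast
  note J = jump_inflow[OF v ad e(2)]
  \<comment> \<open>A face has only one inflow cell; were it a stabilised one, it would be
    \<open>E\<close>. Hence the reduced weight of such a face in the seminorm does not occur
    here.\<close>
  have not_in: "e \<notin> e_in ` stab_cells"
  proof
    assume "e \<in> e_in ` stab_cells"
    then obtain F where F: "F \<in> stab_cells" "e = e_in F" by blast
    have "E = F"
      by (rule same_sign_unique[OF ad]) (use F stab_adjacent(2)[OF F(1)] stab_faces(3)[OF F(1)] e(2) in \<open>auto intro: mult_neg_neg\<close>)
    then show False using F E by blast
  qed
  show ?thesis
  proof (cases "e \<in> e_out ` stab_cells")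
    case True
    then obtain F where F: "F \<in> stab_cells" "e = e_out F" by blast
    note sa = stab_adjacent[OF F(1)]
    define t x y where "t = capacity F" and "x = upwind v e - val v E" and "y = v_in v F - val v E"
    have t: "0 \<le> t" "t \<le> 1" using capacity_bounds[OF F(1)] unfolding t_def by auto
    have "flux_value v e - val v E = t * x + (1 - t) * y"
      unfolding F(2) flux_value_e_out[OF F(1)] t_def x_def y_def by (simp add: algebra_simps)
    then have "\<bar>flux E e\<bar> * (flux_value v e - val v E)\<^sup>2 \<le> \<bar>flux E e\<bar> * (t * x\<^sup>2 + (1 - t) * y\<^sup>2)"
      using convex_square[OF t] by (simp add: mult_left_mono)
    also have "\<dots> = face_seminorm v e"
      unfolding F(2) face_seminorm_e_out[OF F(1)] v_out_eq[OF v F(1) ad[unfolded F(2)] e(2)[unfolded F(2)]]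
        J[unfolded F(2)] speed_eq[OF ad[unfolded F(2)]] t_def x_def y_def
      by (simp add: F(2) power2_commute algebra_simps)
    finally show ?thesis .
  next
    case False
    then show ?thesis
      using face_seminorm_other[OF not_in False] flux_value_other[OF False] J speed_eq[OF ad] by simp
  qed
qed

text \<open>On outflow faces of \<open>E\<close> the flux value is the value on \<open>E\<close>
  itself, so they drop out. For the inflow faces Cauchy-Schwarz is used with the flux as weight,
  which separates the total inflow from the seminorm terms.\<close>

lemma residual_bound_nonstab:
  assumes v: "v \<in> V0" and E: "E \<in> cells" "E \<notin> stab_cells"
  shows "(residual v E)\<^sup>2 * h \<le> C_tr * measure lebesgue E * (\<Sum>e | e \<in> cell_faces E \<and> flux E e < 0. face_seminorm v e)"
proof -
  let ?I = "{e. e \<in> cell_faces E \<and> flux E e < 0}"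
  have fin: "finite (cell_faces E)" by (rule finite_cell_faces[OF E(1)])
  have pos: "(flux_value v e - val v E) * flux E e = 0" if e: "e \<in> cell_faces E" "\<not> flux E e < 0" for e
  proof (cases "flux E e = 0")
    case False
    then have f: "0 < flux E e" using e by simp
    have ad: "E \<in> adjacent_cells e" using E(1) e(1) adjacent_iff by blast
    have "e \<notin> e_out ` stab_cells"
    proof
      assume "e \<in> e_out ` stab_cells"
      then obtain F where F: "F \<in> stab_cells" "e = e_out F" by blast
      have "E = F"
        by (rule same_sign_unique[OF ad]) (use F stab_adjacent(3,6)[OF F(1)] f in auto)
      then show False using F E by blast
    qed
    then show ?thesis using flux_value_other upwind_outflow[OF v ad f] by simp
  qed simp
  have "residual v E = (\<Sum>e\<in>?I. (flux_value v e - val v E) * flux E e)"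
    unfolding residual_eq[OF E(1)] by (rule sum.mono_neutral_right[OF fin]) (use pos in auto)
  \<comment> \<open>On inflow faces the flux is minus its absolute value, which is distributed as
    two square roots over the factors.\<close>
  also have "\<dots> = (\<Sum>e\<in>?I. sqrt \<bar>flux E e\<bar> * (- sqrt \<bar>flux E e\<bar> * (flux_value v e - val v E)))"
    by (rule sum.cong[OF refl]) (simp add: mult.assoc[symmetric])
  finally have R0: "residual v E = (\<Sum>e\<in>?I. sqrt \<bar>flux E e\<bar> * (- sqrt \<bar>flux E e\<bar> * (flux_value v e - val v E)))" .
  have "(residual v E)\<^sup>2 \<le> (\<Sum>e\<in>?I. (sqrt \<bar>flux E e\<bar>)\<^sup>2) * (\<Sum>e\<in>?I. (- sqrt \<bar>flux E e\<bar> * (flux_value v e - val v E))\<^sup>2)"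
    unfolding R0 by (rule Cauchy_Schwarz_ineq_sum)
  then have "(residual v E)\<^sup>2 \<le> (\<Sum>e\<in>?I. \<bar>flux E e\<bar>) * (\<Sum>e\<in>?I. \<bar>flux E e\<bar> * (flux_value v e - val v E)\<^sup>2)"
    by (simp add: power_mult_distrib)
  also have "\<dots> \<le> (\<Sum>e\<in>?I. \<bar>flux E e\<bar>) * (\<Sum>e\<in>?I. face_seminorm v e)"
    using inflow_term_le[OF v E] by (intro mult_left_mono sum_mono sum_nonneg) auto
  finally have R: "(residual v E)\<^sup>2 \<le> (\<Sum>e\<in>?I. \<bar>flux E e\<bar>) * (\<Sum>e\<in>?I. face_seminorm v e)" .
  have Tn: "0 \<le> (\<Sum>e\<in>?I. face_seminorm v e)"
    using active_in_faces[OF E(1)] by (intro sum_nonneg face_seminorm_nonneg) auto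
  \<comment> \<open>The difference of absolute value and flux is twice the absolute value on inflow
    faces and 0 elsewhere. As the fluxes sum to zero, the inflow is half of the total.\<close>
  have "(\<Sum>e\<in>?I. 2 * \<bar>flux E e\<bar>) = (\<Sum>e\<in>cell_faces E. \<bar>flux E e\<bar> - flux E e)"
    by (rule sum.mono_neutral_cong_left[OF fin]) auto
  also have "\<dots> = (\<Sum>e\<in>cell_faces E. \<bar>flux E e\<bar>)" using sum_flux[OF E(1)] by (simp add: sum_subtractf)
  finally have half: "2 * (\<Sum>e\<in>?I. \<bar>flux E e\<bar>) = (\<Sum>e\<in>cell_faces E. \<bar>flux E e\<bar>)"
    by (simp add: sum_distrib_left)
  have "(\<Sum>e\<in>?I. \<bar>flux E e\<bar>) * h \<le> 4 * beta_max * measure lebesgue E"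
    using total_flux_bound[OF E] unfolding half[symmetric] by linarith
  also have "\<dots> \<le> C_tr * measure lebesgue E" by (intro mult_right_mono C_tr_ge) simp
  finally have "(\<Sum>e\<in>?I. \<bar>flux E e\<bar>) * h * (\<Sum>e\<in>?I. face_seminorm v e) \<le> C_tr * measure lebesgue E * (\<Sum>e\<in>?I. face_seminorm v e)"
    using Tn by (rule mult_right_mono)
  moreover have "(residual v E)\<^sup>2 * h \<le> (\<Sum>e\<in>?I. \<bar>flux E e\<bar>) * (\<Sum>e\<in>?I. face_seminorm v e) * h"
    using R h_pos by (intro mult_right_mono) auto
  ultimately show ?thesis by (simp add: mult_ac)
qed

text \<open>Forgetting the cell is injective on pairs of a cell and one of its inflow faces, so no
  face is counted twice.\<close>

lemma sum_inflow_seminorm: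
  "(\<Sum>E\<in>cells. \<Sum>e | e \<in> cell_faces E \<and> flux E e < 0. face_seminorm v e) \<le> (\<Sum>e\<in>faces. face_seminorm v e)"
proof -
  let ?I = "\<lambda>E. {e. e \<in> cell_faces E \<and> flux E e < 0}"
  have fin: "finite (?I E)" if "E \<in> cells" for E using finite_cell_faces[OF that] by simp
  have "(\<Sum>E\<in>cells. \<Sum>e\<in>?I E. face_seminorm v e) = (\<Sum>(E, e)\<in>Sigma cells ?I. face_seminorm v e)"
    using finite_cells fin by (intro sum.Sigma) auto
  also have "\<dots> = (\<Sum>x\<in>Sigma cells ?I. face_seminorm v (snd x))" by (simp add: split_beta')
  also have "\<dots> = sum (face_seminorm v) (snd ` Sigma cells ?I)"
  proof -
    have "inj_on snd (Sigma cells ?I)"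
    proof (rule inj_onI)
      fix x y assume *: "x \<in> Sigma cells ?I" "y \<in> Sigma cells ?I" "snd x = snd y"
      then have "fst x = fst y"
        by (intro same_sign_unique[of _ "snd x"]) (auto simp: adjacent_iff mult_neg_neg)
      then show "x = y" using *(3) by (simp add: prod_eq_iff)
    qed
    then show ?thesis by (simp add: sum.reindex)
  qed
  also have "\<dots> \<le> (\<Sum>e\<in>faces. face_seminorm v e)"
    by (rule sum_mono2[OF finite_faces]) (use active_in_faces face_seminorm_nonneg in auto)
  finally show ?thesis .
qed

text \<open>Cauchy-Schwarz over the cells with the square root of the area as weight: the factor
  with \<open>w\<close> becomes its L2 norm, and the division of the squared residual by the area
  cancels the area in the local bounds.\<close>

lemma a_DoD_bound:
  assumes v: "v \<in> V0" and w: "w \<in> V0"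
  shows "a_DoD v w \<le> sqrt (C_tr / h) * seminorm_beta v * L2_norm w"
proof -
  let ?T = "\<lambda>E. \<Sum>e | e \<in> cell_faces E \<and> flux E e < 0. face_seminorm v e"
  let ?m = "\<lambda>E. measure lebesgue E"
  have bound: "(residual v E / sqrt (?m E))\<^sup>2 \<le> C_tr / h * ?T E" if E: "E \<in> cells" for E
  proof -
    have "(residual v E)\<^sup>2 * h \<le> C_tr * ?m E * ?T E"
      using residual_bound_stab[OF v] residual_bound_nonstab[OF v E] by blast
    then have "(residual v E)\<^sup>2 / ?m E \<le> C_tr / h * ?T E"
      using measure_cells_pos[OF E] h_pos by (simp add: field_simps)
    then show ?thesis using measure_cells_pos[OF E] by (simp add: power_divide)
  qed
  have R0: "a_DoD v w = (\<Sum>E\<in>cells. (val w E * sqrt (?m E)) * (residual v E / sqrt (?m E)))"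
    unfolding a_DoD_eq[OF v w]
  proof (rule sum.cong[OF refl])
    fix E assume "E \<in> cells"
    then have "sqrt (?m E) \<noteq> 0" using measure_cells_pos[of E] by simp
    then show "val w E * residual v E = (val w E * sqrt (?m E)) * (residual v E / sqrt (?m E))" by simp
  qed
  have "(a_DoD v w)\<^sup>2 \<le> (\<Sum>E\<in>cells. (val w E * sqrt (?m E))\<^sup>2) * (\<Sum>E\<in>cells. (residual v E / sqrt (?m E))\<^sup>2)"
    unfolding R0 by (rule Cauchy_Schwarz_ineq_sum)
  also have "(\<Sum>E\<in>cells. (val w E * sqrt (?m E))\<^sup>2) = (\<Sum>E\<in>cells. (val w E)\<^sup>2 * ?m E)"
    by (simp add: power_mult_distrib)
  also have "\<dots> * (\<Sum>E\<in>cells. (residual v E / sqrt (?m E))\<^sup>2)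
      \<le> (\<Sum>E\<in>cells. (val w E)\<^sup>2 * ?m E) * (C_tr / h * (\<Sum>e\<in>faces. face_seminorm v e))"
  proof (rule mult_left_mono)
    have "(\<Sum>E\<in>cells. (residual v E / sqrt (?m E))\<^sup>2) \<le> (\<Sum>E\<in>cells. C_tr / h * ?T E)"
      by (rule sum_mono) (rule bound)
    also have "\<dots> = C_tr / h * (\<Sum>E\<in>cells. ?T E)" by (simp add: sum_distrib_left)
    also have "\<dots> \<le> C_tr / h * (\<Sum>e\<in>faces. face_seminorm v e)"
      using C_tr_ge(3) h_pos by (intro mult_left_mono sum_inflow_seminorm) auto
    finally show "(\<Sum>E\<in>cells. (residual v E / sqrt (?m E))\<^sup>2) \<le> C_tr / h * (\<Sum>e\<in>faces. face_seminorm v e)" .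
  qed (auto intro!: sum_nonneg)
  finally have "sqrt ((a_DoD v w)\<^sup>2) \<le> sqrt ((\<Sum>E\<in>cells. (val w E)\<^sup>2 * ?m E) * (C_tr / h * (\<Sum>e\<in>faces. face_seminorm v e)))"
    by (rule real_sqrt_le_mono)
  then have "\<bar>a_DoD v w\<bar> \<le> L2_norm w * (sqrt (C_tr / h) * seminorm_beta v)"
    unfolding L2_norm_V0[OF w] seminorm_eq by (simp only: real_sqrt_abs real_sqrt_mult)
  then show ?thesis by (simp add: mult_ac)
qed

text \<open>\<open>A_DoD\<close> is a choice, so a representing function has to be exhibited: the
  one with value residual divided by area on each cell, which is well defined since cells have
  positive area.\<close>

lemma A_DoD_properties:
  assumes "v \<in> V0"
  shows "A_DoD v \<in> V0" "\<And>w. w \<in> V0 \<Longrightarrow> L2_inner (A_DoD v) w = a_DoD v w"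
proof -
  let ?u = "step (\<lambda>E. residual v E / measure lebesgue E)"
  have "L2_inner ?u w = a_DoD v w" if w: "w \<in> V0" for w
    unfolding L2_inner_V0[OF step_in_V0 w] a_DoD_eq[OF assms w]
  proof (rule sum.cong[OF refl])
    fix E assume E: "E \<in> cells"
    show "val ?u E * val w E * measure lebesgue E = val w E * residual v E"
      unfolding val_step[OF E] using measure_cells_pos[OF E] by simp
  qed
  then have "?u \<in> V0 \<and> (\<forall>w\<in>V0. L2_inner ?u w = a_DoD v w)" using step_in_V0 by blast
  then have "A_DoD v \<in> V0 \<and> (\<forall>w\<in>V0. L2_inner (A_DoD v) w = a_DoD v w)"
    unfolding A_DoD_def by (rule someI[of "\<lambda>u. u \<in> V0 \<and> (\<forall>w\<in>V0. L2_inner u w = a_DoD v w)"])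
  then show "A_DoD v \<in> V0" "\<And>w. w \<in> V0 \<Longrightarrow> L2_inner (A_DoD v) w = a_DoD v w" by blast+
qed

lemma A_DoD_bound:
  assumes v: "v \<in> V0"
  shows "L2_norm (A_DoD v) \<le> sqrt (C_tr / h) * seminorm_beta v"
proof -
  note A = A_DoD_properties[OF v]
  have nonneg: "0 \<le> sqrt (C_tr / h) * seminorm_beta v"
    unfolding seminorm_eq using C_tr_ge(3) h_pos face_seminorm_nonneg by (simp add: sum_nonneg)
  have "0 \<le> L2_inner (A_DoD v) (A_DoD v)" unfolding L2_inner_V0[OF A(1) A(1)] by (intro sum_nonneg) simp
  then have "(L2_norm (A_DoD v))\<^sup>2 = L2_inner (A_DoD v) (A_DoD v)"
    unfolding L2_norm_def L2_inner_def by (simp add: power2_eq_square)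
  also have "\<dots> = a_DoD v (A_DoD v)" by (rule A(2)[OF A(1)])
  also have "\<dots> \<le> sqrt (C_tr / h) * seminorm_beta v * L2_norm (A_DoD v)" by (rule a_DoD_bound[OF v A(1)])
  finally have sq: "L2_norm (A_DoD v) * L2_norm (A_DoD v) \<le> (sqrt (C_tr / h) * seminorm_beta v) * L2_norm (A_DoD v)"
    by (simp add: power2_eq_square)
  show ?thesis
  proof (cases "0 < L2_norm (A_DoD v)")
    case True
    then show ?thesis using sq by simp
  next
    case False
    then show ?thesis using nonneg by linarith
  qed
qed

end

theorem lemma4p6:
  fixes L x0 \<gamma> h \<tau> :: real
    and \<beta> :: "real \<times> real \<Rightarrow> real \<times> real"
    and v w :: "real \<times> real \<Rightarrow> real"
  assumes "dod_setting L x0 \<gamma> h \<tau> \<beta>"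
    and "v \<in> dod_data.V0 L x0 \<gamma> h"
    and "w \<in> dod_data.V0 L x0 \<gamma> h"
  shows "dod_data.a_DoD L x0 \<gamma> h \<tau> \<beta> v w
           \<le> sqrt (dod_data.C_tr L x0 \<gamma> \<tau> \<beta> / h)
              * dod_data.seminorm_beta L x0 \<gamma> h \<tau> \<beta> v * dod_data.L2_norm L x0 \<gamma> w
         \<and> dod_data.L2_norm L x0 \<gamma> (dod_data.A_DoD L x0 \<gamma> h \<tau> \<beta> v)
           \<le> sqrt (dod_data.C_tr L x0 \<gamma> \<tau> \<beta> / h)
              * dod_data.seminorm_beta L x0 \<gamma> h \<tau> \<beta> v"
  using dod_setting.a_DoD_bound[OF assms] dod_setting.A_DoD_bound[OF assms(1,2)] by (rule conjI)

end
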